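(* Let $M$ be a compact Riemannian manifold of dimension $d\ge2$ with volume measure $Leb$, and let $1\le p<\infty$. Endow $\mathrm{Aut}_{Leb}(M)\times L^p(M,SL(2,\mathbb{R}))$ with the separate topology associated with the weak topology $\mathcal{W}$ on $\mathrm{Aut}_{Leb}(M)$ and the $L^p$-norm topology on $L^p(M,SL(2,\mathbb{R}))$. There exists a residual subset $\mathcal{R}\subset\mathrm{Aut}_{Leb}(M)\times L^p(M,SL(2,\mathbb{R}))$ such that every $(f,A)\in\mathcal{R}$ has trivial spectrum.
   Context: $\mathrm{Aut}_{Leb}(M)$ is the space of bi-measurable bijections of $M$ preserving $Leb$ (identified when equal a.e.), with the weak topology $\mathcal{W}$: $f_n\to f$ iff $Leb(f_n(K)\,\triangle\, f(K))\to0$ for every measurable $K\subset M$. $L^p(M,SL(2,\mathbb{R}))$ is the space of measurable maps $A:M\to SL(2,\mathbb{R})$ (modulo a.e. equality) with $\int_M\|A(x)\|^p\,dLeb(x)<\infty$, with distance $\|A-B\|_{L^p}=\left(\int_M\|A(x)-B(x)\|^p\,dLeb(x)\right)^{1/p}$. Separate topology on a product $X\times Y$ of topological spaces: $U\subset X\times Y$ is open iff for every $(x,y)\in U$ the sections $\{x'\in X:(x',y)\in U\}$ and $\{y'\in Y:(x,y')\in U\}$ are open in $X$ and $Y$ respectively. A subset is residual if it contains a countable intersection of open dense sets. For $(f,A)$ put $A^n(x)=A(f^{n-1}(x))\cdots A(f(x))A(x)$ for $n\ge1$ and $\lambda^+(f,A,x)=\lim_{n\to+\infty}\frac1n\log\|A^n(x)\|\ge0$,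 which exists for $Leb$-a.e. $x$; the Lyapunov exponents at $x$ are $\pm\lambda^+(f,A,x)$. The pair $(f,A)$ has trivial spectrum if all Lyapunov exponents are equal, i.e. $\lambda^+(f,A,x)=0$ for $Leb$-a.e. $x$. *)

theory Defs
  imports "HOL-Analysis.Analysis"
begin

section \<open>Riemannian manifolds and their volume measure\<close>

text \<open>
  A manifold is a Hausdorff second countable type \<open>'a\<close> with a smooth atlas; a chart is a pair
  \<open>(U, \<phi>)\<close> of its domain and its coordinate map, whose values outside \<open>U\<close> are irrelevant.
  The dimension is \<open>CARD('n)\<close>.
\<close>

type_synonym ('a, 'n) chart = "'a set \<times> ('a \<Rightarrow> real^'n)"

primrec Ck_on :: "nat \<Rightarrow> ('a::real_normed_vector \<Rightarrow> 'b::real_normed_vector) \<Rightarrow> 'a set \<Rightarrow> bool" where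
  "Ck_on 0 f S \<longleftrightarrow> continuous_on S f"
| "Ck_on (Suc k) f S \<longleftrightarrow> (\<forall>x\<in>S. f differentiable (at x)) \<and>
     (\<forall>v. Ck_on k (\<lambda>x. frechet_derivative f (at x) v) S)"

text \<open>Only meaningful for open \<open>S\<close>, since full derivatives are taken at the points of \<open>S\<close>.\<close>

definition smooth_on :: "('a::real_normed_vector \<Rightarrow> 'b::real_normed_vector) \<Rightarrow> 'a set \<Rightarrow> bool" where
  "smooth_on f S \<longleftrightarrow> (\<forall>k. Ck_on k f S)"

definition is_chart :: "('a::topological_space, 'n::finite) chart \<Rightarrow> bool" where
  "is_chart c \<longleftrightarrow> (case c of (U, \<phi>) \<Rightarrow>
     open U \<and> open (\<phi> ` U) \<and> homeomorphism U (\<phi> ` U) \<phi> (inv_into U \<phi>))"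

definition transition :: "('a, 'n::finite) chart \<Rightarrow> ('a, 'n) chart \<Rightarrow> real^'n \<Rightarrow> real^'n" where
  "transition c c' = snd c' \<circ> inv_into (fst c) (snd c)"

text \<open>The part of the coordinate range of \<open>c\<close> on which \<open>transition c c'\<close> is meaningful.\<close>

definition overlap :: "('a, 'n::finite) chart \<Rightarrow> ('a, 'n) chart \<Rightarrow> (real^'n) set" where
  "overlap c c' = snd c ` (fst c \<inter> fst c')"

definition smooth_atlas :: "('a::topological_space, 'n::finite) chart set \<Rightarrow> bool" where
  "smooth_atlas \<A> \<longleftrightarrow>
     (\<forall>c\<in>\<A>. is_chart c) \<and>
     (\<Union>c\<in>\<A>. fst c) = UNIV \<and>
     (\<forall>c\<in>\<A>. \<forall>c'\<in>\<A>. smooth_on (transition c c') (overlap c c'))"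

text \<open>
  A Riemannian metric is given by its component matrices \<open>g c y = (g\<^sub>i\<^sub>j(y))\<close> in every chart \<open>c\<close>,
  at the coordinate point \<open>y\<close>; the last clause is the transformation law of a covariant 2-tensor.
\<close>

definition riemannian_metric ::
  "('a::topological_space, 'n::finite) chart set \<Rightarrow> (('a, 'n) chart \<Rightarrow> real^'n \<Rightarrow> real^'n^'n) \<Rightarrow> bool"
where
  "riemannian_metric \<A> g \<longleftrightarrow>
     (\<forall>c\<in>\<A>. smooth_on (g c) (snd c ` fst c)) \<and>
     (\<forall>c\<in>\<A>. \<forall>y \<in> snd c ` fst c. transpose (g c y) = g c y \<and> (\<forall>v. v \<noteq> 0 \<longrightarrow> v \<bullet> (g c y *v v) > 0)) \<and>
     (\<forall>c\<in>\<A>. \<forall>c'\<in>\<A>. \<forall>y \<in> overlap c c'.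
        let J = jacobian (transition c c') (at y)
        in g c y = transpose J ** g c' (transition c c' y) ** J)"

text \<open>
  The Riemannian volume is the unique Borel measure which in every chart has density
  \<open>sqrt (det (g\<^sub>i\<^sub>j))\<close> with respect to Lebesgue measure.
\<close>

definition riemannian_volume ::
  "('a::topological_space, 'n::finite) chart set \<Rightarrow> (('a, 'n) chart \<Rightarrow> real^'n \<Rightarrow> real^'n^'n) \<Rightarrow>
   'a measure \<Rightarrow> bool"
where
  "riemannian_volume \<A> g \<mu> \<longleftrightarrow>
     sets \<mu> = sets borel \<and>
     (\<forall>c\<in>\<A>. \<forall>E\<in>sets borel. E \<subseteq> fst c \<longrightarrow>
        emeasure \<mu> E = (\<integral>\<^sup>+y \<in> snd c ` E. ennreal (sqrt (det (g c y))) \<partial>lborel))"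


section \<open>Spaces of maps modulo almost everywhere equality\<close>

definition ae_rel :: "'a measure \<Rightarrow> ('a \<Rightarrow> 'b) set \<Rightarrow> (('a \<Rightarrow> 'b) \<times> ('a \<Rightarrow> 'b)) set" where
  "ae_rel \<mu> X = {(f, g). f \<in> X \<and> g \<in> X \<and> (AE x in \<mu>. f x = g x)}"

lemma equiv_ae_rel: "equiv X (ae_rel \<mu> X)"
proof (rule equivI)
  show "ae_rel \<mu> X \<subseteq> X \<times> X" by (auto simp: ae_rel_def)
  show "refl_on X (ae_rel \<mu> X)" by (auto simp: ae_rel_def refl_on_def)
  show "sym (ae_rel \<mu> X)" by (auto simp: ae_rel_def sym_def eq_commute)
  show "trans (ae_rel \<mu> X)"
  proof (rule transI)
    fix f g h assume fg: "(f, g) \<in> ae_rel \<mu> X" and gh: "(g, h) \<in> ae_rel \<mu> X"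
    then have "AE x in \<mu>. f x = g x" "AE x in \<mu>. g x = h x" by (auto simp: ae_rel_def)
    then have "AE x in \<mu>. f x = h x" by eventually_elim simp
    then show "(f, h) \<in> ae_rel \<mu> X" using fg gh by (simp add: ae_rel_def)
  qed
qed

definition automorphisms :: "'a measure \<Rightarrow> ('a \<Rightarrow> 'a) set" where
  "automorphisms \<mu> = {f. bij f \<and> f \<in> measurable \<mu> \<mu> \<and> inv f \<in> measurable \<mu> \<mu> \<and> distr \<mu> \<mu> f = \<mu>}"

definition Aut :: "'a measure \<Rightarrow> ('a \<Rightarrow> 'a) set set" where
  "Aut \<mu> = automorphisms \<mu> // ae_rel \<mu> (automorphisms \<mu>)"

definition weak_nbhd :: "'a measure \<Rightarrow> ('a \<Rightarrow> 'a) \<Rightarrow> 'a set \<Rightarrow> real \<Rightarrow> ('a \<Rightarrow> 'a) set set" where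
  "weak_nbhd \<mu> f K e =
     {F \<in> Aut \<mu>. \<exists>g\<in>F. measure \<mu> (sym_diff (g ` K) (f ` K)) < e}"

text \<open>Its convergent sequences are described in \<open>limitin_weak_topology\<close> below.\<close>

definition weak_topology :: "'a measure \<Rightarrow> ('a \<Rightarrow> 'a) set topology" where
  "weak_topology \<mu> =
     topology_generated_by {weak_nbhd \<mu> f K e | f K e. f \<in> automorphisms \<mu> \<and> K \<in> sets \<mu> \<and> e > 0}"

definition SL2 :: "(real^2^2) set" where
  "SL2 = {A. det A = 1}"

definition matrix_norm :: "real^2^2 \<Rightarrow> real" where
  "matrix_norm A = onorm ((*v) A)"

definition Lp_maps :: "'a measure \<Rightarrow> real \<Rightarrow> ('a \<Rightarrow> real^2^2) set" where
  "Lp_maps \<mu> p = {A \<in> borel_measurable \<mu>. range A \<subseteq> SL2 \<and> integrable \<mu> (\<lambda>x. matrix_norm (A x) powr p)}"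

definition Lp_SL2 :: "'a measure \<Rightarrow> real \<Rightarrow> ('a \<Rightarrow> real^2^2) set set" where
  "Lp_SL2 \<mu> p = Lp_maps \<mu> p // ae_rel \<mu> (Lp_maps \<mu> p)"

text \<open>The integral below does not depend on the chosen representatives.\<close>

definition Lp_dist ::
  "'a measure \<Rightarrow> real \<Rightarrow> ('a \<Rightarrow> real^2^2) set \<Rightarrow> ('a \<Rightarrow> real^2^2) set \<Rightarrow> real" where
  "Lp_dist \<mu> p \<alpha> \<beta> = (let A = (SOME A. A \<in> \<alpha>); B = (SOME B. B \<in> \<beta>)
     in (\<integral>x. matrix_norm (A x - B x) powr p \<partial>\<mu>) powr (1 / p))"

definition Lp_topology :: "'a measure \<Rightarrow> real \<Rightarrow> ('a \<Rightarrow> real^2^2) set topology" where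
  "Lp_topology \<mu> p = Metric_space.mtopology (Lp_SL2 \<mu> p) (Lp_dist \<mu> p)"


section \<open>Separate topology and residual sets\<close>

definition separately_open :: "'a topology \<Rightarrow> 'b topology \<Rightarrow> ('a \<times> 'b) set \<Rightarrow> bool" where
  "separately_open X Y U \<longleftrightarrow> U \<subseteq> topspace X \<times> topspace Y \<and>
     (\<forall>(x, y) \<in> U. openin X {x' \<in> topspace X. (x', y) \<in> U} \<and> openin Y {y' \<in> topspace Y. (x, y') \<in> U})"

definition separate_topology :: "'a topology \<Rightarrow> 'b topology \<Rightarrow> ('a \<times> 'b) topology" where
  "separate_topology X Y = topology (separately_open X Y)"

lemma istopology_separately_open: "istopology (separately_open X Y)"
  unfolding istopology_def
proof safe
  fix S T assume S: "separately_open X Y S" and T: "separately_open X Y T"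
  have "{x' \<in> topspace X. (x', y) \<in> S \<inter> T}
      = {x' \<in> topspace X. (x', y) \<in> S} \<inter> {x' \<in> topspace X. (x', y) \<in> T}"
    "{y' \<in> topspace Y. (x, y') \<in> S \<inter> T}
      = {y' \<in> topspace Y. (x, y') \<in> S} \<inter> {y' \<in> topspace Y. (x, y') \<in> T}" for x y
    by auto
  then show "separately_open X Y (S \<inter> T)"
    using S T unfolding separately_open_def
    by (smt (verit, best) Int_iff case_prodD case_prodI2 inf.coboundedI1 openin_Int)
next
  fix \<K> assume K: "\<forall>U\<in>\<K>. separately_open X Y U"
  have "openin X {x' \<in> topspace X. (x', y) \<in> U}" "openin Y {y' \<in> topspace Y. (x, y') \<in> U}"
    if "U \<in> \<K>" for U x y
  proof -
    have U: "separately_open X Y U" using K that by blast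
    show "openin X {x' \<in> topspace X. (x', y) \<in> U}"
    proof (cases "\<exists>x'. (x', y) \<in> U")
      case True
      then show ?thesis using U unfolding separately_open_def by blast
    next
      case False
      then show ?thesis by simp
    qed
    show "openin Y {y' \<in> topspace Y. (x, y') \<in> U}"
    proof (cases "\<exists>y'. (x, y') \<in> U")
      case True
      then show ?thesis using U unfolding separately_open_def by blast
    next
      case False
      then show ?thesis by simp
    qed
  qed
  moreover have "{x' \<in> topspace X. (x', y) \<in> \<Union>\<K>} = (\<Union>U\<in>\<K>. {x' \<in> topspace X. (x', y) \<in> U})"
    "{y' \<in> topspace Y. (x, y') \<in> \<Union>\<K>} = (\<Union>U\<in>\<K>. {y' \<in> topspace Y. (x, y') \<in> U})" for x y
    by auto
  ultimately have "openin X {x' \<in> topspace X. (x', y) \<in> \<Union>\<K>}" "openin Y {y' \<in> topspace Y. (x, y') \<in> \<Union>\<K>}"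
    for x y by auto
  moreover have "\<Union>\<K> \<subseteq> topspace X \<times> topspace Y"
    using K unfolding separately_open_def by blast
  ultimately show "separately_open X Y (\<Union>\<K>)"
    unfolding separately_open_def by blast
qed

lemma openin_separate_topology: "openin (separate_topology X Y) = separately_open X Y"
  by (simp add: separate_topology_def istopology_separately_open topology_inverse')

lemma topspace_separate_topology: "topspace (separate_topology X Y) = topspace X \<times> topspace Y"
proof
  show "topspace (separate_topology X Y) \<subseteq> topspace X \<times> topspace Y"
    by (metis openin_separate_topology openin_topspace separately_open_def)
  have "separately_open X Y (topspace X \<times> topspace Y)"
    unfolding separately_open_def by auto
  then show "topspace X \<times> topspace Y \<subseteq> topspace (separate_topology X Y)"
    by (metis openin_separate_topology openin_subset)
qed

definition residual_in :: "'a topology \<Rightarrow> 'a set \<Rightarrow> bool" where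
  "residual_in Z R \<longleftrightarrow> R \<subseteq> topspace Z \<and>
     (\<exists>\<G>. countable \<G> \<and> (\<forall>G\<in>\<G>. openin Z G \<and> Z closure_of G = topspace Z) \<and>
          topspace Z \<inter> \<Inter>\<G> \<subseteq> R)"


section \<open>Lyapunov exponents\<close>

primrec cocycle :: "('a \<Rightarrow> 'a) \<Rightarrow> ('a \<Rightarrow> real^2^2) \<Rightarrow> nat \<Rightarrow> 'a \<Rightarrow> real^2^2" where
  "cocycle f A 0 x = mat 1"
| "cocycle f A (Suc n) x = A ((f ^^ n) x) ** cocycle f A n x"

definition lyapunov_seq :: "('a \<Rightarrow> 'a) \<Rightarrow> ('a \<Rightarrow> real^2^2) \<Rightarrow> 'a \<Rightarrow> nat \<Rightarrow> real" where
  "lyapunov_seq f A x n = ln (matrix_norm (cocycle f A n x)) / real n"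

definition lyapunov_exponent :: "('a \<Rightarrow> 'a) \<Rightarrow> ('a \<Rightarrow> real^2^2) \<Rightarrow> 'a \<Rightarrow> real" where
  "lyapunov_exponent f A x = lim (lyapunov_seq f A x)"

text \<open>Convergence is part of the condition because \<open>lim\<close> is arbitrary on divergent sequences.\<close>

definition trivial_spectrum :: "'a measure \<Rightarrow> ('a \<Rightarrow> 'a) \<Rightarrow> ('a \<Rightarrow> real^2^2) \<Rightarrow> bool" where
  "trivial_spectrum \<mu> f A \<longleftrightarrow>
     (AE x in \<mu>. convergent (lyapunov_seq f A x) \<and> lyapunov_exponent f A x = 0)"


section \<open>Convergence in the weak topology\<close>

lemma automorphisms_image:
  assumes "f \<in> automorphisms \<mu>" "K \<in> sets \<mu>" "space \<mu> = UNIV"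
  shows "f ` K \<in> sets \<mu>" "emeasure \<mu> (f ` K) = emeasure \<mu> K"
proof -
  have f: "bij f" "f \<in> measurable \<mu> \<mu>" "inv f \<in> measurable \<mu> \<mu>" "distr \<mu> \<mu> f = \<mu>"
    using assms by (auto simp: automorphisms_def)
  have "f ` K = inv f -` K \<inter> space \<mu>"
    using f(1) assms(3) by (simp add: bij_vimage_eq_inv_image bij_imp_bij_inv inv_inv_eq)
  then show K: "f ` K \<in> sets \<mu>"
    using f(3) assms(2) measurable_sets by metis
  have "emeasure \<mu> (f ` K) = emeasure (distr \<mu> \<mu> f) (f ` K)"
    by (simp add: f(4))
  also have "\<dots> = emeasure \<mu> (f -` (f ` K) \<inter> space \<mu>)"
    by (rule emeasure_distr[OF f(2) K])
  also have "f -` (f ` K) \<inter> space \<mu> = K"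
    using f(1) assms(3) by (simp add: bij_is_inj inj_vimage_image_eq)
  finally show "emeasure \<mu> (f ` K) = emeasure \<mu> K" .
qed

lemma automorphisms_image_ae:
  fixes \<mu> :: "'a measure"
  assumes f: "f \<in> automorphisms \<mu>" and g: "g \<in> automorphisms \<mu>" and K: "K \<in> sets \<mu>"
    and UNIV: "space \<mu> = UNIV" and ae: "AE x in \<mu>. f x = g x"
  shows "AE y in \<mu>. y \<in> f ` K \<longleftrightarrow> y \<in> g ` K"
proof -
  obtain N where N: "N \<in> null_sets \<mu>" "{x \<in> space \<mu>. \<not> (f x = g x)} \<subseteq> N"
    using AE_E[OF ae] by (metis null_setsI)
  have "h ` N \<in> null_sets \<mu>" if "h \<in> automorphisms \<mu>" for h
    using N(1) automorphisms_image[OF that _ UNIV, of N] by (simp add: null_sets_def)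
  then have "f ` N \<union> g ` N \<in> null_sets \<mu>" using f g by blast
  moreover have "y \<in> f ` K \<longleftrightarrow> y \<in> g ` K" if "y \<notin> f ` N \<union> g ` N" for y
  proof -
    have eq: "f x = g x" if "x \<notin> N" for x using N(2) UNIV that by blast
    have "y \<in> h' ` K" if "y \<in> h ` K" "y \<notin> h ` N" "\<And>x. x \<notin> N \<Longrightarrow> h x = h' x" for h h' :: "'a \<Rightarrow> 'a"
      using that by force
    from this[of f g] this[of g f] show ?thesis using that eq by auto
  qed
  ultimately show ?thesis
    by (intro AE_I'[of "f ` N \<union> g ` N"]) auto
qed

lemma measure_sym_diff_ae:
  assumes f: "f \<in> automorphisms \<mu>" "f' \<in> automorphisms \<mu>" "AE x in \<mu>. f x = f' x"
    and g: "g \<in> automorphisms \<mu>" "g' \<in> automorphisms \<mu>" "AE x in \<mu>. g x = g' x"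
    and K: "K \<in> sets \<mu>" and UNIV: "space \<mu> = UNIV"
  shows "measure \<mu> (sym_diff (f ` K) (g ` K)) = measure \<mu> (sym_diff (f' ` K) (g' ` K))"
proof (rule measure_eq_AE)
  show "AE x in \<mu>. (x \<in> f ` K - g ` K \<union> (g ` K - f ` K)) = (x \<in> f' ` K - g' ` K \<union> (g' ` K - f' ` K))"
    using automorphisms_image_ae[OF f(1,2) K UNIV f(3)] automorphisms_image_ae[OF g(1,2) K UNIV g(3)]
    by eventually_elim auto
  have "f ` K \<in> sets \<mu>" "f' ` K \<in> sets \<mu>" "g ` K \<in> sets \<mu>" "g' ` K \<in> sets \<mu>"
    using f g by (simp_all add: automorphisms_image(1)[OF _ K UNIV])
  then show "sym_diff (f ` K) (g ` K) \<in> sets \<mu>" "sym_diff (f' ` K) (g' ` K) \<in> sets \<mu>"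
    by (simp_all add: sets.Un sets.Diff)
qed

lemma topspace_weak_topology: "topspace (weak_topology \<mu>) = Aut \<mu>"
proof -
  have "\<exists>f. f \<in> automorphisms \<mu> \<and> F \<in> weak_nbhd \<mu> f {} 1" if F: "F \<in> Aut \<mu>" for F
  proof -
    obtain f where f: "f \<in> automorphisms \<mu>" "F = ae_rel \<mu> (automorphisms \<mu>) `` {f}"
      using F unfolding Aut_def by (meson quotientE)
    then have "f \<in> F" by (simp add: ae_rel_def)
    then show ?thesis using f(1) F by (auto simp: weak_nbhd_def)
  qed
  then have "Aut \<mu> \<subseteq> (\<Union>f\<in>automorphisms \<mu>. weak_nbhd \<mu> f {} 1)" by blast
  also have "\<dots> \<subseteq> topspace (weak_topology \<mu>)"
    unfolding weak_topology_def topology_generated_by_topspace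
    by (intro UN_least Union_upper CollectI exI[of _ "{}"] exI[of _ "1::real"] exI conjI refl) auto
  finally have "Aut \<mu> \<subseteq> topspace (weak_topology \<mu>)" .
  moreover have "topspace (weak_topology \<mu>) \<subseteq> Aut \<mu>"
    unfolding weak_topology_def topology_generated_by_topspace weak_nbhd_def by blast
  ultimately show ?thesis by blast
qed

lemma limitin_weak_topology:
  fixes \<mu> :: "'a measure" and F :: "nat \<Rightarrow> 'a \<Rightarrow> 'a"
  assumes "finite_measure \<mu>" and UNIV: "space \<mu> = UNIV"
    and F: "\<And>n. F n \<in> automorphisms \<mu>" and f: "f \<in> automorphisms \<mu>"
  defines "cls \<equiv> \<lambda>h. ae_rel \<mu> (automorphisms \<mu>) `` {h}"
  shows "limitin (weak_topology \<mu>) (\<lambda>n. cls (F n)) (cls f) sequentially \<longleftrightarrow>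
    (\<forall>K\<in>sets \<mu>. (\<lambda>n. measure \<mu> (sym_diff (F n ` K) (f ` K))) \<longlonglongrightarrow> 0)"
    (is "?lhs \<longleftrightarrow> ?rhs")
proof -
  interpret finite_measure \<mu> by fact
  define d where "d = (\<lambda>(K::'a set) (g::'a \<Rightarrow> 'a) (h::'a \<Rightarrow> 'a). measure \<mu> (sym_diff (g ` K) (h ` K)))"
  have img: "g ` K \<in> sets \<mu>" if "g \<in> automorphisms \<mu>" "K \<in> sets \<mu>" for g K
    using automorphisms_image(1) that UNIV by blast
  have cls_Aut: "cls g \<in> Aut \<mu>" if "g \<in> automorphisms \<mu>" for g
    using that by (auto simp: Aut_def cls_def intro: quotientI)
  have mem: "cls g \<in> weak_nbhd \<mu> h K e \<longleftrightarrow> d K g h < e"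
    if g: "g \<in> automorphisms \<mu>" and h: "h \<in> automorphisms \<mu>" and K: "K \<in> sets \<mu>" for g h K e
  proof -
    have eq: "d K g' h = d K g h" if "g' \<in> cls g" for g'
    proof -
      have g': "g' \<in> automorphisms \<mu>" "AE x in \<mu>. g' x = g x"
        using \<open>g' \<in> cls g\<close> by (auto simp: cls_def ae_rel_def eq_commute)
      show ?thesis
        unfolding d_def using measure_sym_diff_ae[OF g'(1) g g'(2) h h _ K UNIV] by simp
    qed
    have "g \<in> cls g" using that by (auto simp: cls_def ae_rel_def)
    then have "(\<exists>g'\<in>cls g. d K g' h < e) \<longleftrightarrow> d K g h < e" using eq by metis
    then show ?thesis using cls_Aut that by (simp add: weak_nbhd_def d_def)
  qed
  have tri: "d K g h \<le> d K g k + d K k h"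
    if "g \<in> automorphisms \<mu>" "h \<in> automorphisms \<mu>" "k \<in> automorphisms \<mu>" "K \<in> sets \<mu>" for g h k K
  proof -
    have s: "g ` K \<in> sets \<mu>" "h ` K \<in> sets \<mu>" "k ` K \<in> sets \<mu>" using img that by auto
    have "d K g h \<le> measure \<mu> (sym_diff (g ` K) (k ` K) \<union> sym_diff (k ` K) (h ` K))"
      unfolding d_def using s by (intro finite_measure_mono) auto
    also have "\<dots> \<le> d K g k + d K k h"
      unfolding d_def using s by (intro measure_Un_le) auto
    finally show ?thesis .
  qed
  show ?thesis
  proof
    assume L: ?lhs
    show ?rhs
    proof
      fix K assume K: "K \<in> sets \<mu>"
      have "(\<lambda>n. d K (F n) f) \<longlonglongrightarrow> 0"
      proof (rule order_tendstoI)
        fix a :: real assume "a < 0"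
        then show "\<forall>\<^sub>F n in sequentially. a < d K (F n) f"
          by (intro always_eventually allI) (auto simp: d_def intro: less_le_trans)
      next
        fix e :: real assume e: "0 < e"
        have "openin (weak_topology \<mu>) (weak_nbhd \<mu> f K e)"
          unfolding weak_topology_def by (rule topology_generated_by_Basis) (use f K e in blast)
        moreover have "cls f \<in> weak_nbhd \<mu> f K e"
          using mem[OF f f K] e by (simp add: d_def)
        ultimately have "\<forall>\<^sub>F n in sequentially. cls (F n) \<in> weak_nbhd \<mu> f K e"
          using L by (auto simp: limitin_def)
        then show "\<forall>\<^sub>F n in sequentially. d K (F n) f < e"
          using mem[OF F f K] by simp
      qed
      then show "(\<lambda>n. measure \<mu> (sym_diff (F n ` K) (f ` K))) \<longlonglongrightarrow> 0"
        by (simp add: d_def)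
    qed
  next
    assume R: ?rhs
    let ?S = "{weak_nbhd \<mu> f K e | f K e. f \<in> automorphisms \<mu> \<and> K \<in> sets \<mu> \<and> e > 0}"
    have ev: "cls f \<in> U \<longrightarrow> (\<forall>\<^sub>F n in sequentially. cls (F n) \<in> U)" if "generate_topology_on ?S U" for U
      using that
    proof (induction rule: generate_topology_on.induct)
      case Empty then show ?case by simp
    next
      case (Int a b) then show ?case by (auto intro: eventually_conj)
    next
      case (UN \<K>) then show ?case by (smt (verit) UnionE UnionI eventually_mono)
    next
      case (Basis U)
      then obtain h K e where U: "U = weak_nbhd \<mu> h K e" and h: "h \<in> automorphisms \<mu>" and K: "K \<in> sets \<mu>"
        by blast
      show ?case
      proof
        assume "cls f \<in> U"
        then have "d K f h < e" using mem[OF f h K] U by simp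
        moreover have "(\<lambda>n. d K (F n) f) \<longlonglongrightarrow> 0" using R K by (simp add: d_def)
        ultimately have "\<forall>\<^sub>F n in sequentially. d K (F n) f < e - d K f h"
          by (intro order_tendstoD) auto
        then show "\<forall>\<^sub>F n in sequentially. cls (F n) \<in> U"
        proof eventually_elim
          case (elim n)
          then have "d K (F n) h < e" using tri[OF F h f K, of n] by simp
          then show ?case using mem[OF F h K] U by simp
        qed
      qed
    qed
    show ?lhs
      unfolding limitin_def
    proof (intro conjI allI impI)
      show "cls f \<in> topspace (weak_topology \<mu>)"
        using topspace_weak_topology cls_Aut f by metis
      fix U assume U: "openin (weak_topology \<mu>) U \<and> cls f \<in> U"
      then show "\<forall>\<^sub>F n in sequentially. cls (F n) \<in> U"
        using ev by (auto simp: weak_topology_def openin_topology_generated_by_iff)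
    qed
  qed
qed

end

theory Submission
  imports Defs "HOL-Probability.Weak_Convergence"
begin

text \<open>
  Call \<open>(f, A)\<close> slow with accuracy \<open>1 / (k + 1)\<close> if at some time \<open>n \<ge> 1\<close> the growth rate
  \<open>ln \<parallel>A\<^sup>n(x)\<parallel> / n\<close> is below \<open>1 / (k + 1)\<close> outside a set of measure less than \<open>1 / (k + 1)\<close>. The residual set is
  the intersection of the sets \<open>slow_pairs p k\<close> of pairs with this property. Three facts are needed.

  A pair that is slow with every accuracy has trivial spectrum (\<open>trivial_spectrum_if_slow_growth\<close>). The
  growth rates are dominated by the uniformly integrable Birkhoff averages of \<open>ln \<parallel>A\<parallel>\<close>, so the infimum
  of their integrals is zero, and a maximal inequality turns this into convergence to zero almost
  everywhere. Kingman's theorem is not needed, because the limit is zero.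

  Slowness is an open condition in each variable separately (\<open>openin_slow_pairs\<close>): both weak convergence
  of \<open>f\<close> and convergence of \<open>A\<close> in \<open>L\<^sup>p\<close> imply convergence in measure of \<open>A\<^sup>n\<close> for fixed \<open>n\<close>.

  Slow pairs are dense in the separate topology (\<open>residual_slow_pairs\<close>). A given pair may be moved first in
  the direction of \<open>f\<close> and then in the direction of \<open>A\<close>.
  In the first move \<open>f\<close> is replaced by \<open>f \<circ> T\<close> with almost no periodic points, where \<open>T\<close>
  leaves invariant the finitely many sets that define a weak neighbourhood, so that the neighbourhood is
  not left at all (\<open>aperiodic_perturbation\<close>, \<open>weak_open_contains_perturbations\<close>). The map \<open>T\<close> acts on
  fundamental domains of the periodic part of \<open>f\<close> and is an irrational rotation
  in a measure isomorphism with an interval (\<open>aperiodic_on_coded_set\<close>).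
  In the second move \<open>A\<close> is first truncated to a bounded map, and a marker set cuts the orbits of the
  aperiodic map into columns of lengths between \<open>N\<close> and \<open>2 N\<close> (\<open>marker_set\<close>). In each column a single value of the truncated map is multiplied by a
  rotation, chosen so that the expansion before it is cancelled by the expansion after it
  (\<open>rotation_balance\<close>, \<open>balanced_rotation_exists\<close>). The product along every column is then
  bounded independently of \<open>N\<close>, while the truncated map changes on a set of measure of order \<open>1 / N\<close>
  (\<open>bounded_cocycle_slowed\<close>, \<open>slow_growth_Lp_dense\<close>).
\<close>

section \<open>Matrices in SL(2, R) in complex coordinates\<close>

text \<open>
  Under the identification of the plane with the complex numbers, a real matrix \<open>A\<close> acts as
  \<open>z \<mapsto> \<alpha> z + \<beta> cnj z\<close>. These are the coefficients: \<open>\<alpha> = mat_lin A\<close> is the complex linear part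
  and \<open>\<beta> = mat_conj A\<close> the conjugate linear part. In these coordinates
  \<open>matrix_norm A = |\<alpha>| + |\<beta>|\<close> and \<open>det A = |\<alpha>|\<^sup>2 - |\<beta>|\<^sup>2\<close>, which replaces the singular value decomposition.
\<close>

definition mat_lin :: "real^2^2 \<Rightarrow> complex" where
  "mat_lin A = Complex ((A$1$1 + A$2$2) / 2) ((A$2$1 - A$1$2) / 2)"

definition mat_conj :: "real^2^2 \<Rightarrow> complex" where
  "mat_conj A = Complex ((A$1$1 - A$2$2) / 2) ((A$2$1 + A$1$2) / 2)"

text \<open>
  A complex number as a vector of the plane.
\<close>

definition plane :: "complex \<Rightarrow> real^2" where
  "plane z = vector [Re z, Im z]"

lemma norm_plane: "norm (plane z) = cmod z"
  by (simp add: plane_def norm_vec_def L2_set_def sum_2 cmod_def)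

lemma plane_surj: "\<exists>z. v = plane z"
  by (rule exI[of _ "Complex (v$1) (v$2)"]) (simp add: plane_def vec_eq_iff forall_2)

lemma matrix_vector_plane: "A *v plane z = plane (mat_lin A * z + mat_conj A * cnj z)"
  by (simp add: plane_def vec_eq_iff forall_2 matrix_vector_mult_def sum_2 mat_lin_def mat_conj_def
      field_simps)

lemma mat_lin_mult: "mat_lin (A ** B) = mat_lin A * mat_lin B + mat_conj A * cnj (mat_conj B)"
  by (simp add: complex_eq_iff mat_lin_def mat_conj_def matrix_matrix_mult_def sum_2 field_simps)

lemma mat_conj_mult: "mat_conj (A ** B) = mat_lin A * mat_conj B + mat_conj A * cnj (mat_lin B)"
  by (simp add: complex_eq_iff mat_lin_def mat_conj_def matrix_matrix_mult_def sum_2 field_simps)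

lemma det_mat_lin_conj: "det A = (cmod (mat_lin A))\<^sup>2 - (cmod (mat_conj A))\<^sup>2"
  by (simp add: det_2 cmod_power2 mat_lin_def mat_conj_def) (simp add: power2_eq_square field_simps)

text \<open>
  Both numbers can be turned onto the same ray by opposite rotations.
\<close>

lemma phase_alignment:
  obtains t c where "cmod c = 1" "cis t * u = of_real (cmod u) * c" "cis (- t) * v = of_real (cmod v) * c"
proof -
  define t where "t = (Arg v - Arg u) / 2"
  have "cis t * cis (Arg u) = cis ((Arg u + Arg v) / 2)" "cis (- t) * cis (Arg v) = cis ((Arg u + Arg v) / 2)"
    by (simp_all add: t_def cis_mult field_simps)
  moreover have "cis t * u = of_real (cmod u) * (cis t * cis (Arg u))"
    "cis (- t) * v = of_real (cmod v) * (cis (- t) * cis (Arg v))"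
    by (metis rcis_cmod_Arg rcis_def mult.left_commute)+
  ultimately show ?thesis using that[of "cis ((Arg u + Arg v) / 2)" t] by simp
qed

lemma matrix_norm_eq: "matrix_norm A = cmod (mat_lin A) + cmod (mat_conj A)"
proof (rule antisym)
  show "matrix_norm A \<le> cmod (mat_lin A) + cmod (mat_conj A)"
    unfolding matrix_norm_def
  proof (rule onorm_le)
    fix x :: "real^2"
    obtain z where z: "x = plane z" using plane_surj by blast
    have "cmod (mat_lin A * z + mat_conj A * cnj z) \<le> cmod (mat_lin A) * cmod z + cmod (mat_conj A) * cmod z"
      by (metis complex_mod_cnj norm_mult norm_triangle_ineq)
    then show "norm (A *v x) \<le> (cmod (mat_lin A) + cmod (mat_conj A)) * norm x"
      by (simp add: z matrix_vector_plane norm_plane algebra_simps)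
  qed
  obtain t c where c: "cmod c = 1" "cis t * mat_lin A = of_real (cmod (mat_lin A)) * c"
      "cis (- t) * mat_conj A = of_real (cmod (mat_conj A)) * c"
    using phase_alignment by blast
  have "cis t * mat_lin A + cis (- t) * mat_conj A = of_real (cmod (mat_lin A) + cmod (mat_conj A)) * c"
    unfolding c by (simp add: algebra_simps)
  then have t: "cmod (cis t * mat_lin A + cis (- t) * mat_conj A) = cmod (mat_lin A) + cmod (mat_conj A)"
    using c(1) by (simp add: norm_mult del: of_real_add)
  have "norm (A *v plane (cis t)) \<le> matrix_norm A * norm (plane (cis t))"
    unfolding matrix_norm_def by (rule onorm) (rule matrix_vector_mul_bounded_linear)
  then show "cmod (mat_lin A) + cmod (mat_conj A) \<le> matrix_norm A"
    using t by (simp add: matrix_vector_plane norm_plane cis_cnj mult.commute)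
qed

lemma matrix_norm_nonneg [simp]: "0 \<le> matrix_norm A"
  by (simp add: matrix_norm_eq)

lemma matrix_norm_triangle: "matrix_norm (A + B) \<le> matrix_norm A + matrix_norm B"
proof -
  have "mat_lin (A + B) = mat_lin A + mat_lin B" "mat_conj (A + B) = mat_conj A + mat_conj B"
    by (simp_all add: mat_lin_def mat_conj_def complex_eq_iff field_simps)
  then show ?thesis
    using norm_triangle_ineq[of "mat_lin A" "mat_lin B"] norm_triangle_ineq[of "mat_conj A" "mat_conj B"]
    by (simp add: matrix_norm_eq)
qed

lemma matrix_norm_minus [simp]: "matrix_norm (- A) = matrix_norm A"
proof -
  have "mat_lin (- A) = - mat_lin A" "mat_conj (- A) = - mat_conj A"
    by (simp_all add: mat_lin_def mat_conj_def complex_eq_iff field_simps)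
  then show ?thesis by (simp add: matrix_norm_eq)
qed

lemma matrix_norm_minus_commute: "matrix_norm (A - B) = matrix_norm (B - A)"
  by (metis matrix_norm_minus minus_diff_eq)

lemma matrix_norm_diff_le: "matrix_norm (A - B) \<le> matrix_norm A + matrix_norm B"
  using matrix_norm_triangle[of A "- B"] by simp

lemma matrix_norm_0_iff: "matrix_norm A = 0 \<longleftrightarrow> A = 0"
proof
  assume "matrix_norm A = 0"
  then have "mat_lin A = 0" "mat_conj A = 0"
    by (simp_all add: matrix_norm_eq add_nonneg_eq_0_iff)
  then show "A = 0"
    by (auto simp: mat_lin_def mat_conj_def complex_eq_iff vec_eq_iff forall_2)
qed (simp add: matrix_norm_eq mat_lin_def mat_conj_def complex_eq_iff)

lemma matrix_norm_mult: "matrix_norm (A ** B) \<le> matrix_norm A * matrix_norm B"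
proof -
  have "(*v) (A ** B) = (*v) A \<circ> (*v) B" by (auto simp: matrix_vector_mul_assoc)
  then show ?thesis
    unfolding matrix_norm_def
    by (metis matrix_vector_mul_bounded_linear onorm_compose)
qed

lemma continuous_on_matrix_norm [continuous_intros]:
  "continuous_on S f \<Longrightarrow> continuous_on S (\<lambda>x. matrix_norm (f x))"
  unfolding matrix_norm_eq mat_lin_def mat_conj_def Complex_eq
  by (intro continuous_intros) auto

lemma continuous_on_matrix_mult [continuous_intros]:
  fixes f :: "'x::topological_space \<Rightarrow> real^'n^'m" and g :: "'x \<Rightarrow> real^'k^'n"
  shows "continuous_on S f \<Longrightarrow> continuous_on S g \<Longrightarrow> continuous_on S (\<lambda>x. f x ** g x)"
  unfolding matrix_matrix_mult_def
  by (intro continuous_intros)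

lemma borel_measurable_matrix_norm [measurable (raw)]:
  "f \<in> borel_measurable M \<Longrightarrow> (\<lambda>x. matrix_norm (f x)) \<in> borel_measurable M"
  by (rule borel_measurable_continuous_on[where f = matrix_norm])
    (auto intro!: continuous_intros)

lemma borel_measurable_matrix_mult [measurable (raw)]:
  fixes f :: "'x \<Rightarrow> real^'n::finite^'m::finite" and g :: "'x \<Rightarrow> real^'k::finite^'n"
  assumes "f \<in> borel_measurable M" "g \<in> borel_measurable M"
  shows "(\<lambda>x. f x ** g x) \<in> borel_measurable M"
  by (rule borel_measurable_continuous_Pair[OF assms, where H = "\<lambda>a b. a ** b"])
    (intro continuous_intros)

lemma SL2_mult: "A \<in> SL2 \<Longrightarrow> B \<in> SL2 \<Longrightarrow> A ** B \<in> SL2"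
  by (simp add: SL2_def det_mul)

lemma SL2_one: "mat 1 \<in> SL2"
  by (simp add: SL2_def)

lemma matrix_norm_one [simp]: "matrix_norm (mat 1) = 1"
  by (simp add: matrix_norm_eq mat_lin_def mat_conj_def mat_def flip: complex_of_real_def one_complex.code zero_complex.code)

text \<open>In \<open>SL2\<close> the norm \<open>|\<alpha>| + |\<beta>|\<close> determines \<open>|\<alpha>|\<close> and \<open>|\<beta>|\<close>.\<close>

lemma SL2_coords:
  assumes "A \<in> SL2"
  shows matrix_norm_SL2: "1 \<le> matrix_norm A"
    and "cmod (mat_lin A) = (matrix_norm A + 1 / matrix_norm A) / 2"
    and "cmod (mat_conj A) = (matrix_norm A - 1 / matrix_norm A) / 2"
proof -
  define a b where "a = cmod (mat_lin A)" and "b = cmod (mat_conj A)"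
  have ab: "a\<^sup>2 - b\<^sup>2 = 1" "0 \<le> a" "0 \<le> b"
    using assms by (simp_all add: SL2_def det_mat_lin_conj a_def b_def)
  have n: "matrix_norm A = a + b" by (simp add: matrix_norm_eq a_def b_def)
  have a1: "1 \<le> a" using ab by (smt (verit, best) one_power2 power2_le_imp_le zero_le_power2)
  have "(a - b) * (a + b) = 1" using ab by (simp add: algebra_simps power2_eq_square)
  then have inv: "1 / (a + b) = a - b" using a1 ab by (simp add: field_simps)
  show "1 \<le> matrix_norm A" using n a1 ab by simp
  show "cmod (mat_lin A) = (matrix_norm A + 1 / matrix_norm A) / 2"
    "cmod (mat_conj A) = (matrix_norm A - 1 / matrix_norm A) / 2"
    unfolding n inv by (simp_all add: a_def b_def)
qed

text \<open>
  The counterclockwise rotation of the plane by the angle \<open>t\<close>.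
\<close>

definition rotation :: "real \<Rightarrow> real^2^2" where
  "rotation t = vector [vector [cos t, - sin t], vector [sin t, cos t]]"

lemma mat_lin_rotation: "mat_lin (rotation t) = cis t"
  and mat_conj_rotation: "mat_conj (rotation t) = 0"
  by (simp_all add: mat_lin_def mat_conj_def rotation_def complex_eq_iff)

lemma rotation_SL2: "rotation t \<in> SL2"
  by (simp add: SL2_def det_mat_lin_conj mat_lin_rotation mat_conj_rotation)

lemma matrix_norm_mult_rotation: "matrix_norm (A ** rotation t) = matrix_norm A"
  by (simp add: matrix_norm_eq mat_lin_mult mat_conj_mult mat_lin_rotation mat_conj_rotation norm_mult)

lemma continuous_on_rotation [continuous_intros]: "continuous_on S rotation"
proof -
  have "rotation t = (\<chi> i j. if i = 1 then (if j = 1 then cos t else - sin t) else (if j = 1 then sin t else cos t))" for t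
    by (simp add: rotation_def vec_eq_iff forall_2)
  then have eq: "rotation = (\<lambda>t. \<chi> i j. if i = 1 then (if j = 1 then cos t else - sin t) else (if j = 1 then sin t else cos t))"
    by (rule ext)
  have "continuous_on S (\<lambda>t. if i = 1 then (if j = 1 then cos t else - sin t) else (if j = 1 then sin t else cos t))"
    for i j :: 2
    by (cases "i = 1"; cases "j = 1") (auto intro!: continuous_intros)
  then show ?thesis
    unfolding eq by (intro continuous_on_vec_lambda)
qed

text \<open>
  The map \<open>q \<mapsto> q - 1 / q\<close> is injective on \<open>q \<ge> 1\<close>.
\<close>

lemma balance_real:
  fixes a b :: real
  assumes "1 \<le> a" "1 \<le> b" and q: "1 \<le> q"
    and eq: "(q - 1 / q) / 2 = \<bar>a / b - b / a\<bar> / 2"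
  shows "q = max (a / b) (b / a)"
proof -
  define m where "m = max (a / b) (b / a)"
  have m1: "1 \<le> m" and m: "\<bar>a / b - b / a\<bar> = m - 1 / m"
  proof -
    consider "b \<le> a" | "a \<le> b" by linarith
    then have "1 \<le> m \<and> \<bar>a / b - b / a\<bar> = m - 1 / m"
    proof cases
      case 1
      then have "b / a \<le> 1" "1 \<le> a / b" using assms by simp_all
      then have "m = a / b" "1 / m = b / a" by (auto simp: m_def max_def)
      then show ?thesis using \<open>b / a \<le> 1\<close> \<open>1 \<le> a / b\<close> by simp
    next
      case 2
      then have "a / b \<le> 1" "1 \<le> b / a" using assms by simp_all
      then have "m = b / a" "1 / m = a / b" by (auto simp: m_def max_def)
      then show ?thesis using \<open>a / b \<le> 1\<close> \<open>1 \<le> b / a\<close> by simp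
    qed
    then show "1 \<le> m" "\<bar>a / b - b / a\<bar> = m - 1 / m" by auto
  qed
  have "q - 1 / q = m - 1 / m" using eq m by simp
  then have "(q - m) * (q * m + 1) = 0" using q m1 by (simp add: field_simps)
  moreover have "q * m + 1 > 0" using q m1 by (simp add: add_pos_pos)
  ultimately show ?thesis by (auto simp: m_def)
qed

text \<open>
  A suitable rotation sends the direction most expanded by \<open>A\<close> to the direction most contracted by
  \<open>B\<close>, so that the growth of the two factors cancels. With \<open>|\<alpha>| = cosh\<close> and \<open>|\<beta>| = sinh\<close> of the
  logarithm of the norm, the conjugate part of the product becomes the \<open>sinh\<close> of a difference.
\<close>

lemma rotation_balance:
  assumes "A \<in> SL2" "B \<in> SL2"
  obtains t where "matrix_norm (B ** (rotation t ** A)) = max (matrix_norm A / matrix_norm B) (matrix_norm B / matrix_norm A)"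
proof -
  define u v where "u = mat_lin B * mat_conj A" and "v = mat_conj B * cnj (mat_lin A)"
  define a b where "a = matrix_norm A" and "b = matrix_norm B"
  have ab: "1 \<le> a" "1 \<le> b" using SL2_coords assms by (auto simp: a_def b_def)
  obtain t' c where c: "cmod c = 1" "cis t' * u = of_real (cmod u) * c" "cis (- t') * v = of_real (cmod v) * c"
    using phase_alignment by blast
  \<comment> \<open>Turning by a further right angle makes the two terms cancel instead of add up.\<close>
  define t where "t = t' + pi / 2"
  have t: "cis t = \<i> * cis t'" "cis (- t) = - \<i> * cis (- t')"
    by (simp_all add: t_def complex_eq_iff sin_add cos_add sin_diff cos_diff)
  have "cis t * u + cis (- t) * v = \<i> * (cis t' * u) - \<i> * (cis (- t') * v)"
    by (simp add: t)
  also have "\<dots> = \<i> * (of_real (cmod u - cmod v) * c)"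
    unfolding c by (simp add: algebra_simps)
  finally have uv: "cmod (cis t * u + cis (- t) * v) = \<bar>cmod u - cmod v\<bar>"
    by (simp add: norm_mult c(1) del: of_real_diff)
  define Q where "Q = B ** (rotation t ** A)"
  have Q: "Q \<in> SL2" using assms rotation_SL2 by (auto simp: Q_def intro!: SL2_mult)
  have "mat_conj Q = cis t * u + cis (- t) * v"
    by (simp add: Q_def mat_lin_mult mat_conj_mult mat_lin_rotation mat_conj_rotation u_def v_def cis_cnj
      algebra_simps)
  then have "cmod (mat_conj Q) = \<bar>cmod u - cmod v\<bar>" using uv by simp
  also have "cmod u - cmod v = (b + 1 / b) / 2 * ((a - 1 / a) / 2) - (b - 1 / b) / 2 * ((a + 1 / a) / 2)"
    by (simp add: u_def v_def norm_mult a_def b_def SL2_coords(2,3)[OF assms(1)] SL2_coords(2,3)[OF assms(2)])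
  also have "\<dots> = (a / b - b / a) / 2" using ab by (simp add: field_simps)
  finally have "(matrix_norm Q - 1 / matrix_norm Q) / 2 = \<bar>a / b - b / a\<bar> / 2"
    using SL2_coords(3)[OF Q] by simp
  from balance_real[OF ab SL2_coords(1)[OF Q] this] show ?thesis
    using that[of t] by (simp add: Q_def a_def b_def)
qed

text \<open>
  Rational angles suffice at the cost of an arbitrarily small loss. There are countably many of them,
  which later makes the choice of the angle measurable.
\<close>

lemma rational_rotation_balance:
  assumes "A \<in> SL2" "B \<in> SL2" "matrix_norm A / matrix_norm B \<le> c" "matrix_norm B / matrix_norm A \<le> c"
  shows "\<exists>q::rat. matrix_norm (B ** (rotation (of_rat q) ** A)) < c + 1"
proof -
  obtain t where t: "matrix_norm (B ** (rotation t ** A)) \<le> c"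
    using rotation_balance[OF assms(1,2)] assms(3,4) by (metis max.bounded_iff order_refl)
  define S where "S = {t. matrix_norm (B ** (rotation t ** A)) < c + 1}"
  have "open S" unfolding S_def
    by (intro open_Collect_less continuous_intros)
  moreover have "t \<in> S" using t by (simp add: S_def)
  ultimately obtain e where e: "e > 0" "\<And>s. dist s t < e \<Longrightarrow> s \<in> S"
    by (meson open_dist)
  obtain q :: rat where "t < of_rat q" "of_rat q < t + e"
    using of_rat_dense[of t "t + e"] e by auto
  then have "of_rat q \<in> S" by (intro e) (simp add: dist_real_def)
  then show ?thesis unfolding S_def by blast
qed

section \<open>Automorphisms and cocycles\<close>

text \<open>
  A finite measure on the Borel sets of a second countable Hausdorff space.
\<close>

locale finite_measure_on_borel = finite_measure \<mu>
  for \<mu> :: "'a::{t2_space, second_countable_topology} measure" +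
  assumes sets_eq_borel [measurable_cong]: "sets \<mu> = sets borel"
begin

lemma space_eq_UNIV [simp]: "space \<mu> = UNIV"
  using sets_eq_imp_space_eq[OF sets_eq_borel] by simp

lemma Collect_in_sets: "Measurable.pred \<mu> P \<Longrightarrow> {x. P x} \<in> sets \<mu>"
  by (drule predE) simp

lemma automorphismI:
  assumes "f \<in> measurable \<mu> \<mu>" "f' \<in> measurable \<mu> \<mu>" "\<And>x. f' (f x) = x" "\<And>x. f (f' x) = x"
    and "\<And>B. B \<in> sets \<mu> \<Longrightarrow> emeasure \<mu> (f -` B) = emeasure \<mu> B"
  shows "f \<in> automorphisms \<mu>" "inv f = f'"
proof -
  have bij: "bij f" using assms(3,4) by (intro bij_betw_byWitness[where f' = f']) auto
  show inv: "inv f = f'" by (rule inv_equality) (simp_all add: assms(3,4))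
  have "distr \<mu> \<mu> f = \<mu>"
    by (rule measure_eqI) (simp_all add: emeasure_distr assms(1,5))
  then show "f \<in> automorphisms \<mu>"
    using assms bij inv by (simp add: automorphisms_def)
qed

lemma automorphism_bij: "f \<in> automorphisms \<mu> \<Longrightarrow> bij f"
  and automorphism_measurable: "f \<in> automorphisms \<mu> \<Longrightarrow> f \<in> measurable \<mu> \<mu>"
  and automorphism_inv_measurable: "f \<in> automorphisms \<mu> \<Longrightarrow> inv f \<in> measurable \<mu> \<mu>"
  and automorphism_distr: "f \<in> automorphisms \<mu> \<Longrightarrow> distr \<mu> \<mu> f = \<mu>"
  by (simp_all add: automorphisms_def)

lemma automorphism_vimage_sets: "f \<in> automorphisms \<mu> \<Longrightarrow> B \<in> sets \<mu> \<Longrightarrow> f -` B \<in> sets \<mu>"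
  using measurable_sets[OF automorphism_measurable, of f B] by simp

lemma automorphism_emeasure_vimage:
  "f \<in> automorphisms \<mu> \<Longrightarrow> B \<in> sets \<mu> \<Longrightarrow> emeasure \<mu> (f -` B) = emeasure \<mu> B"
  using emeasure_distr[of f \<mu> \<mu> B] automorphism_measurable[of f] automorphism_distr[of f] by simp

lemma automorphism_measure_vimage:
  "f \<in> automorphisms \<mu> \<Longrightarrow> B \<in> sets \<mu> \<Longrightarrow> measure \<mu> (f -` B) = measure \<mu> B"
  by (simp add: measure_def automorphism_emeasure_vimage)

lemma automorphism_image_sets: "f \<in> automorphisms \<mu> \<Longrightarrow> B \<in> sets \<mu> \<Longrightarrow> f ` B \<in> sets \<mu>"
  by (rule automorphisms_image(1)) auto

lemma automorphism_measure_image: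
  "f \<in> automorphisms \<mu> \<Longrightarrow> B \<in> sets \<mu> \<Longrightarrow> measure \<mu> (f ` B) = measure \<mu> B"
  using automorphisms_image(2)[of f \<mu> B] by (simp add: measure_def)

lemma automorphism_id: "id \<in> automorphisms \<mu>"
  by (rule automorphismI(1)[of _ id]) (simp_all add: id_def)

lemma automorphism_comp:
  assumes "f \<in> automorphisms \<mu>" "g \<in> automorphisms \<mu>"
  shows "f \<circ> g \<in> automorphisms \<mu>"
proof (rule automorphismI)
  show "f \<circ> g \<in> measurable \<mu> \<mu>" "inv g \<circ> inv f \<in> measurable \<mu> \<mu>"
    using measurable_comp[OF automorphism_measurable automorphism_measurable]
      measurable_comp[OF automorphism_inv_measurable automorphism_inv_measurable] assms by blast+
  show "(inv g \<circ> inv f) ((f \<circ> g) x) = x" "(f \<circ> g) ((inv g \<circ> inv f) x) = x" for x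
    using assms[THEN automorphism_bij] by (simp_all add: bij_is_inj bij_is_surj surj_f_inv_f)
  show "emeasure \<mu> ((f \<circ> g) -` B) = emeasure \<mu> B" if "B \<in> sets \<mu>" for B
    using assms that automorphism_emeasure_vimage automorphism_vimage_sets
    by (simp add: vimage_comp[symmetric])
qed

lemma automorphism_funpow: "f \<in> automorphisms \<mu> \<Longrightarrow> f ^^ n \<in> automorphisms \<mu>"
proof (induction n)
  case 0
  show ?case by (simp only: funpow.simps automorphism_id)
next
  case (Suc n)
  then show ?case by (simp only: funpow.simps automorphism_comp)
qed

lemma automorphism_AE:
  assumes "f \<in> automorphisms \<mu>" "AE x in \<mu>. P x"
  shows "AE x in \<mu>. P (f x)"
proof -
  obtain N where N: "{x \<in> space \<mu>. \<not> P x} \<subseteq> N" "emeasure \<mu> N = 0" "N \<in> sets \<mu>"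
    by (rule AE_E[OF assms(2)])
  have "f -` N \<in> null_sets \<mu>"
    using automorphism_emeasure_vimage[OF assms(1) N(3)] automorphism_vimage_sets[OF assms(1) N(3)] N(2)
    by (simp add: null_sets_def)
  moreover have "{x \<in> space \<mu>. \<not> P (f x)} \<subseteq> f -` N" using N(1) by auto
  ultimately show ?thesis by (rule AE_I')
qed

lemma automorphism_integral:
  fixes h :: "'a \<Rightarrow> real"
  assumes "f \<in> automorphisms \<mu>" "h \<in> borel_measurable \<mu>"
  shows "(\<integral>x. h (f x) \<partial>\<mu>) = (\<integral>x. h x \<partial>\<mu>)"
  using integral_distr[OF automorphism_measurable[OF assms(1)] assms(2)]
  by (simp add: automorphism_distr[OF assms(1)])

lemma automorphism_integrable:
  fixes h :: "'a \<Rightarrow> real"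
  assumes "f \<in> automorphisms \<mu>" "integrable \<mu> h"
  shows "integrable \<mu> (\<lambda>x. h (f x))"
  by (rule integrable_distr[OF automorphism_measurable[OF assms(1)]])
    (simp add: automorphism_distr[OF assms(1)] assms(2))

end

text \<open>
  The logarithm of the norm of the \<open>n\<close>-th iterate of the cocycle. It is nonnegative for cocycles with
  values in \<open>SL2\<close>, and subadditive along orbits.
\<close>

definition log_growth :: "('a \<Rightarrow> 'a) \<Rightarrow> ('a \<Rightarrow> real^2^2) \<Rightarrow> nat \<Rightarrow> 'a \<Rightarrow> real" where
  "log_growth f A n x = ln (matrix_norm (cocycle f A n x))"

lemma cocycle_add: "cocycle f A (m + n) x = cocycle f A m ((f ^^ n) x) ** cocycle f A n x"
  by (induction m) (simp_all add: funpow_add matrix_mul_assoc)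

lemma cocycle_SL2: "range A \<subseteq> SL2 \<Longrightarrow> cocycle f A n x \<in> SL2"
  by (induction n) (simp_all add: SL2_one SL2_mult image_subset_iff)

lemma log_growth_nonneg: "range A \<subseteq> SL2 \<Longrightarrow> 0 \<le> log_growth f A n x"
  by (simp add: log_growth_def matrix_norm_SL2 cocycle_SL2)

lemma ln_matrix_norm_mult:
  assumes "A \<in> SL2" "B \<in> SL2"
  shows "ln (matrix_norm (A ** B)) \<le> ln (matrix_norm A) + ln (matrix_norm B)"
proof -
  have "1 \<le> matrix_norm A" "1 \<le> matrix_norm B" "1 \<le> matrix_norm (A ** B)"
    using assms by (auto intro: matrix_norm_SL2 SL2_mult)
  then show ?thesis
    using matrix_norm_mult[of A B] by (subst ln_mult_pos[symmetric]) auto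
qed

lemma log_growth_add:
  assumes "range A \<subseteq> SL2"
  shows "log_growth f A (m + n) x \<le> log_growth f A m ((f ^^ n) x) + log_growth f A n x"
  unfolding log_growth_def cocycle_add by (intro ln_matrix_norm_mult cocycle_SL2 assms)

lemma log_growth_0 [simp]: "log_growth f A 0 x = 0"
  by (simp add: log_growth_def)

lemma log_growth_Suc_0: "log_growth f A (Suc 0) x = ln (matrix_norm (A x))"
  by (simp add: log_growth_def)

lemma log_growth_le_sum:
  assumes "range A \<subseteq> SL2"
  shows "log_growth f A n x \<le> (\<Sum>j<n. ln (matrix_norm (A ((f ^^ j) x))))"
proof (induction n)
  case (Suc n)
  have "log_growth f A (Suc n) x \<le> ln (matrix_norm (A ((f ^^ n) x))) + log_growth f A n x"
    using log_growth_add[OF assms, of f "Suc 0" n x] unfolding log_growth_Suc_0 by simp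
  then show ?case using Suc.IH by simp
qed simp

lemma log_growth_mult_le_sum:
  assumes "range A \<subseteq> SL2"
  shows "log_growth f A (N * q) x \<le> (\<Sum>j<q. log_growth f A N (((f ^^ N) ^^ j) x))"
proof (induction q)
  case (Suc q)
  have "log_growth f A (N * Suc q) x \<le> log_growth f A N ((f ^^ (N * q)) x) + log_growth f A (N * q) x"
    using log_growth_add[OF assms, of f N "N * q" x] by simp
  then show ?case using Suc.IH by (simp add: funpow_mult)
qed simp

context finite_measure_on_borel
begin

lemma cocycle_measurable [measurable]:
  assumes [measurable]: "f \<in> measurable \<mu> \<mu>" "A \<in> borel_measurable \<mu>"
  shows "cocycle f A n \<in> borel_measurable \<mu>"
proof (induction n)
  case 0
  have "cocycle f A 0 = (\<lambda>x. mat 1)" by (rule ext) simp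
  then show ?case by simp
next
  case (Suc n)
  note [measurable] = Suc
  have [measurable]: "f ^^ n \<in> measurable \<mu> \<mu>" by (rule measurable_compose_n) fact
  have "(\<lambda>x. A ((f ^^ n) x) ** cocycle f A n x) \<in> borel_measurable \<mu>" by measurable
  moreover have "cocycle f A (Suc n) = (\<lambda>x. A ((f ^^ n) x) ** cocycle f A n x)" by (rule ext) simp
  ultimately show ?case by simp
qed

lemma log_growth_measurable [measurable]:
  assumes [measurable]: "f \<in> measurable \<mu> \<mu>" "A \<in> borel_measurable \<mu>"
  shows "log_growth f A n \<in> borel_measurable \<mu>"
  unfolding log_growth_def by measurable

lemma AE_cocycle_eq:
  assumes "f \<in> automorphisms \<mu>" "AE x in \<mu>. f x = f' x" "AE x in \<mu>. A x = A' x"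
  shows "AE x in \<mu>. \<forall>n. cocycle f A n x = cocycle f' A' n x"
proof -
  have "AE x in \<mu>. \<forall>n. f ((f ^^ n) x) = f' ((f ^^ n) x) \<and> A ((f ^^ n) x) = A' ((f ^^ n) x)"
    unfolding AE_all_countable
  proof (intro allI)
    fix n
    have "AE x in \<mu>. f x = f' x \<and> A x = A' x" using assms(2,3) by auto
    from automorphism_AE[OF automorphism_funpow[OF assms(1)] this]
    show "AE x in \<mu>. f ((f ^^ n) x) = f' ((f ^^ n) x) \<and> A ((f ^^ n) x) = A' ((f ^^ n) x)" .
  qed
  then show ?thesis
  proof eventually_elim
    fix x assume x: "\<forall>n. f ((f ^^ n) x) = f' ((f ^^ n) x) \<and> A ((f ^^ n) x) = A' ((f ^^ n) x)"
    have eq: "(f ^^ n) x = (f' ^^ n) x" for n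
    proof (induction n)
      case (Suc n)
      then show ?case using spec[OF x, of n] by simp
    qed simp
    have "cocycle f A n x = cocycle f' A' n x" for n
    proof (induction n)
      case (Suc n)
      then show ?case using spec[OF x, of n] eq[of n] by simp
    qed simp
    then show "\<forall>n. cocycle f A n x = cocycle f' A' n x" by blast
  qed
qed

end

section \<open>Slow growth in measure implies trivial spectrum\<close>

context finite_measure_on_borel
begin

text \<open>
  The weak type \<open>(1, 1)\<close> bound for Birkhoff sums of a nonnegative function, from the maximal ergodic
  theorem. \<open>B n\<close> below is the maximum of the first \<open>n + 1\<close> Birkhoff sums of \<open>h - \<lambda>\<close>.
\<close>

lemma maximal_inequality:
  assumes S: "S \<in> automorphisms \<mu>" and h: "integrable \<mu> h" "\<And>x. 0 \<le> h x" and l: "0 < l"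
  shows "{x. \<exists>m. l * real m < (\<Sum>j<m. h ((S ^^ j) x))} \<in> sets \<mu>"
    and "measure \<mu> {x. \<exists>m. l * real m < (\<Sum>j<m. h ((S ^^ j) x))} \<le> (\<integral>x. h x \<partial>\<mu>) / l"
proof -
  have [measurable]: "h \<in> borel_measurable \<mu>" "S \<in> measurable \<mu> \<mu>"
    using h S automorphism_measurable by auto
  have [measurable]: "S ^^ j \<in> measurable \<mu> \<mu>" for j
    by (rule measurable_compose_n) measurable
  define Z where "Z = {x. \<exists>m. l * real m < (\<Sum>j<m. h ((S ^^ j) x))}"
  have Z: "Z \<in> sets \<mu>" unfolding Z_def by (rule Collect_in_sets) measurable
  then show "{x. \<exists>m. l * real m < (\<Sum>j<m. h ((S ^^ j) x))} \<in> sets \<mu>" by (simp add: Z_def)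
  define F where "F = (\<lambda>x. h x - l)"
  have F: "integrable \<mu> F" using h by (simp add: F_def)
  define B where "B = rec_nat (\<lambda>x. 0) (\<lambda>n b x. max 0 (F x + b (S x)))"
  have B0: "B 0 x = 0" and BS: "B (Suc n) x = max 0 (F x + B n (S x))" for n x
    by (simp_all add: B_def)
  have B_int: "integrable \<mu> (B n)" for n
  proof (induction n)
    case 0
    have "B 0 = (\<lambda>x. 0)" by (rule ext) (simp add: B0)
    then show ?case by simp
  next
    case (Suc n)
    have "B (Suc n) = (\<lambda>x. max 0 (F x + B n (S x)))" by (rule ext) (simp add: BS)
    moreover have "integrable \<mu> (\<lambda>x. max 0 (F x + B n (S x)))"
      using F automorphism_integrable[OF S Suc] by (intro integrable_max Bochner_Integration.integrable_add) auto
    ultimately show ?case by simp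
  qed
  have [measurable]: "B n \<in> borel_measurable \<mu>" for n using B_int by auto
  have B_nonneg: "0 \<le> B n x" for n x by (cases n) (simp_all add: B0 BS)
  have B_mono: "B n x \<le> B (Suc n) x" for n x
  proof (induction n arbitrary: x)
    case 0
    then show ?case using B_nonneg by (simp add: B0)
  next
    case (Suc n)
    then show ?case using Suc[of "S x"] unfolding BS[of "Suc n" x] BS[of n x] by (intro max.mono) auto
  qed
  define E where "E = (\<lambda>n. {x. 0 < B n x})"
  have E: "E n \<in> sets \<mu>" for n
    unfolding E_def by (rule Collect_in_sets) measurable
  have "measure \<mu> (E n) \<le> (\<integral>x. h x \<partial>\<mu>) / l" for n
  proof -
    have pt: "B (Suc n) x - B (Suc n) (S x) \<le> indicator (E (Suc n)) x * h x - l * indicator (E (Suc n)) x" for x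
    proof (cases "x \<in> E (Suc n)")
      case True
      then have "B (Suc n) x = F x + B n (S x)" by (auto simp: E_def BS max_def split: if_splits)
      then show ?thesis using True B_mono[of n "S x"] by (simp add: F_def)
    next
      case False
      then have "B (Suc n) x = 0" using B_nonneg[of "Suc n" x] by (simp add: E_def)
      then show ?thesis using False B_nonneg[of "Suc n" "S x"] by simp
    qed
    have i: "integrable \<mu> (\<lambda>x. indicator (E (Suc n)) x * h x)" "integrable \<mu> (\<lambda>x. l * indicator (E (Suc n)) x)"
      using E h by (auto intro!: integrable_mult_indicator[where 'b = real, simplified] integrable_real_indicator
        simp: emeasure_eq_measure)
    have "0 = (\<integral>x. B (Suc n) x - B (Suc n) (S x) \<partial>\<mu>)"
      using B_int automorphism_integrable[OF S B_int] automorphism_integral[OF S, of "B (Suc n)"] by simp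
    also have "\<dots> \<le> (\<integral>x. indicator (E (Suc n)) x * h x - l * indicator (E (Suc n)) x \<partial>\<mu>)"
      using i B_int automorphism_integrable[OF S B_int] pt
      by (intro integral_mono Bochner_Integration.integrable_diff) auto
    also have "\<dots> = (\<integral>x. indicator (E (Suc n)) x * h x \<partial>\<mu>) - l * measure \<mu> (E (Suc n))"
      using i E by simp
    also have "(\<integral>x. indicator (E (Suc n)) x * h x \<partial>\<mu>) \<le> (\<integral>x. h x \<partial>\<mu>)"
      using i h by (intro integral_mono) (auto simp: indicator_def)
    finally have "measure \<mu> (E (Suc n)) \<le> (\<integral>x. h x \<partial>\<mu>) / l"
      using l by (simp add: field_simps)
    moreover have "measure \<mu> (E n) \<le> measure \<mu> (E (Suc n))"
      using E B_mono[of n] by (intro finite_measure_mono) (auto simp: E_def intro: less_le_trans)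
    ultimately show ?thesis by simp
  qed
  moreover have "(\<lambda>n. measure \<mu> (E n)) \<longlonglongrightarrow> measure \<mu> (\<Union>n. E n)"
    using E B_mono by (intro finite_Lim_measure_incseq incseq_SucI) (auto simp: E_def intro: less_le_trans)
  ultimately have lim: "measure \<mu> (\<Union>n. E n) \<le> (\<integral>x. h x \<partial>\<mu>) / l"
    by (meson LIMSEQ_le_const2)
  have sums: "(\<Sum>j<m. F ((S ^^ j) x)) \<le> B m x" for m x
  proof (induction m arbitrary: x)
    case (Suc m)
    have "(\<Sum>j<Suc m. F ((S ^^ j) x)) = F x + (\<Sum>j<m. F ((S ^^ j) (S x)))"
      by (simp add: sum.lessThan_Suc_shift funpow_swap1 del: sum.lessThan_Suc)
    then show ?case using Suc[of "S x"] by (simp add: BS)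
  qed (simp add: B0)
  have "Z \<subseteq> (\<Union>n. E n)"
  proof
    fix x assume "x \<in> Z"
    then obtain m where "l * real m < (\<Sum>j<m. h ((S ^^ j) x))" by (auto simp: Z_def)
    then have "0 < (\<Sum>j<m. F ((S ^^ j) x))" by (simp add: F_def sum_subtractf mult.commute)
    then show "x \<in> (\<Union>n. E n)" using sums[where m = m and x = x] by (auto simp: E_def intro: less_le_trans)
  qed
  then have "measure \<mu> Z \<le> measure \<mu> (\<Union>n. E n)" using E by (intro finite_measure_mono) auto
  then show "measure \<mu> {x. \<exists>m. l * real m < (\<Sum>j<m. h ((S ^^ j) x))} \<le> (\<integral>x. h x \<partial>\<mu>) / l"
    using lim by (simp add: Z_def)
qed

text \<open>
  The part of an integrable function above a high level has small integral.
\<close>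

lemma truncation_tail_small:
  fixes g :: "'a \<Rightarrow> real"
  assumes g: "integrable \<mu> g" and e: "0 < e"
  obtains c where "0 \<le> c" "(\<integral>x. max 0 (g x - c) \<partial>\<mu>) < e"
proof -
  have "(\<lambda>n. \<integral>x. max 0 (g x - real n) \<partial>\<mu>) \<longlonglongrightarrow> (\<integral>x. 0 \<partial>\<mu>)"
  proof (rule integral_dominated_convergence[where w = "\<lambda>x. \<bar>g x\<bar>"])
    show "AE x in \<mu>. (\<lambda>n. max 0 (g x - real n)) \<longlonglongrightarrow> 0"
    proof (rule AE_I2)
      fix x
      have "\<forall>\<^sub>F n in sequentially. max 0 (g x - real n) = 0"
        using eventually_ge_at_top[of "nat \<lceil>g x\<rceil>"]
      proof eventually_elim
        case (elim n)
        then have "g x \<le> real n" by linarith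
        then show ?case by simp
      qed
      then show "(\<lambda>n. max 0 (g x - real n)) \<longlonglongrightarrow> 0" by (rule tendsto_eventually)
    qed
  qed (use g in auto)
  then have "\<forall>\<^sub>F n in sequentially. (\<integral>x. max 0 (g x - real n) \<partial>\<mu>) < e"
    using e by (intro order_tendstoD(2)) auto
  then obtain n where "(\<integral>x. max 0 (g x - real n) \<partial>\<mu>) < e"
    by (auto simp: eventually_sequentially)
  then show ?thesis using that[of "real n"] by simp
qed

end

text \<open>
  At some time \<open>n \<ge> 1\<close> the growth rate \<open>log_growth f A n x / n\<close> is below \<open>1 / (k + 1)\<close> outside a set of
  measure less than \<open>1 / (k + 1)\<close>. No integral occurs, so the condition is stable under convergence
  in measure of the map and of the cocycle.
\<close>

definition slow_growth :: "'a measure \<Rightarrow> nat \<Rightarrow> ('a \<Rightarrow> 'a) \<Rightarrow> ('a \<Rightarrow> real^2^2) \<Rightarrow> bool" where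
  "slow_growth \<mu> k f A \<longleftrightarrow>
     (\<exists>n\<ge>1. measure \<mu> {x. real n / real (Suc k) \<le> log_growth f A n x} < 1 / real (Suc k))"

context finite_measure_on_borel
begin

context
  fixes f :: "'a \<Rightarrow> 'a" and A :: "'a \<Rightarrow> real^2^2"
  assumes f: "f \<in> automorphisms \<mu>" and A: "A \<in> borel_measurable \<mu>" "range A \<subseteq> SL2"
    and int: "integrable \<mu> (\<lambda>x. ln (matrix_norm (A x)))"
begin

lemma integrable_log_growth: "integrable \<mu> (log_growth f A n)"
proof (rule Bochner_Integration.integrable_bound)
  show "integrable \<mu> (\<lambda>x. \<Sum>j<n. ln (matrix_norm (A ((f ^^ j) x))))"
    using automorphism_integrable[OF automorphism_funpow[OF f] int] by auto
  show "log_growth f A n \<in> borel_measurable \<mu>"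
    using f A automorphism_measurable by measurable
  show "AE x in \<mu>. norm (log_growth f A n x) \<le> norm (\<Sum>j<n. ln (matrix_norm (A ((f ^^ j) x))))"
  proof (rule AE_I2)
    fix x
    show "norm (log_growth f A n x) \<le> norm (\<Sum>j<n. ln (matrix_norm (A ((f ^^ j) x))))"
      using log_growth_nonneg[OF A(2), of f n x] log_growth_le_sum[OF A(2), of f n x] by simp
  qed
qed

text \<open>
  Growth rates are dominated by Birkhoff averages of the integrable function \<open>ln (matrix_norm (A x))\<close>.
  These averages are uniformly integrable, so a rate that is small in measure is small in the mean.
\<close>

lemma small_mean_log_growth:
  assumes slow: "\<And>k. slow_growth \<mu> k f A" and e: "0 < e"
  obtains n where "1 \<le> n" "(\<integral>x. log_growth f A n x \<partial>\<mu>) < e * real n"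
proof -
  define g where "g = (\<lambda>x. ln (matrix_norm (A x)))"
  have g: "integrable \<mu> g" using int by (simp add: g_def)
  obtain c where c: "0 \<le> c" "(\<integral>x. max 0 (g x - c) \<partial>\<mu>) < e / 2"
    using truncation_tail_small[OF g, of "e / 2"] e by auto
  define H where "H = (\<lambda>x. max 0 (g x - c))"
  have H: "integrable \<mu> H" using g by (auto simp: H_def)
  define M where "M = measure \<mu> UNIV + c"
  have M: "0 \<le> M" using c by (simp add: M_def)
  obtain k where k: "2 * M / e < real (Suc k)" by (metis reals_Archimedean2 less_Suc_eq of_nat_less_iff order_less_trans)
  then have kM: "M / real (Suc k) < e / 2" using e by (simp add: field_simps)
  obtain n where n: "1 \<le> n" and small: "measure \<mu> {x. real n / real (Suc k) \<le> log_growth f A n x} < 1 / real (Suc k)"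
    using slow[of k] by (auto simp: slow_growth_def)
  define Z where "Z = {x. real n / real (Suc k) \<le> log_growth f A n x}"
  have [measurable]: "log_growth f A n \<in> borel_measurable \<mu>" using integrable_log_growth by auto
  have Z: "Z \<in> sets \<mu>" unfolding Z_def by (rule Collect_in_sets) measurable
  have Hj: "integrable \<mu> (\<lambda>x. H ((f ^^ j) x))" "(\<integral>x. H ((f ^^ j) x) \<partial>\<mu>) = (\<integral>x. H x \<partial>\<mu>)" for j
    using automorphism_integrable[OF automorphism_funpow[OF f] H]
      automorphism_integral[OF automorphism_funpow[OF f]] H by auto
  have iZ: "integrable \<mu> (\<lambda>x. indicator Z x * (real n * c))"
    using Z by (auto intro!: integrable_real_indicator simp: emeasure_eq_measure)
  have pt: "log_growth f A n x \<le> real n / real (Suc k) + indicator Z x * (real n * c) + (\<Sum>j<n. H ((f ^^ j) x))" for x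
  proof (cases "x \<in> Z")
    case True
    have "log_growth f A n x \<le> (\<Sum>j<n. g ((f ^^ j) x))"
      using log_growth_le_sum[OF A(2)] by (simp add: g_def)
    also have "\<dots> \<le> (\<Sum>j<n. c + H ((f ^^ j) x))"
      by (intro sum_mono) (simp add: H_def)
    also have "\<dots> = real n * c + (\<Sum>j<n. H ((f ^^ j) x))" by (simp add: sum.distrib)
    finally have "log_growth f A n x \<le> real n * c + (\<Sum>j<n. H ((f ^^ j) x))" .
    moreover have "0 \<le> real n / real (Suc k)" by simp
    moreover have "indicator Z x * (real n * c) = real n * c" using True by simp
    ultimately show ?thesis by linarith
  next
    case False
    moreover have "0 \<le> (\<Sum>j<n. H ((f ^^ j) x))" by (intro sum_nonneg) (simp add: H_def)
    ultimately show ?thesis by (simp add: Z_def)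
  qed
  have "(\<integral>x. log_growth f A n x \<partial>\<mu>)
      \<le> (\<integral>x. real n / real (Suc k) + indicator Z x * (real n * c) + (\<Sum>j<n. H ((f ^^ j) x)) \<partial>\<mu>)"
    using pt iZ Hj integrable_log_growth
    by (intro integral_mono Bochner_Integration.integrable_add Bochner_Integration.integrable_sum) auto
  also have "\<dots> = real n / real (Suc k) * measure \<mu> UNIV + measure \<mu> Z * (real n * c) + real n * (\<integral>x. H x \<partial>\<mu>)"
    using iZ Hj Z by (simp add: Bochner_Integration.integral_sum)
  also have "\<dots> \<le> real n / real (Suc k) * measure \<mu> UNIV + 1 / real (Suc k) * (real n * c) + real n * (\<integral>x. H x \<partial>\<mu>)"
    using mult_right_mono[of "measure \<mu> Z" "1 / real (Suc k)" "real n * c"] small c(1) unfolding Z_def by auto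
  also have "\<dots> = real n * (M / real (Suc k) + (\<integral>x. H x \<partial>\<mu>))"
    by (simp add: M_def algebra_simps add_divide_distrib del: of_nat_Suc)
  also have "\<dots> < real n * e"
  proof (rule mult_strict_left_mono)
    show "M / real (Suc k) + (\<integral>x. H x \<partial>\<mu>) < e"
      using kM c(2) unfolding H_def by linarith
  qed (use n in auto)
  finally show ?thesis using that[OF n] by (simp add: mult.commute)
qed

text \<open>
  Outside a set of small measure, the maximal inequality controls both the Birkhoff sums of
  \<open>log_growth f A N\<close> along \<open>f ^^ N\<close> and those of the unbounded part \<open>H\<close> of the generator; the latter
  bounds the last incomplete block of length less than \<open>N\<close>.
\<close>

lemma large_growth_set:
  assumes slow: "\<And>k. slow_growth \<mu> k f A" and e: "0 < e"
  obtains Z where "Z \<in> sets \<mu>" "measure \<mu> Z \<le> 2 * e"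
    and "\<And>x. x \<notin> Z \<Longrightarrow> \<forall>\<^sub>F n in sequentially. log_growth f A n x \<le> 3 * e * real n"
proof -
  define g where "g = (\<lambda>x. ln (matrix_norm (A x)))"
  have g: "integrable \<mu> g" using int by (simp add: g_def)
  obtain c where c: "0 \<le> c" "(\<integral>x. max 0 (g x - c) \<partial>\<mu>) < e\<^sup>2"
    using truncation_tail_small[OF g, of "e\<^sup>2"] e by auto
  define H where "H = (\<lambda>x. max 0 (g x - c))"
  have H: "integrable \<mu> H" "\<And>x. 0 \<le> H x" using g by (auto simp: H_def)
  obtain N where N: "1 \<le> N" "(\<integral>x. log_growth f A N x \<partial>\<mu>) < e\<^sup>2 * real N"
    using small_mean_log_growth[OF slow, of "e\<^sup>2"] e by auto
  define Z1 where "Z1 = {x. \<exists>m. e * real N * real m < (\<Sum>j<m. log_growth f A N (((f ^^ N) ^^ j) x))}"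
  define Z2 where "Z2 = {x. \<exists>m. e * real m < (\<Sum>j<m. H ((f ^^ j) x))}"
  have "Z1 \<in> sets \<mu>" "measure \<mu> Z1 \<le> (\<integral>x. log_growth f A N x \<partial>\<mu>) / (e * real N)"
    unfolding Z1_def using N e
    by (intro maximal_inequality automorphism_funpow f integrable_log_growth log_growth_nonneg A; simp)+
  moreover have "(\<integral>x. log_growth f A N x \<partial>\<mu>) / (e * real N) \<le> e"
    using N e by (simp add: field_simps power2_eq_square)
  moreover have "Z2 \<in> sets \<mu>" "measure \<mu> Z2 \<le> (\<integral>x. H x \<partial>\<mu>) / e"
    unfolding Z2_def using e by (intro maximal_inequality f H; simp)+
  moreover have "(\<integral>x. H x \<partial>\<mu>) / e \<le> e"
    using c e by (simp add: field_simps power2_eq_square H_def)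
  ultimately have Z: "Z1 \<union> Z2 \<in> sets \<mu>" "measure \<mu> (Z1 \<union> Z2) \<le> 2 * e"
    using measure_Un_le[of Z1 \<mu> Z2] by auto
  have "\<forall>\<^sub>F n in sequentially. log_growth f A n x \<le> 3 * e * real n" if x: "x \<notin> Z1 \<union> Z2" for x
  proof -
    have bound: "log_growth f A n x \<le> 2 * e * real n + real N * (c + e)" for n
    proof -
      define q r where "q = n div N" and "r = n mod N"
      have n: "n = r + N * q" and r: "r < N" using N by (simp_all add: q_def r_def)
      have "log_growth f A n x \<le> log_growth f A r ((f ^^ (N * q)) x) + log_growth f A (N * q) x"
        using log_growth_add[OF A(2), of f r "N * q" x] n by simp
      also have "log_growth f A (N * q) x \<le> e * real N * real q"
        using log_growth_mult_le_sum[OF A(2), of f N q x] x by (auto simp: Z1_def not_less intro: order_trans)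
      also have "log_growth f A r ((f ^^ (N * q)) x) \<le> (\<Sum>j<r. g ((f ^^ j) ((f ^^ (N * q)) x)))"
        using log_growth_le_sum[OF A(2)] by (simp add: g_def)
      also have "\<dots> \<le> (\<Sum>j<r. c + H ((f ^^ (j + N * q)) x))"
        by (intro sum_mono) (simp add: H_def funpow_add)
      also have "\<dots> = real r * c + (\<Sum>j<r. H ((f ^^ (j + N * q)) x))" by (simp add: sum.distrib)
      also have "(\<Sum>j<r. H ((f ^^ (j + N * q)) x)) = (\<Sum>i\<in>{N * q..<N * q + r}. H ((f ^^ i) x))"
        by (rule sum.reindex_bij_witness[of _ "\<lambda>i. i - N * q" "\<lambda>j. j + N * q"]) auto
      also have "\<dots> \<le> (\<Sum>i<n. H ((f ^^ i) x))"
        using n H by (intro sum_mono2) auto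
      also have "\<dots> \<le> e * real n" using x by (auto simp: Z2_def not_less)
      also have "real r * c \<le> real N * c" using r c by (intro mult_right_mono) auto
      also have "e * real N * real q \<le> e * real n" using n e by simp
      also have "real N * c \<le> real N * (c + e)" using e by (simp add: distrib_left)
      finally show ?thesis by (simp add: algebra_simps)
    qed
    have "\<forall>\<^sub>F n in sequentially. real N * (c + e) / e \<le> real n"
      using eventually_ge_at_top[of "nat \<lceil>real N * (c + e) / e\<rceil>"] by eventually_elim linarith
    then show ?thesis
    proof eventually_elim
      case (elim n)
      then have "real N * (c + e) \<le> e * real n" using e by (simp add: field_simps)
      then show ?case using bound[of n] by simp
    qed
  qed
  then show ?thesis using that[OF Z] by blast
qed

text \<open>
  This case of the subadditive ergodic theorem, in which the limit is zero, follows from the maximal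
  inequality alone; convergence is part of the conclusion.
\<close>

theorem trivial_spectrum_if_slow_growth:
  assumes slow: "\<And>k. slow_growth \<mu> k f A"
  shows "trivial_spectrum \<mu> f A"
proof -
  have "\<exists>Z. Z \<in> sets \<mu> \<and> measure \<mu> Z \<le> 2 * (1 / real (Suc j)) \<and>
      (\<forall>x. x \<notin> Z \<longrightarrow> (\<forall>\<^sub>F n in sequentially. log_growth f A n x \<le> 3 * (1 / real (Suc j)) * real n))" for j
    using large_growth_set[OF slow, of "1 / real (Suc j)"] by (metis of_nat_0_less_iff zero_less_Suc zero_less_divide_1_iff)
  then obtain Z where Z: "\<And>j. Z j \<in> sets \<mu>" "\<And>j. measure \<mu> (Z j) \<le> 2 * (1 / real (Suc j))"
    "\<And>j x. x \<notin> Z j \<Longrightarrow> \<forall>\<^sub>F n in sequentially. log_growth f A n x \<le> 3 * (1 / real (Suc j)) * real n"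
    by metis
  have "AE x in \<mu>. \<forall>i. \<exists>j\<ge>i. x \<notin> Z j"
    unfolding AE_all_countable
  proof
    fix i
    define W where "W = (\<Inter>j\<in>{i..}. Z j)"
    have W: "W \<in> sets \<mu>" unfolding W_def using Z by (intro sets.countable_INT) auto
    have "measure \<mu> W \<le> 2 * (1 / real (Suc j))" if "i \<le> j" for j
    proof -
      have "measure \<mu> W \<le> measure \<mu> (Z j)" using Z that by (intro finite_measure_mono) (auto simp: W_def)
      then show ?thesis using Z(2)[of j] by simp
    qed
    moreover have "(\<lambda>j. 2 * (1 / real (Suc j))) \<longlonglongrightarrow> 2 * 0"
      by (intro tendsto_mult tendsto_const LIMSEQ_Suc lim_1_over_n)
    ultimately have "measure \<mu> W \<le> 0"
      by (intro LIMSEQ_le_const[of _ "2 * 0" "measure \<mu> W", simplified]) auto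
    then have "W \<in> null_sets \<mu>" using W by (simp add: null_sets_def emeasure_eq_measure antisym)
    then show "AE x in \<mu>. \<exists>j\<ge>i. x \<notin> Z j"
      by (rule AE_I') (auto simp: W_def)
  qed
  then show ?thesis
    unfolding trivial_spectrum_def
  proof eventually_elim
    case (elim x)
    have "lyapunov_seq f A x \<longlonglongrightarrow> 0"
    proof (rule order_tendstoI)
      fix a :: real assume "a < 0"
      moreover have "0 \<le> lyapunov_seq f A x n" for n
        using log_growth_nonneg[OF A(2), of f n x] by (simp add: lyapunov_seq_def log_growth_def)
      ultimately show "\<forall>\<^sub>F n in sequentially. a < lyapunov_seq f A x n"
        by (intro always_eventually allI) (rule less_le_trans)
    next
      fix a :: real assume a: "0 < a"
      obtain i where i: "3 / a < real i" using reals_Archimedean2 by blast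
      obtain j where j: "i \<le> j" "x \<notin> Z j" using elim by blast
      have "3 / a < real (Suc j)" using i j by (smt (verit) of_nat_Suc of_nat_mono)
      then have ja: "3 * (1 / real (Suc j)) < a" using a by (simp add: field_simps)
      show "\<forall>\<^sub>F n in sequentially. lyapunov_seq f A x n < a"
        using Z(3)[OF j(2)] eventually_gt_at_top[of 0]
      proof eventually_elim
        case (elim n)
        have "log_growth f A n x < a * real n"
          using elim mult_strict_right_mono[OF ja, of "real n"] by simp
        then show ?case using elim by (simp add: lyapunov_seq_def log_growth_def field_simps)
      qed
    qed
    then show ?case
      by (auto simp: convergent_def lyapunov_exponent_def limI)
  qed
qed

end

end

section \<open>Classes modulo almost everywhere equality and the distance of Lp\<close>

text \<open>
  A representative of a class; it is the one chosen in the definition of \<open>Lp_dist\<close>.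
\<close>

definition rep :: "'b set \<Rightarrow> 'b" where
  "rep X = (SOME x. x \<in> X)"

lemma ae_class_rep:
  assumes "\<alpha> \<in> X // ae_rel \<mu> X"
  shows "rep \<alpha> \<in> \<alpha>" "rep \<alpha> \<in> X" "\<And>f. f \<in> \<alpha> \<Longrightarrow> f \<in> X" "\<And>f g. f \<in> \<alpha> \<Longrightarrow> g \<in> \<alpha> \<Longrightarrow> AE x in \<mu>. f x = g x"
proof -
  have "\<alpha> \<noteq> {}" using in_quotient_imp_non_empty[OF equiv_ae_rel assms] .
  then show "rep \<alpha> \<in> \<alpha>" by (simp add: rep_def some_in_eq)
  show X: "f \<in> X" if "f \<in> \<alpha>" for f
    using in_quotient_imp_subset[OF equiv_ae_rel assms] that by blast
  then show "rep \<alpha> \<in> X" using \<open>rep \<alpha> \<in> \<alpha>\<close> by blast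
  show "AE x in \<mu>. f x = g x" if "f \<in> \<alpha>" "g \<in> \<alpha>" for f g
    using in_quotient_imp_in_rel[OF equiv_ae_rel assms, of f g] that by (simp add: ae_rel_def)
qed

lemma ae_class_eqI:
  assumes "\<alpha> \<in> X // ae_rel \<mu> X" "\<beta> \<in> X // ae_rel \<mu> X" "f \<in> \<alpha>" "g \<in> \<beta>" "AE x in \<mu>. f x = g x"
  shows "\<alpha> = \<beta>"
  using quotient_eq_iff[OF equiv_ae_rel assms(1-4)] assms ae_class_rep(3)
  by (auto simp: ae_rel_def)

text \<open>
  The class of \<open>f\<close> modulo almost everywhere equality, inside the set \<open>X\<close> of admissible maps.
\<close>

definition ae_class :: "'a measure \<Rightarrow> ('a \<Rightarrow> 'b) set \<Rightarrow> ('a \<Rightarrow> 'b) \<Rightarrow> ('a \<Rightarrow> 'b) set" where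
  "ae_class \<mu> X f = ae_rel \<mu> X `` {f}"

lemma ae_class_in_quotient: "f \<in> X \<Longrightarrow> ae_class \<mu> X f \<in> X // ae_rel \<mu> X"
  by (simp add: ae_class_def quotientI)

lemma self_in_ae_class: "f \<in> X \<Longrightarrow> f \<in> ae_class \<mu> X f"
  by (simp add: ae_class_def ae_rel_def)

lemma ae_class_of_member: "\<alpha> \<in> X // ae_rel \<mu> X \<Longrightarrow> f \<in> \<alpha> \<Longrightarrow> ae_class \<mu> X f = \<alpha>"
  by (rule ae_class_eqI[of _ X \<mu> _ f f])
    (auto intro: ae_class_in_quotient self_in_ae_class ae_class_rep(3))

lemma powr_convex_nonneg:
  fixes x y p t :: real
  assumes p: "1 \<le> p" and x: "0 \<le> x" and y: "0 \<le> y" and t: "0 \<le> t" "t \<le> 1"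
  shows "((1 - t) * x + t * y) powr p \<le> (1 - t) * x powr p + t * y powr p"
proof -
  have shrink: "(s * z) powr p \<le> s * z powr p" if "0 \<le> s" "s \<le> 1" "0 \<le> z" for s z :: real
  proof -
    have "s powr p \<le> s"
    proof (cases "s = 0")
      case False
      then have "s powr p \<le> s powr 1" using that p by (intro powr_mono') auto
      then show ?thesis using that by simp
    qed simp
    then show ?thesis using that by (simp add: powr_mult mult_right_mono)
  qed
  consider "x = 0" | "y = 0" | "0 < x" "0 < y" using x y by linarith
  then show ?thesis
  proof cases
    case 1
    then show ?thesis using shrink[of t y] t y p by simp
  next
    case 2
    then show ?thesis using shrink[of "1 - t" x] t x p by simp
  next
    case 3
    then show ?thesis using convex_onD[OF powr_convex[OF p], of t x y] t by simp
  qed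
qed

lemma Minkowski_inequality:
  fixes u v w :: "'a \<Rightarrow> real"
  assumes p: "1 \<le> p"
    and u: "\<And>x. 0 \<le> u x" "integrable M (\<lambda>x. u x powr p)"
    and v: "\<And>x. 0 \<le> v x" "integrable M (\<lambda>x. v x powr p)"
    and w: "\<And>x. 0 \<le> w x" "integrable M (\<lambda>x. w x powr p)" "\<And>x. w x \<le> u x + v x"
  shows "(\<integral>x. w x powr p \<partial>M) powr (1 / p) \<le> (\<integral>x. u x powr p \<partial>M) powr (1 / p) + (\<integral>x. v x powr p \<partial>M) powr (1 / p)"
proof -
  define N where "N = (\<lambda>u. (\<integral>x. u x powr p \<partial>M) powr (1 / p))"
  have p0: "0 < p" using p by simp
  have Np: "N u powr p = (\<integral>x. u x powr p \<partial>M)" for u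
  proof -
    have "0 \<le> (\<integral>x. u x powr p \<partial>M)" by simp
    then show ?thesis using p0 by (simp add: N_def powr_powr)
  qed
  \<comment> \<open>Replacing the norms by slightly larger positive numbers avoids the case of norm zero.\<close>
  have "N w \<le> N u + N v + e" if e: "0 < e" for e
  proof -
    define a b where "a = N u + e / 2" and "b = N v + e / 2"
    have N0: "0 \<le> N u" "0 \<le> N v" by (simp_all add: N_def)
    have ab: "0 < a" "0 < b" "N u \<le> a" "N v \<le> b" using e N0 by (simp_all add: a_def b_def)
    define t where "t = b / (a + b)"
    have t: "0 \<le> t" "t \<le> 1" "1 - t = a / (a + b)" using ab by (simp_all add: t_def field_simps)
    define C D where "C = (a + b) powr p * (1 - t) / a powr p" and "D = (a + b) powr p * t / b powr p"
    have pt: "w x powr p \<le> C * u x powr p + D * v x powr p" for x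
    proof -
      have "(1 - t) * (u x / a) + t * (v x / b) = (u x + v x) / (a + b)"
        unfolding t(3) using ab by (simp add: t_def add_divide_distrib)
      then have "w x \<le> (a + b) * ((1 - t) * (u x / a) + t * (v x / b))"
        using w(3)[of x] ab by simp
      then have "w x powr p \<le> ((a + b) * ((1 - t) * (u x / a) + t * (v x / b))) powr p"
        using w(1) p0 by (intro powr_mono2) auto
      also have "\<dots> = (a + b) powr p * ((1 - t) * (u x / a) + t * (v x / b)) powr p"
        by (rule powr_mult)
      also have "\<dots> \<le> (a + b) powr p * ((1 - t) * (u x / a) powr p + t * (v x / b) powr p)"
        using ab u(1)[of x] v(1)[of x] t p by (intro mult_left_mono powr_convex_nonneg) auto
      also have "\<dots> = C * u x powr p + D * v x powr p"
        using ab u(1)[of x] v(1)[of x] by (simp add: C_def D_def powr_divide field_simps)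
      finally show ?thesis .
    qed
    have "N w powr p \<le> (\<integral>x. C * u x powr p + D * v x powr p \<partial>M)"
      unfolding Np using pt u v w by (intro integral_mono) auto
    also have "\<dots> = C * N u powr p + D * N v powr p"
      using u v by (simp add: Np)
    also have "\<dots> \<le> C * a powr p + D * b powr p"
      using ab t N0 p0 by (intro add_mono mult_left_mono powr_mono2) (auto simp: C_def D_def)
    also have "\<dots> = (a + b) powr p" 
    proof -
      have "C * a powr p = (a + b) powr p * (1 - t)" "D * b powr p = (a + b) powr p * t"
        using ab by (simp_all add: C_def D_def)
      then show ?thesis by (simp add: algebra_simps)
    qed
    finally have "N w powr p \<le> (a + b) powr p" .
    then have "N w \<le> a + b"
      using powr_less_mono2[of p "a + b" "N w"] ab p0 by linarith
    then show ?thesis by (simp add: a_def b_def)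
  qed
  then show ?thesis unfolding N_def by (rule field_le_epsilon)
qed

context finite_measure_on_borel
begin

lemma Lp_maps_measurable: "A \<in> Lp_maps \<mu> p \<Longrightarrow> A \<in> borel_measurable \<mu>"
  and Lp_maps_SL2: "A \<in> Lp_maps \<mu> p \<Longrightarrow> range A \<subseteq> SL2"
  and Lp_maps_integrable: "A \<in> Lp_maps \<mu> p \<Longrightarrow> integrable \<mu> (\<lambda>x. matrix_norm (A x) powr p)"
  by (simp_all add: Lp_maps_def)

lemma Lp_maps_norm_ge_1: "A \<in> Lp_maps \<mu> p \<Longrightarrow> 1 \<le> matrix_norm (A x)"
  using Lp_maps_SL2 matrix_norm_SL2 by blast

lemma integrable_Lp_diff:
  assumes p: "1 \<le> p" and A: "A \<in> Lp_maps \<mu> p" and B: "B \<in> Lp_maps \<mu> p"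
  shows "integrable \<mu> (\<lambda>x. matrix_norm (A x - B x) powr p)"
proof (rule Bochner_Integration.integrable_bound)
  note [measurable] = Lp_maps_measurable[OF A] Lp_maps_measurable[OF B]
  show "integrable \<mu> (\<lambda>x. 2 powr p * (matrix_norm (A x) powr p + matrix_norm (B x) powr p))"
    using Lp_maps_integrable[OF A] Lp_maps_integrable[OF B] by auto
  show "(\<lambda>x. matrix_norm (A x - B x) powr p) \<in> borel_measurable \<mu>" by measurable
  show "AE x in \<mu>. norm (matrix_norm (A x - B x) powr p)
      \<le> norm (2 powr p * (matrix_norm (A x) powr p + matrix_norm (B x) powr p))"
  proof (rule AE_I2)
    fix x
    define m where "m = max (matrix_norm (A x)) (matrix_norm (B x))"
    have "matrix_norm (A x - B x) \<le> 2 * m"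
      using matrix_norm_diff_le[of "A x" "B x"] by (simp add: m_def)
    then have "matrix_norm (A x - B x) powr p \<le> (2 * m) powr p"
      using p by (intro powr_mono2) auto
    also have "\<dots> = 2 powr p * m powr p" by (rule powr_mult)
    also have "\<dots> \<le> 2 powr p * (matrix_norm (A x) powr p + matrix_norm (B x) powr p)"
      by (intro mult_left_mono) (auto simp: m_def max_def)
    finally show "norm (matrix_norm (A x - B x) powr p)
      \<le> norm (2 powr p * (matrix_norm (A x) powr p + matrix_norm (B x) powr p))" by simp
  qed
qed

lemma Lp_dist_eq:
  assumes \<alpha>: "\<alpha> \<in> Lp_SL2 \<mu> p" "A \<in> \<alpha>" and \<beta>: "\<beta> \<in> Lp_SL2 \<mu> p" "B \<in> \<beta>"
  shows "Lp_dist \<mu> p \<alpha> \<beta> = (\<integral>x. matrix_norm (A x - B x) powr p \<partial>\<mu>) powr (1 / p)"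
proof -
  note \<alpha>r = ae_class_rep[OF \<alpha>(1)[unfolded Lp_SL2_def]] and \<beta>r = ae_class_rep[OF \<beta>(1)[unfolded Lp_SL2_def]]
  note [measurable] = Lp_maps_measurable[OF \<alpha>r(2)] Lp_maps_measurable[OF \<beta>r(2)]
    Lp_maps_measurable[OF \<alpha>r(3)[OF \<alpha>(2)]] Lp_maps_measurable[OF \<beta>r(3)[OF \<beta>(2)]]
  have "(\<integral>x. matrix_norm (rep \<alpha> x - rep \<beta> x) powr p \<partial>\<mu>) = (\<integral>x. matrix_norm (A x - B x) powr p \<partial>\<mu>)"
  proof (rule integral_cong_AE)
    show "AE x in \<mu>. matrix_norm (rep \<alpha> x - rep \<beta> x) powr p = matrix_norm (A x - B x) powr p"
      using \<alpha>r(4)[OF \<alpha>r(1) \<alpha>(2)] \<beta>r(4)[OF \<beta>r(1) \<beta>(2)] by eventually_elim simp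
  qed measurable
  then show ?thesis by (simp add: Lp_dist_def rep_def Let_def)
qed

lemma Lp_Metric_space:
  assumes p: "1 \<le> p"
  shows "Metric_space (Lp_SL2 \<mu> p) (Lp_dist \<mu> p)"
proof
  note int = integrable_Lp_diff[OF p]
  have rep: "rep \<alpha> \<in> \<alpha>" "rep \<alpha> \<in> Lp_maps \<mu> p" if "\<alpha> \<in> Lp_SL2 \<mu> p" for \<alpha>
    using ae_class_rep(1,2)[OF that[unfolded Lp_SL2_def]] by auto
  show "0 \<le> Lp_dist \<mu> p \<alpha> \<beta>" for \<alpha> \<beta>
    by (simp add: Lp_dist_def Let_def)
  show "Lp_dist \<mu> p \<alpha> \<beta> = Lp_dist \<mu> p \<beta> \<alpha>" for \<alpha> \<beta>
    by (simp add: Lp_dist_def Let_def matrix_norm_minus_commute)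
  fix \<alpha> \<beta> assume \<alpha>: "\<alpha> \<in> Lp_SL2 \<mu> p" and \<beta>: "\<beta> \<in> Lp_SL2 \<mu> p"
  have d: "Lp_dist \<mu> p \<alpha> \<beta> = (\<integral>x. matrix_norm (rep \<alpha> x - rep \<beta> x) powr p \<partial>\<mu>) powr (1 / p)"
    using Lp_dist_eq rep \<alpha> \<beta> by blast
  show "Lp_dist \<mu> p \<alpha> \<beta> = 0 \<longleftrightarrow> \<alpha> = \<beta>"
  proof
    assume "Lp_dist \<mu> p \<alpha> \<beta> = 0"
    then have "(\<integral>x. matrix_norm (rep \<alpha> x - rep \<beta> x) powr p \<partial>\<mu>) = 0" using d by simp
    then have "AE x in \<mu>. matrix_norm (rep \<alpha> x - rep \<beta> x) powr p = 0"
      using integral_nonneg_eq_0_iff_AE[OF int[OF rep(2)[OF \<alpha>] rep(2)[OF \<beta>]]] by simp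
    then have "AE x in \<mu>. rep \<alpha> x = rep \<beta> x"
      by eventually_elim (simp add: matrix_norm_0_iff)
    then show "\<alpha> = \<beta>"
      using ae_class_eqI[OF \<alpha>[unfolded Lp_SL2_def] \<beta>[unfolded Lp_SL2_def] rep(1)[OF \<alpha>] rep(1)[OF \<beta>]] by blast
  next
    assume "\<alpha> = \<beta>"
    then show "Lp_dist \<mu> p \<alpha> \<beta> = 0" using d by (simp add: matrix_norm_0_iff[THEN iffD2])
  qed
  fix \<gamma> assume \<gamma>: "\<gamma> \<in> Lp_SL2 \<mu> p"
  have "matrix_norm (rep \<alpha> x - rep \<gamma> x) \<le> matrix_norm (rep \<alpha> x - rep \<beta> x) + matrix_norm (rep \<beta> x - rep \<gamma> x)" for x
    using matrix_norm_triangle[of "rep \<alpha> x - rep \<beta> x" "rep \<beta> x - rep \<gamma> x"] by simp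
  then show "Lp_dist \<mu> p \<alpha> \<gamma> \<le> Lp_dist \<mu> p \<alpha> \<beta> + Lp_dist \<mu> p \<beta> \<gamma>"
    unfolding Lp_dist_eq[OF \<alpha> rep(1)[OF \<alpha>] \<beta> rep(1)[OF \<beta>]] Lp_dist_eq[OF \<alpha> rep(1)[OF \<alpha>] \<gamma> rep(1)[OF \<gamma>]]
      Lp_dist_eq[OF \<beta> rep(1)[OF \<beta>] \<gamma> rep(1)[OF \<gamma>]]
    by (intro Minkowski_inequality[OF p] int rep(2) \<alpha> \<beta> \<gamma>) auto
qed

lemma topspace_Lp_topology: "1 \<le> p \<Longrightarrow> topspace (Lp_topology \<mu> p) = Lp_SL2 \<mu> p"
  unfolding Lp_topology_def by (rule Metric_space.topspace_mtopology[OF Lp_Metric_space])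

lemma openin_Lp_topology:
  assumes "1 \<le> p"
  shows "openin (Lp_topology \<mu> p) U \<longleftrightarrow> U \<subseteq> Lp_SL2 \<mu> p \<and>
    (\<forall>\<alpha>\<in>U. \<exists>r>0. \<forall>\<beta>\<in>Lp_SL2 \<mu> p. Lp_dist \<mu> p \<alpha> \<beta> < r \<longrightarrow> \<beta> \<in> U)"
  unfolding Lp_topology_def Metric_space.openin_mtopology[OF Lp_Metric_space[OF assms]]
    Metric_space.mball_def[OF Lp_Metric_space[OF assms]]
  by blast

end

section \<open>Slow growth is an open condition in each variable\<close>

context finite_measure_on_borel
begin

text \<open>
  Convergence in measure of \<open>T i\<close> to \<open>T0\<close> along the filter \<open>\<F>\<close>, phrased without a metric: few points that
  \<open>T0\<close> sends into a given open set are sent outside of it by \<open>T i\<close>. Measurability of \<open>T i\<close> is required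
  only eventually, because the index will run over neighbourhood filters.
\<close>

definition tends_in_measure ::
  "'i filter \<Rightarrow> ('i \<Rightarrow> 'a \<Rightarrow> 'x::second_countable_topology) \<Rightarrow> ('a \<Rightarrow> 'x) \<Rightarrow> bool" where
  "tends_in_measure \<F> T T0 \<longleftrightarrow> T0 \<in> borel_measurable \<mu> \<and> (\<forall>\<^sub>F i in \<F>. T i \<in> borel_measurable \<mu>) \<and>
     (\<forall>W e. open W \<longrightarrow> e > 0 \<longrightarrow> (\<forall>\<^sub>F i in \<F>. measure \<mu> {x. T0 x \<in> W \<and> T i x \<notin> W} < e))"

lemma loss_sets:
  assumes "T0 \<in> borel_measurable \<mu>" "T \<in> borel_measurable \<mu>" "open W"
  shows "{x. T0 x \<in> W \<and> T x \<notin> W} \<in> sets \<mu>"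
proof -
  have [measurable]: "W \<in> sets borel" using assms by simp
  have "{x \<in> space \<mu>. T0 x \<in> W \<and> T x \<notin> W} \<in> sets \<mu>"
    using assms by measurable
  then show ?thesis by simp
qed

lemma tends_in_measure_const:
  "T0 \<in> borel_measurable \<mu> \<Longrightarrow> tends_in_measure \<F> (\<lambda>i. T0) T0"
  by (simp add: tends_in_measure_def)

lemma tends_in_measure_compose:
  fixes h :: "'x::second_countable_topology \<Rightarrow> 'y::second_countable_topology"
  assumes T: "tends_in_measure \<F> T T0" and h: "continuous_on UNIV h"
  shows "tends_in_measure \<F> (\<lambda>i x. h (T i x)) (\<lambda>x. h (T0 x))"
  unfolding tends_in_measure_def
proof (intro conjI allI impI)
  have hm: "h \<in> borel_measurable borel" using h by (rule borel_measurable_continuous_onI)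
  show "(\<lambda>x. h (T0 x)) \<in> borel_measurable \<mu>"
    using T hm unfolding tends_in_measure_def by (auto intro: measurable_compose)
  show "\<forall>\<^sub>F i in \<F>. (\<lambda>x. h (T i x)) \<in> borel_measurable \<mu>"
    using T unfolding tends_in_measure_def
    by (auto elim!: eventually_mono intro: measurable_compose[OF _ hm])
  fix W :: "'y set" and e :: real assume W: "open W" and e: "0 < e"
  have "open (h -` W)" using W h by (simp add: continuous_on_open_vimage)
  then have "\<forall>\<^sub>F i in \<F>. measure \<mu> {x. T0 x \<in> h -` W \<and> T i x \<notin> h -` W} < e"
    using T e unfolding tends_in_measure_def by blast
  then show "\<forall>\<^sub>F i in \<F>. measure \<mu> {x. h (T0 x) \<in> W \<and> h (T i x) \<notin> W} < e" by simp
qed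

text \<open>
  An open set of the product is a countable union of open rectangles, and finitely many of them carry
  almost all the mass.
\<close>

lemma tends_in_measure_Pair:
  fixes T0 :: "'a \<Rightarrow> 'x::second_countable_topology" and S0 :: "'a \<Rightarrow> 'y::second_countable_topology"
  assumes T: "tends_in_measure \<F> T T0" and S: "tends_in_measure \<F> S S0"
  shows "tends_in_measure \<F> (\<lambda>i x. (T i x, S i x)) (\<lambda>x. (T0 x, S0 x))"
  unfolding tends_in_measure_def
proof (intro conjI allI impI)
  have [measurable]: "T0 \<in> borel_measurable \<mu>" "S0 \<in> borel_measurable \<mu>"
    using T S by (auto simp: tends_in_measure_def)
  have ev: "\<forall>\<^sub>F i in \<F>. T i \<in> borel_measurable \<mu>" "\<forall>\<^sub>F i in \<F>. S i \<in> borel_measurable \<mu>"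
    using T S by (auto simp: tends_in_measure_def)
  show P0: "(\<lambda>x. (T0 x, S0 x)) \<in> borel_measurable \<mu>" by measurable
  show "\<forall>\<^sub>F i in \<F>. (\<lambda>x. (T i x, S i x)) \<in> borel_measurable \<mu>"
    using ev
  proof eventually_elim
    case (elim i)
    note [measurable] = elim
    show ?case by measurable
  qed
  fix W :: "('x \<times> 'y) set" and e :: real assume W: "open W" and e: "0 < e"
  obtain BX :: "'x set set" where BX: "countable BX" "topological_basis BX" using ex_countable_basis by blast
  obtain BY :: "'y set set" where BY: "countable BY" "topological_basis BY" using ex_countable_basis by blast
  obtain \<B> where \<B>: "\<B> \<subseteq> BX \<times> BY" "W = (\<Union>(U, V)\<in>\<B>. U \<times> V)"
  proof -
    obtain \<B>' where "\<B>' \<subseteq> (\<lambda>(a, b). a \<times> b) ` (BX \<times> BY)" "W = \<Union>\<B>'"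
      using topological_basis_prod[OF BX(2) BY(2)] W unfolding topological_basis_def by metis
    then show ?thesis using that by (auto simp: subset_image_iff)
  qed
  have cnt: "countable \<B>" by (rule countable_subset[OF \<B>(1)]) (intro countable_SIGMA BX BY)
  show "\<forall>\<^sub>F i in \<F>. measure \<mu> {x. (T0 x, S0 x) \<in> W \<and> (T i x, S i x) \<notin> W} < e"
  proof (cases "\<B> = {}")
    case True
    then have "W = {}" using \<B>(2) by simp
    then show ?thesis using e by simp
  next
    case False
    define U V where "U = (\<lambda>n. fst (from_nat_into \<B> n))" and "V = (\<lambda>n. snd (from_nat_into \<B> n))"
    have UV: "open (U n)" "open (V n)" for n
    proof -
      have "from_nat_into \<B> n \<in> BX \<times> BY" using from_nat_into[OF False] \<B>(1) by blast
      then show "open (U n)" "open (V n)"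
        using topological_basis_open[OF BX(2)] topological_basis_open[OF BY(2)]
        by (simp_all add: U_def V_def mem_Times_iff)
    qed
    have WUV: "W = (\<Union>n. U n \<times> V n)"
    proof -
      have "W = (\<Union>(U, V)\<in>range (from_nat_into \<B>). U \<times> V)"
        using \<B>(2) range_from_nat_into[OF False cnt] by simp
      also have "\<dots> = (\<Union>n. case from_nat_into \<B> n of (U, V) \<Rightarrow> U \<times> V)" by simp
      finally show ?thesis by (simp add: U_def V_def case_prod_unfold)
    qed
    define R where "R = (\<lambda>m. {x. (T0 x, S0 x) \<in> W - (\<Union>n<m. U n \<times> V n)})"
    have [measurable]: "U n \<in> sets borel" "V n \<in> sets borel" "W \<in> sets borel" for n using UV W by auto
    have Rm: "R m \<in> sets \<mu>" for m
    proof -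
      have "{x \<in> space \<mu>. (T0 x, S0 x) \<in> W \<and> (\<forall>n\<in>{..<m}. \<not> (T0 x \<in> U n \<and> S0 x \<in> V n))} \<in> sets \<mu>"
        using P0 by measurable
      then show ?thesis by (simp add: R_def Ball_def)
    qed
    have "(\<lambda>m. measure \<mu> (R m)) \<longlonglongrightarrow> measure \<mu> (\<Inter>m. R m)"
      using Rm by (intro finite_Lim_measure_decseq) (auto simp: R_def decseq_def)
    also have "(\<Inter>m. R m) = {}"
      unfolding R_def WUV by auto
    finally have "\<forall>\<^sub>F m in sequentially. measure \<mu> (R m) < e / 2"
      using e by (intro order_tendstoD(2)) auto
    then obtain m where m: "measure \<mu> (R m) < e / 2" by (auto simp: eventually_sequentially)
    define d where "d = e / (4 * (real m + 1))"
    have d: "0 < d" using e by (simp add: d_def)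
    have "\<forall>\<^sub>F i in \<F>. \<forall>n\<in>{..<m}. measure \<mu> {x. T0 x \<in> U n \<and> T i x \<notin> U n} < d \<and>
        measure \<mu> {x. S0 x \<in> V n \<and> S i x \<notin> V n} < d"
      using T S UV d unfolding tends_in_measure_def
      by (intro eventually_ball_finite ballI eventually_conj) auto
    with ev show ?thesis
    proof eventually_elim
      case (elim i)
      define L where "L = (\<lambda>n. {x. T0 x \<in> U n \<and> T i x \<notin> U n} \<union> {x. S0 x \<in> V n \<and> S i x \<notin> V n})"
      have L: "L n \<in> sets \<mu>" for n unfolding L_def using elim UV by (intro sets.Un loss_sets) auto
      have Ld: "measure \<mu> (L n) \<le> 2 * d" if "n < m" for n
      proof -
        have "measure \<mu> (L n) \<le> measure \<mu> {x. T0 x \<in> U n \<and> T i x \<notin> U n} + measure \<mu> {x. S0 x \<in> V n \<and> S i x \<notin> V n}"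
          unfolding L_def using elim UV by (intro measure_Un_le loss_sets) auto
        also have "\<dots> \<le> d + d" using elim that by (intro add_mono) (auto intro: less_imp_le)
        finally show ?thesis by simp
      qed
      have "{x. (T0 x, S0 x) \<in> W \<and> (T i x, S i x) \<notin> W} \<subseteq> R m \<union> (\<Union>n<m. L n)"
        unfolding R_def L_def WUV by auto
      then have "measure \<mu> {x. (T0 x, S0 x) \<in> W \<and> (T i x, S i x) \<notin> W} \<le> measure \<mu> (R m \<union> (\<Union>n<m. L n))"
        using Rm L by (intro finite_measure_mono) auto
      also have "\<dots> \<le> measure \<mu> (R m) + (\<Sum>n<m. measure \<mu> (L n))"
        using Rm L measure_UNION_le[of "{..<m}" L \<mu>]
        by (intro order_trans[OF measure_Un_le]) auto
      also have "(\<Sum>n<m. measure \<mu> (L n)) \<le> (\<Sum>n<m. 2 * d)" using Ld by (intro sum_mono) auto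
      also have "\<dots> \<le> e / 2" using e by (simp add: d_def field_simps)
      finally show ?case using m by linarith
    qed
  qed
qed

lemma tends_in_measure_cocycle:
  assumes "\<And>j. tends_in_measure \<F> (\<lambda>i x. A i ((f i ^^ j) x)) (\<lambda>x. A0 ((f0 ^^ j) x))"
  shows "tends_in_measure \<F> (\<lambda>i. cocycle (f i) (A i) n) (cocycle f0 A0 n)"
proof (induction n)
  case 0
  have "cocycle f A 0 = (\<lambda>x. mat 1)" for f :: "'a \<Rightarrow> 'a" and A by (rule ext) simp
  then show ?case using tends_in_measure_const[of "\<lambda>x. mat 1" \<F>] by simp
next
  case (Suc n)
  have "tends_in_measure \<F> (\<lambda>i x. fst (A i ((f i ^^ n) x), cocycle (f i) (A i) n x) ** snd (A i ((f i ^^ n) x), cocycle (f i) (A i) n x))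
      (\<lambda>x. fst (A0 ((f0 ^^ n) x), cocycle f0 A0 n x) ** snd (A0 ((f0 ^^ n) x), cocycle f0 A0 n x))"
    by (rule tends_in_measure_compose[OF tends_in_measure_Pair[OF assms Suc], where h = "\<lambda>p. fst p ** snd p"])
      (intro continuous_intros)
  moreover have "cocycle f A (Suc n) = (\<lambda>x. A ((f ^^ n) x) ** cocycle f A n x)" for f :: "'a \<Rightarrow> 'a" and A
    by (rule ext) simp
  ultimately show ?case by simp
qed

lemma slow_growth_eventually:
  assumes "tends_in_measure \<F> (\<lambda>i. cocycle (f i) (A i) n) (cocycle f0 A0 n)"
    and SL: "range A0 \<subseteq> SL2" "\<forall>\<^sub>F i in \<F>. range (A i) \<subseteq> SL2"
    and n: "1 \<le> n" "measure \<mu> {x. real n / real (Suc k) \<le> log_growth f0 A0 n x} < 1 / real (Suc k)"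
  shows "\<forall>\<^sub>F i in \<F>. slow_growth \<mu> k (f i) (A i)"
proof -
  define t where "t = real n / real (Suc k)"
  define W where "W = {B. matrix_norm B < exp t}"
  have W: "open W" unfolding W_def by (intro open_Collect_less continuous_intros)
  have iff: "t \<le> log_growth f A n x \<longleftrightarrow> cocycle f A n x \<notin> W" if "range A \<subseteq> SL2"
    for f :: "'a \<Rightarrow> 'a" and A x
  proof -
    have "0 < matrix_norm (cocycle f A n x)"
      using matrix_norm_SL2[OF cocycle_SL2[OF that, of f n x]] by linarith
    then show ?thesis by (simp add: W_def log_growth_def not_less ln_ge_iff)
  qed
  define e where "e = 1 / real (Suc k) - measure \<mu> {x. cocycle f0 A0 n x \<notin> W}"
  have e: "0 < e" using n iff[OF SL(1)] by (simp add: e_def t_def)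
  have 1: "cocycle f0 A0 n \<in> borel_measurable \<mu>" "\<forall>\<^sub>F i in \<F>. cocycle (f i) (A i) n \<in> borel_measurable \<mu>"
    "\<forall>\<^sub>F i in \<F>. measure \<mu> {x. cocycle f0 A0 n x \<in> W \<and> cocycle (f i) (A i) n x \<notin> W} < e"
    using assms(1) W e unfolding tends_in_measure_def by auto
  from 1(2,3) SL(2) show ?thesis
  proof eventually_elim
    case (elim i)
    have C: "{x. cocycle f0 A0 n x \<notin> W} \<in> sets \<mu>"
      using loss_sets[of "cocycle f0 A0 n" "\<lambda>x. 0" UNIV] measurable_sets[OF 1(1), of "- W"] W
      by (auto simp: vimage_def)
    have "measure \<mu> {x. t \<le> log_growth (f i) (A i) n x} = measure \<mu> {x. cocycle (f i) (A i) n x \<notin> W}"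
      using iff[OF elim(3)] by simp
    also have "\<dots> \<le> measure \<mu> ({x. cocycle f0 A0 n x \<in> W \<and> cocycle (f i) (A i) n x \<notin> W} \<union> {x. cocycle f0 A0 n x \<notin> W})"
      using C loss_sets[OF 1(1) elim(1) W] by (intro finite_measure_mono) auto
    also have "\<dots> \<le> measure \<mu> {x. cocycle f0 A0 n x \<in> W \<and> cocycle (f i) (A i) n x \<notin> W} + measure \<mu> {x. cocycle f0 A0 n x \<notin> W}"
      using C loss_sets[OF 1(1) elim(1) W] by (intro measure_Un_le) auto
    also have "\<dots> < 1 / real (Suc k)" using elim by (simp add: e_def)
    finally show ?case using n(1) unfolding slow_growth_def t_def by blast
  qed
qed

end

lemma norm_le_matrix_norm: "norm B \<le> 4 * matrix_norm B"
proof -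
  have entry: "\<bar>B $ i $ j\<bar> \<le> matrix_norm B" for i j
  proof -
    have eqs: "B$1$1 = Re (mat_lin B + mat_conj B)" "B$2$1 = Im (mat_lin B + mat_conj B)"
      "B$2$2 = Re (mat_lin B - mat_conj B)" "B$1$2 = Im (mat_conj B - mat_lin B)"
      by (simp_all add: mat_lin_def mat_conj_def field_simps)
    have "cmod (mat_lin B + mat_conj B) \<le> matrix_norm B" "cmod (mat_lin B - mat_conj B) \<le> matrix_norm B"
      "cmod (mat_conj B - mat_lin B) \<le> matrix_norm B"
      using matrix_norm_eq[of B] norm_triangle_ineq[of "mat_lin B" "mat_conj B"]
        norm_triangle_ineq4[of "mat_lin B" "mat_conj B"] norm_triangle_ineq4[of "mat_conj B" "mat_lin B"]
      by linarith+
    then have "\<bar>B$1$1\<bar> \<le> matrix_norm B" "\<bar>B$2$1\<bar> \<le> matrix_norm B" "\<bar>B$2$2\<bar> \<le> matrix_norm B" "\<bar>B$1$2\<bar> \<le> matrix_norm B"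
      unfolding eqs by (meson abs_Re_le_cmod abs_Im_le_cmod order_trans)+
    then show ?thesis using exhaust_2[of i] exhaust_2[of j] by auto
  qed
  have "norm B \<le> (\<Sum>i\<in>UNIV. norm (B $ i))"
    unfolding norm_vec_def by (rule L2_set_le_sum) simp
  also have "\<dots> \<le> (\<Sum>i\<in>UNIV. \<Sum>j\<in>UNIV. \<bar>B $ i $ j\<bar>)"
    by (intro sum_mono norm_le_l1_cart)
  also have "\<dots> \<le> (\<Sum>i\<in>(UNIV :: 2 set). \<Sum>j\<in>(UNIV :: 2 set). matrix_norm B)"
    by (intro sum_mono entry)
  finally show ?thesis by simp
qed

context finite_measure_on_borel
begin

lemma slow_growth_cong_AE:
  assumes "f \<in> automorphisms \<mu>" "f' \<in> automorphisms \<mu>" "AE x in \<mu>. f x = f' x"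
    and A: "A \<in> borel_measurable \<mu>" "A' \<in> borel_measurable \<mu>" "AE x in \<mu>. A x = A' x"
    and "slow_growth \<mu> k f A"
  shows "slow_growth \<mu> k f' A'"
proof -
  obtain n where n: "1 \<le> n" "measure \<mu> {x. real n / real (Suc k) \<le> log_growth f A n x} < 1 / real (Suc k)"
    using assms(7) unfolding slow_growth_def by blast
  have meas: "{x. real n / real (Suc k) \<le> log_growth f A n x} \<in> sets \<mu>"
    if "f \<in> automorphisms \<mu>" "A \<in> borel_measurable \<mu>" for f A
  proof -
    note [measurable] = automorphism_measurable[OF that(1)] that(2)
    have "{x \<in> space \<mu>. real n / real (Suc k) \<le> log_growth f A n x} \<in> sets \<mu>" by measurable
    then show ?thesis by simp
  qed
  have "measure \<mu> {x. real n / real (Suc k) \<le> log_growth f A n x} =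
      measure \<mu> {x. real n / real (Suc k) \<le> log_growth f' A' n x}"
  proof (rule measure_eq_AE)
    show "AE x in \<mu>. (x \<in> {x. real n / real (Suc k) \<le> log_growth f A n x}) =
        (x \<in> {x. real n / real (Suc k) \<le> log_growth f' A' n x})"
      using AE_cocycle_eq[OF assms(1,3,6)] by eventually_elim (simp add: log_growth_def)
  qed (use meas assms in auto)
  then show ?thesis using n unfolding slow_growth_def by auto
qed

text \<open>
  The pairs of classes whose representatives satisfy \<open>slow_growth\<close>; by \<open>slow_pairs_iff\<close> below the
  choice of representatives does not matter.
\<close>

definition slow_pairs :: "real \<Rightarrow> nat \<Rightarrow> (('a \<Rightarrow> 'a) set \<times> ('a \<Rightarrow> real^2^2) set) set" where
  "slow_pairs p k = {(F, \<alpha>) \<in> Aut \<mu> \<times> Lp_SL2 \<mu> p. slow_growth \<mu> k (rep F) (rep \<alpha>)}"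

lemma Aut_rep:
  assumes "F \<in> Aut \<mu>"
  shows "rep F \<in> F" "rep F \<in> automorphisms \<mu>" "\<And>f. f \<in> F \<Longrightarrow> f \<in> automorphisms \<mu>"
    "\<And>f g. f \<in> F \<Longrightarrow> g \<in> F \<Longrightarrow> AE x in \<mu>. f x = g x"
  using ae_class_rep[OF assms[unfolded Aut_def]] by auto

lemma Lp_rep:
  assumes "\<alpha> \<in> Lp_SL2 \<mu> p"
  shows "rep \<alpha> \<in> \<alpha>" "rep \<alpha> \<in> Lp_maps \<mu> p" "\<And>A. A \<in> \<alpha> \<Longrightarrow> A \<in> Lp_maps \<mu> p"
    "\<And>A B. A \<in> \<alpha> \<Longrightarrow> B \<in> \<alpha> \<Longrightarrow> AE x in \<mu>. A x = B x"
  using ae_class_rep[OF assms[unfolded Lp_SL2_def]] by auto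

lemma slow_pairs_iff:
  assumes "F \<in> Aut \<mu>" "\<alpha> \<in> Lp_SL2 \<mu> p" "f \<in> F" "A \<in> \<alpha>"
  shows "(F, \<alpha>) \<in> slow_pairs p k \<longleftrightarrow> slow_growth \<mu> k f A"
proof -
  note r = Aut_rep[OF assms(1)] Lp_rep[OF assms(2)]
  note m = Lp_maps_measurable[OF r(6)] Lp_maps_measurable[OF r(7)[OF assms(4)]]
  show ?thesis
    using slow_growth_cong_AE[OF r(2) r(3)[OF assms(3)] r(4)[OF r(1) assms(3)] m r(8)[OF r(5) assms(4)]]
      slow_growth_cong_AE[OF r(3)[OF assms(3)] r(2) r(4)[OF assms(3) r(1)] m(2,1) r(8)[OF assms(4) r(5)]]
    by (auto simp: slow_pairs_def assms)
qed

lemma eventually_weak_image: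
  assumes F0: "F0 \<in> Aut \<mu>" and K: "K \<in> sets \<mu>" and e: "0 < e"
  shows "\<forall>\<^sub>F F in nhdsin (weak_topology \<mu>) F0. F \<in> Aut \<mu> \<and>
    measure \<mu> (sym_diff (rep F ` K) (rep F0 ` K)) < e"
proof -
  note r0 = Aut_rep[OF F0]
  let ?U = "weak_nbhd \<mu> (rep F0) K e"
  have "openin (weak_topology \<mu>) ?U"
    unfolding weak_topology_def by (rule topology_generated_by_Basis) (use r0(2) K e in blast)
  moreover have "F0 \<in> ?U"
    using F0 r0(1) e by (auto simp: weak_nbhd_def intro!: bexI[of _ "rep F0"])
  moreover have "F \<in> Aut \<mu> \<and> measure \<mu> (sym_diff (rep F ` K) (rep F0 ` K)) < e" if F: "F \<in> ?U" for F
  proof -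
    obtain g where g: "g \<in> F" "measure \<mu> (sym_diff (g ` K) (rep F0 ` K)) < e" and FA: "F \<in> Aut \<mu>"
      using F unfolding weak_nbhd_def by blast
    note r = Aut_rep[OF FA]
    have "measure \<mu> (sym_diff (g ` K) (rep F0 ` K)) = measure \<mu> (sym_diff (rep F ` K) (rep F0 ` K))"
      using r r0 g K by (intro measure_sym_diff_ae) auto
    then show ?thesis using FA g by simp
  qed
  ultimately show ?thesis
    unfolding eventually_nhdsin by blast
qed

text \<open>
  The weak topology is defined by images; preimages under iterates depend continuously on the map too,
  since \<open>f -` K\<close> and \<open>f0 -` K\<close> differ by as much as \<open>f0 ` L\<close> and \<open>f ` L\<close>, where \<open>L = f0 -` K\<close>.
\<close>

lemma eventually_weak_vimage:
  assumes F0: "F0 \<in> Aut \<mu>" and K: "K \<in> sets \<mu>" and e: "0 < e"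
  shows "\<forall>\<^sub>F F in nhdsin (weak_topology \<mu>) F0. F \<in> Aut \<mu> \<and>
    measure \<mu> (sym_diff ((rep F ^^ j) -` K) ((rep F0 ^^ j) -` K)) < e"
  using K e
proof (induction j arbitrary: K e)
  case 0
  have "\<forall>\<^sub>F F in nhdsin (weak_topology \<mu>) F0. F \<in> Aut \<mu>"
    using eventually_weak_image[OF F0 0] by (rule eventually_mono) blast
  then show ?case by (rule eventually_mono) (use 0 in simp)
next
  case (Suc j)
  define L where "L = rep F0 -` K"
  note f0 = Aut_rep(2)[OF F0]
  have L: "L \<in> sets \<mu>" unfolding L_def by (rule automorphism_vimage_sets[OF f0 Suc.prems(1)])
  have e2: "0 < e / 2" using Suc.prems by simp
  from eventually_weak_image[OF F0 L e2] Suc.IH[OF L e2] show ?case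
  proof eventually_elim
    case (elim F)
    define f where "f = rep F"
    have f: "f \<in> automorphisms \<mu>" using Aut_rep(2)[of F] elim by (simp add: f_def)
    have fK: "f -` K \<in> sets \<mu>" by (rule automorphism_vimage_sets[OF f Suc.prems(1)])
    have fj: "f ^^ j \<in> automorphisms \<mu>" "rep F0 ^^ j \<in> automorphisms \<mu>" by (intro automorphism_funpow f f0)+
    have s: "sym_diff (f -` K) L \<in> sets \<mu>" using fK L by (intro sets.Un sets.Diff)
    have "f ` sym_diff (f -` K) L = sym_diff K (f ` L)"
      using automorphism_bij[OF f]
      by (simp add: image_Un image_set_diff bij_is_inj bij_is_surj surj_image_vimage_eq)
    moreover have "rep F0 ` L = K"
      using automorphism_bij[OF f0] by (simp add: L_def bij_is_surj surj_image_vimage_eq)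
    ultimately have "measure \<mu> (sym_diff (f -` K) L) = measure \<mu> (sym_diff (rep F0 ` L) (f ` L))"
      using automorphism_measure_image[OF f s] by simp
    also have "\<dots> < e / 2" using elim by (simp add: f_def Un_commute)
    finally have 1: "measure \<mu> (sym_diff (f -` K) L) < e / 2" .
    have eq: "(f ^^ Suc j) -` K = (f ^^ j) -` (f -` K)" "(rep F0 ^^ Suc j) -` K = (rep F0 ^^ j) -` L"
      by (auto simp: L_def)
    have "measure \<mu> (sym_diff ((f ^^ Suc j) -` K) ((rep F0 ^^ Suc j) -` K))
        \<le> measure \<mu> ((f ^^ j) -` sym_diff (f -` K) L \<union> sym_diff ((f ^^ j) -` L) ((rep F0 ^^ j) -` L))"
      unfolding eq using fj L s f Suc.prems(1)
      by (intro finite_measure_mono sets.Un sets.Diff automorphism_vimage_sets) auto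
    also have "\<dots> \<le> measure \<mu> ((f ^^ j) -` sym_diff (f -` K) L) + measure \<mu> (sym_diff ((f ^^ j) -` L) ((rep F0 ^^ j) -` L))"
      using fj L s f Suc.prems(1) by (intro measure_Un_le sets.Un sets.Diff automorphism_vimage_sets)
    also have "\<dots> < e / 2 + e / 2"
      using 1 elim automorphism_measure_vimage[OF fj(1) s] by (intro add_strict_mono) (auto simp: f_def)
    finally show ?case using elim by (simp add: f_def del: funpow.simps)
  qed
qed

lemma tends_in_measure_weak:
  fixes A :: "'a \<Rightarrow> real^2^2"
  assumes F0: "F0 \<in> Aut \<mu>" and A: "A \<in> borel_measurable \<mu>"
  shows "tends_in_measure (nhdsin (weak_topology \<mu>) F0) (\<lambda>F x. A ((rep F ^^ j) x)) (\<lambda>x. A ((rep F0 ^^ j) x))"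
  unfolding tends_in_measure_def
proof (intro conjI allI impI)
  have m: "(\<lambda>x. A ((f ^^ j) x)) \<in> borel_measurable \<mu>" if "f \<in> automorphisms \<mu>" for f
    using measurable_compose[OF automorphism_measurable[OF automorphism_funpow[OF that]] A] .
  show "(\<lambda>x. A ((rep F0 ^^ j) x)) \<in> borel_measurable \<mu>" by (rule m[OF Aut_rep(2)[OF F0]])
  have "\<forall>\<^sub>F F in nhdsin (weak_topology \<mu>) F0. F \<in> Aut \<mu>"
    using eventually_weak_image[OF F0 sets.empty_sets zero_less_one] by (rule eventually_mono) blast
  then show "\<forall>\<^sub>F F in nhdsin (weak_topology \<mu>) F0. (\<lambda>x. A ((rep F ^^ j) x)) \<in> borel_measurable \<mu>"
    by (rule eventually_mono) (rule m[OF Aut_rep(2)])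
  fix W :: "(real^2^2) set" and e :: real assume W: "open W" and e: "0 < e"
  have K: "A -` W \<in> sets \<mu>" using measurable_sets[OF A, of W] W by simp
  from eventually_weak_vimage[OF F0 K e, of j]
  show "\<forall>\<^sub>F F in nhdsin (weak_topology \<mu>) F0. measure \<mu> {x. A ((rep F0 ^^ j) x) \<in> W \<and> A ((rep F ^^ j) x) \<notin> W} < e"
  proof eventually_elim
    case (elim F)
    have "measure \<mu> {x. A ((rep F0 ^^ j) x) \<in> W \<and> A ((rep F ^^ j) x) \<notin> W}
        \<le> measure \<mu> (sym_diff ((rep F ^^ j) -` (A -` W)) ((rep F0 ^^ j) -` (A -` W)))"
    proof (rule finite_measure_mono)
      have "(rep F ^^ j) -` (A -` W) \<in> sets \<mu>" "(rep F0 ^^ j) -` (A -` W) \<in> sets \<mu>"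
        using elim F0 K by (simp_all add: automorphism_vimage_sets automorphism_funpow Aut_rep(2))
      then show "sym_diff ((rep F ^^ j) -` (A -` W)) ((rep F0 ^^ j) -` (A -` W)) \<in> sets \<mu>"
        by (intro sets.Un sets.Diff)
    qed auto
    then show ?case using elim by simp
  qed
qed

lemma eventually_Lp:
  assumes p: "1 \<le> p" and \<alpha>0: "\<alpha>0 \<in> Lp_SL2 \<mu> p" and d: "0 < d"
  shows "\<forall>\<^sub>F \<alpha> in nhdsin (Lp_topology \<mu> p) \<alpha>0. \<alpha> \<in> Lp_SL2 \<mu> p \<and> Lp_dist \<mu> p \<alpha>0 \<alpha> < d"
proof -
  interpret L: Metric_space "Lp_SL2 \<mu> p" "Lp_dist \<mu> p" by (rule Lp_Metric_space[OF p])
  have "openin (Lp_topology \<mu> p) (L.mball \<alpha>0 d)" unfolding Lp_topology_def by (rule L.openin_mball)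
  moreover have "\<alpha>0 \<in> L.mball \<alpha>0 d" using \<alpha>0 d by simp
  ultimately show ?thesis unfolding eventually_nhdsin by (metis L.in_mball)
qed

text \<open>
  By the Markov inequality, convergence in \<open>L\<^sup>p\<close> implies convergence in measure.
\<close>

lemma tends_in_measure_Lp:
  assumes p: "1 \<le> p" and \<alpha>0: "\<alpha>0 \<in> Lp_SL2 \<mu> p" and f: "f \<in> automorphisms \<mu>"
  shows "tends_in_measure (nhdsin (Lp_topology \<mu> p) \<alpha>0) (\<lambda>\<alpha> x. rep \<alpha> ((f ^^ j) x)) (\<lambda>x. rep \<alpha>0 ((f ^^ j) x))"
  unfolding tends_in_measure_def
proof (intro conjI allI impI)
  define A0 where "A0 = rep \<alpha>0"
  have [measurable]: "A0 \<in> borel_measurable \<mu>"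
    using Lp_maps_measurable[OF Lp_rep(2)[OF \<alpha>0]] by (simp add: A0_def)
  have m: "(\<lambda>x. rep \<alpha> ((f ^^ j) x)) \<in> borel_measurable \<mu>" if "\<alpha> \<in> Lp_SL2 \<mu> p" for \<alpha>
    using measurable_compose[OF automorphism_measurable[OF automorphism_funpow[OF f]]
        Lp_maps_measurable[OF Lp_rep(2)[OF that]]] .
  show "(\<lambda>x. rep \<alpha>0 ((f ^^ j) x)) \<in> borel_measurable \<mu>" by (rule m[OF \<alpha>0])
  have "\<forall>\<^sub>F \<alpha> in nhdsin (Lp_topology \<mu> p) \<alpha>0. \<alpha> \<in> Lp_SL2 \<mu> p"
    using eventually_Lp[OF p \<alpha>0 zero_less_one] by (rule eventually_mono) blast
  then show "\<forall>\<^sub>F \<alpha> in nhdsin (Lp_topology \<mu> p) \<alpha>0. (\<lambda>x. rep \<alpha> ((f ^^ j) x)) \<in> borel_measurable \<mu>"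
    by (rule eventually_mono) (rule m)
  fix W :: "(real^2^2) set" and e :: real assume W: "open W" and e: "0 < e"
  show "\<forall>\<^sub>F \<alpha> in nhdsin (Lp_topology \<mu> p) \<alpha>0.
      measure \<mu> {x. rep \<alpha>0 ((f ^^ j) x) \<in> W \<and> rep \<alpha> ((f ^^ j) x) \<notin> W} < e"
  proof (cases "W = UNIV")
    case True
    then show ?thesis using e by simp
  next
    case False
    define D where "D = (\<lambda>y. infdist y (- W))"
    have D: "D y = 0 \<longleftrightarrow> y \<notin> W" for y
      using in_closed_iff_infdist_zero[of "- W" y] W False by (auto simp: D_def)
    have [measurable]: "D \<in> borel_measurable borel"
      unfolding D_def by (intro borel_measurable_continuous_onI continuous_on_infdist continuous_on_id)
    have [measurable]: "W \<in> sets borel" using W by simp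
    define R where "R = (\<lambda>m. {x. A0 x \<in> W \<and> D (A0 x) < 1 / real (Suc m)})"
    have R: "R m \<in> sets \<mu>" for m
    proof -
      have "{x \<in> space \<mu>. A0 x \<in> W \<and> D (A0 x) < 1 / real (Suc m)} \<in> sets \<mu>" by measurable
      then show ?thesis by (simp add: R_def)
    qed
    have "decseq R"
      unfolding R_def by (intro decseq_SucI) (auto elim!: order.strict_trans2 simp: frac_le)
    then have "(\<lambda>m. measure \<mu> (R m)) \<longlonglongrightarrow> measure \<mu> (\<Inter>m. R m)"
      using R by (intro finite_Lim_measure_decseq) auto
    also have "(\<Inter>m. R m) = {}"
    proof (rule ccontr)
      assume "(\<Inter>m. R m) \<noteq> {}"
      then obtain x where x: "A0 x \<in> W" "\<And>m. D (A0 x) < 1 / real (Suc m)" by (auto simp: R_def)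
      have "0 < D (A0 x)" using x(1) D[of "A0 x"] infdist_nonneg[of "A0 x" "- W"] by (simp add: D_def less_le)
      then obtain m where "inverse (real (Suc m)) < D (A0 x)" using reals_Archimedean by blast
      then show False using x(2)[of m] by (simp add: inverse_eq_divide)
    qed
    finally have "\<forall>\<^sub>F m in sequentially. measure \<mu> (R m) < e / 2"
      using e by (intro order_tendstoD(2)) auto
    then obtain m where m: "measure \<mu> (R m) < e / 2" by (auto simp: eventually_sequentially)
    define c where "c = 1 / real (Suc m) / 4"
    have c: "0 < c" by (simp add: c_def)
    define d where "d = (e / 2 * c powr p) powr (1 / p)"
    have d: "0 < d" using e c by (simp add: d_def)
    from eventually_Lp[OF p \<alpha>0 d] show ?thesis
    proof eventually_elim
      case (elim \<alpha>)
      then have \<alpha>: "\<alpha> \<in> Lp_SL2 \<mu> p" by simp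
      define A where "A = rep \<alpha>"
      have [measurable]: "A \<in> borel_measurable \<mu>"
        using Lp_maps_measurable[OF Lp_rep(2)[OF \<alpha>]] by (simp add: A_def)
      define I where "I = (\<integral>x. matrix_norm (A0 x - A x) powr p \<partial>\<mu>)"
      have "I powr (1 / p) < d"
        using elim Lp_dist_eq[OF \<alpha>0 Lp_rep(1)[OF \<alpha>0] \<alpha> Lp_rep(1)[OF \<alpha>]] by (simp add: I_def A_def A0_def)
      then have I: "I < e / 2 * c powr p"
        unfolding d_def
      proof (rule contrapos_pp)
        assume "\<not> I < e / 2 * c powr p"
        then have "(e / 2 * c powr p) powr (1 / p) \<le> I powr (1 / p)"
          using p e by (intro powr_mono2) auto
        then show "\<not> I powr (1 / p) < (e / 2 * c powr p) powr (1 / p)" by simp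
      qed
      define S where "S = {x. c powr p \<le> matrix_norm (A0 x - A x) powr p}"
      have S: "S \<in> sets \<mu>" unfolding S_def by (rule Collect_in_sets) measurable
      have "measure \<mu> {x \<in> space \<mu>. c powr p \<le> matrix_norm (A0 x - A x) powr p} \<le> I / (c powr p)"
        unfolding I_def A0_def A_def using c
        by (intro integral_Markov_inequality_measure[where A = "{}"] integrable_Lp_diff[OF p] Lp_rep(2) \<alpha> \<alpha>0) auto
      then have "measure \<mu> S \<le> I / (c powr p)" by (simp add: S_def)
      also have "\<dots> < e / 2" using I c by (simp add: field_simps)
      finally have mS: "measure \<mu> S < e / 2" .
      define V where "V = {x. A0 x \<in> W \<and> A x \<notin> W}"
      have V: "V \<in> sets \<mu>" unfolding V_def by (rule loss_sets) (use W in auto)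
      have "V \<subseteq> R m \<union> S"
      proof
        fix x assume x: "x \<in> V"
        show "x \<in> R m \<union> S"
        proof (cases "D (A0 x) < 1 / real (Suc m)")
          case True
          then show ?thesis using x by (simp add: R_def V_def)
        next
          case False
          have "D (A0 x) \<le> dist (A0 x) (A x)"
            unfolding D_def using x by (intro infdist_le) (simp add: V_def)
          also have "\<dots> \<le> 4 * matrix_norm (A0 x - A x)" by (simp add: dist_norm norm_le_matrix_norm)
          finally have "1 / real (Suc m) \<le> 4 * matrix_norm (A0 x - A x)" using False by linarith
          then have "c \<le> matrix_norm (A0 x - A x)"
            using divide_right_mono[of "1 / real (Suc m)" "4 * matrix_norm (A0 x - A x)" 4] by (simp add: c_def)
          then show ?thesis using c p by (auto simp: S_def intro!: powr_mono2)
        qed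
      qed
      then have "measure \<mu> V \<le> measure \<mu> (R m \<union> S)" using R S by (intro finite_measure_mono) auto
      also have "\<dots> \<le> measure \<mu> (R m) + measure \<mu> S" using R S by (intro measure_Un_le)
      also have "\<dots> < e" using m mS by simp
      finally have "measure \<mu> V < e" .
      moreover have "{x. rep \<alpha>0 ((f ^^ j) x) \<in> W \<and> rep \<alpha> ((f ^^ j) x) \<notin> W} = (f ^^ j) -` V"
        by (auto simp: V_def A0_def A_def)
      ultimately show ?case
        using automorphism_measure_vimage[OF automorphism_funpow[OF f] V, of j] by simp
    qed
  qed
qed

text \<open>Slow growth is an open condition on each variable separately.\<close>

lemma openin_slow_pairs:
  assumes p: "1 \<le> p"
  shows "openin (separate_topology (weak_topology \<mu>) (Lp_topology \<mu> p)) (slow_pairs p k)"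
  unfolding openin_separate_topology separately_open_def topspace_weak_topology topspace_Lp_topology[OF p]
proof (intro conjI ballI)
  show "slow_pairs p k \<subseteq> Aut \<mu> \<times> Lp_SL2 \<mu> p" by (auto simp: slow_pairs_def)
  fix P assume "P \<in> slow_pairs p k"
  then obtain F1 \<alpha>1 where P: "P = (F1, \<alpha>1)" "F1 \<in> Aut \<mu>" "\<alpha>1 \<in> Lp_SL2 \<mu> p" by (auto simp: slow_pairs_def)
  have slow: "\<exists>n\<ge>1. measure \<mu> {x. real n / real (Suc k) \<le> log_growth (rep F) (rep \<alpha>) n x} < 1 / real (Suc k)"
    if "(F, \<alpha>) \<in> slow_pairs p k" for F \<alpha>
    using that by (simp add: slow_pairs_def slow_growth_def)
  have SL: "range (rep \<alpha>) \<subseteq> SL2" if "\<alpha> \<in> Lp_SL2 \<mu> p" for \<alpha>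
    by (rule Lp_maps_SL2[OF Lp_rep(2)[OF that]])
  have "openin (weak_topology \<mu>) {F \<in> Aut \<mu>. (F, \<alpha>1) \<in> slow_pairs p k}" (is "openin _ ?S")
  proof (subst openin_subopen, intro ballI)
    fix F0 assume "F0 \<in> ?S"
    then have F0: "F0 \<in> Aut \<mu>" "(F0, \<alpha>1) \<in> slow_pairs p k" by auto
    obtain n where n: "1 \<le> n" "measure \<mu> {x. real n / real (Suc k) \<le> log_growth (rep F0) (rep \<alpha>1) n x} < 1 / real (Suc k)"
      using slow[OF F0(2)] by blast
    have "\<forall>\<^sub>F F in nhdsin (weak_topology \<mu>) F0. slow_growth \<mu> k (rep F) (rep \<alpha>1)"
      by (rule slow_growth_eventually[OF tends_in_measure_cocycle _ _ n])
        (intro tends_in_measure_weak F0 Lp_maps_measurable[OF Lp_rep(2)[OF P(3)]] SL P always_eventually allI)+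
    then have "\<forall>\<^sub>F F in nhdsin (weak_topology \<mu>) F0. F \<in> ?S"
      using eventually_weak_image[OF F0(1) sets.empty_sets zero_less_one]
      by eventually_elim (simp add: slow_pairs_def P)
    then show "\<exists>T. openin (weak_topology \<mu>) T \<and> F0 \<in> T \<and> T \<subseteq> ?S"
      using F0(1) unfolding eventually_nhdsin topspace_weak_topology by blast
  qed
  moreover have "openin (Lp_topology \<mu> p) {\<alpha> \<in> Lp_SL2 \<mu> p. (F1, \<alpha>) \<in> slow_pairs p k}" (is "openin _ ?S")
  proof (subst openin_subopen, intro ballI)
    fix \<alpha>0 assume "\<alpha>0 \<in> ?S"
    then have \<alpha>0: "\<alpha>0 \<in> Lp_SL2 \<mu> p" "(F1, \<alpha>0) \<in> slow_pairs p k" by auto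
    obtain n where n: "1 \<le> n" "measure \<mu> {x. real n / real (Suc k) \<le> log_growth (rep F1) (rep \<alpha>0) n x} < 1 / real (Suc k)"
      using slow[OF \<alpha>0(2)] by blast
    have ev: "\<forall>\<^sub>F \<alpha> in nhdsin (Lp_topology \<mu> p) \<alpha>0. \<alpha> \<in> Lp_SL2 \<mu> p"
      using eventually_Lp[OF p \<alpha>0(1) zero_less_one] by (rule eventually_mono) blast
    have "\<forall>\<^sub>F \<alpha> in nhdsin (Lp_topology \<mu> p) \<alpha>0. range (rep \<alpha>) \<subseteq> SL2"
      using ev by (rule eventually_mono) (rule SL)
    then have "\<forall>\<^sub>F \<alpha> in nhdsin (Lp_topology \<mu> p) \<alpha>0. slow_growth \<mu> k (rep F1) (rep \<alpha>)"
      by (intro slow_growth_eventually[OF tends_in_measure_cocycle _ _ n]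
        tends_in_measure_Lp p \<alpha>0 Aut_rep(2)[OF P(2)] SL)
    then have "\<forall>\<^sub>F \<alpha> in nhdsin (Lp_topology \<mu> p) \<alpha>0. \<alpha> \<in> ?S"
      using ev by eventually_elim (simp add: slow_pairs_def P)
    then show "\<exists>T. openin (Lp_topology \<mu> p) T \<and> \<alpha>0 \<in> T \<and> T \<subseteq> ?S"
      using \<alpha>0(1) unfolding eventually_nhdsin topspace_Lp_topology[OF p] by blast
  qed
  ultimately show "case P of (x, y) \<Rightarrow>
      openin (weak_topology \<mu>) {x' \<in> Aut \<mu>. (x', y) \<in> slow_pairs p k} \<and>
      openin (Lp_topology \<mu> p) {y' \<in> Lp_SL2 \<mu> p. (x, y') \<in> slow_pairs p k}"
    by (simp add: P)
qed

end

section \<open>Marker sets and removal of periodic points\<close>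

lemma measurable_to_nat_Pair:
  fixes a :: "'x \<Rightarrow> 'y::countable" and b :: "'x \<Rightarrow> 'z::countable"
  assumes a: "a \<in> measurable M (count_space UNIV)" and b: "b \<in> measurable M (count_space UNIV)"
  shows "(\<lambda>x. to_nat (a x, b x)) \<in> measurable M (count_space UNIV)"
proof (rule measurable_compose_countable[where f = "\<lambda>y x. to_nat (a x, y)", OF _ b])
  show "(\<lambda>x. to_nat (a x, y)) \<in> measurable M (count_space UNIV)" for y
    by (rule measurable_compose[OF a]) simp
qed

context finite_measure_on_borel
begin

lemma measurable_periodic_points:
  assumes "f \<in> automorphisms \<mu>"
  shows "{x. (f ^^ j) x = x} \<in> sets \<mu>"
proof -
  have fb: "f ^^ j \<in> borel_measurable \<mu>"
    using automorphism_measurable[OF automorphism_funpow[OF assms]] measurable_cong_sets[OF refl sets_eq_borel] by blast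
  have i: "(\<lambda>x. x) \<in> borel_measurable \<mu>"
    using measurable_ident_sets[OF sets_eq_borel] by simp
  show ?thesis using measurable_equality_set[OF fb i] by simp
qed

text \<open>
  A set that returns to itself no earlier than after \<open>N\<close> steps and is met by every orbit in \<open>X\<close> within
  \<open>2 N\<close> steps. The sets \<open>C n\<close> of points of a basic open set that stay outside of it until time \<open>N\<close>
  cover \<open>X\<close>, and a marker set is collected from them greedily.
\<close>

lemma marker_set:
  assumes f: "f \<in> automorphisms \<mu>" and N: "1 \<le> N"
    and X: "X \<in> sets \<mu>" "\<And>x. x \<in> X \<Longrightarrow> f x \<in> X"
    and free: "\<And>x j. x \<in> X \<Longrightarrow> 0 < j \<Longrightarrow> j < N \<Longrightarrow> (f ^^ j) x \<noteq> x"
  obtains E where "E \<in> sets \<mu>" "E \<subseteq> X"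
    and "\<And>x j. x \<in> E \<Longrightarrow> 0 < j \<Longrightarrow> j < N \<Longrightarrow> (f ^^ j) x \<notin> E"
    and "\<And>x. x \<in> X \<Longrightarrow> \<exists>r. 1 \<le> r \<and> r < 2 * N \<and> (f ^^ r) x \<in> E"
proof -
  note fj = automorphism_funpow[OF f]
  obtain \<B> :: "'a set set" where \<B>: "countable \<B>" "topological_basis \<B>" using ex_countable_basis by blast
  have ne: "\<B> \<noteq> {}"
    using topological_basisE[OF \<B>(2) open_UNIV UNIV_I] by blast
  define B where "B = from_nat_into \<B>"
  have B: "B n \<in> sets \<mu>" for n
    using topological_basis_open[OF \<B>(2)] from_nat_into[OF ne, of n] by (simp add: B_def sets_eq_borel)
  define C where "C = (\<lambda>n. X \<inter> B n - (\<Union>j\<in>{0<..<N}. (f ^^ j) -` B n))"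
  have C: "C n \<in> sets \<mu>" for n
    unfolding C_def using X B automorphism_vimage_sets[OF fj B] by (intro sets.Diff sets.Int sets.finite_UN) auto
  have X_C: "\<exists>n. x \<in> C n" if x: "x \<in> X" for x
  proof -
    have "finite ((\<lambda>j. (f ^^ j) x) ` {0<..<N})" by simp
    then have o: "open (- ((\<lambda>j. (f ^^ j) x) ` {0<..<N}))" by (intro open_Compl finite_imp_closed)
    have m: "x \<in> - ((\<lambda>j. (f ^^ j) x) ` {0<..<N})"
    proof
      assume "x \<in> (\<lambda>j. (f ^^ j) x) ` {0<..<N}"
      then obtain j where j: "x = (f ^^ j) x" "0 < j" "j < N" by auto
      show False using free[OF x j(2,3)] j(1)[symmetric] by (rule notE)
    qed
    obtain b where b: "b \<in> \<B>" "x \<in> b" "b \<subseteq> - ((\<lambda>j. (f ^^ j) x) ` {0<..<N})"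
      by (rule topological_basisE[OF \<B>(2) o m])
    obtain n where n: "B n = b" using from_nat_into_surj[OF \<B>(1) b(1)] unfolding B_def by blast
    have "x \<in> C n" using b x unfolding C_def n by auto
    then show ?thesis by blast
  qed
  define E where "E = rec_nat {} (\<lambda>n E. E \<union> (C n - (\<Union>j<N. (f ^^ j) -` E) - (\<Union>j<N. (f ^^ j) ` E)))"
  have E0: "E 0 = {}" and ES: "E (Suc n) = E n \<union> (C n - (\<Union>j<N. (f ^^ j) -` E n) - (\<Union>j<N. (f ^^ j) ` E n))" for n
    by (simp_all add: E_def)
  have E: "E n \<in> sets \<mu>" for n
  proof (induction n)
    case (Suc n)
    then show ?case unfolding ES
      using C automorphism_vimage_sets[OF fj Suc] automorphism_image_sets[OF fj Suc]
      by (intro sets.Un sets.Diff sets.finite_UN) auto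
  qed (simp add: E0)
  have EX: "E n \<subseteq> X" for n by (induction n) (auto simp: E0 ES C_def)
  have mono: "E m \<subseteq> E n" if "m \<le> n" for m n
    by (rule lift_Suc_mono_le[OF _ that]) (simp add: ES)
  have sep: "(f ^^ j) x \<notin> E n" if "x \<in> E n" "0 < j" "j < N" for x j n
    using that
  proof (induction n)
    case (Suc n)
    define D where "D = C n - (\<Union>j<N. (f ^^ j) -` E n) - (\<Union>j<N. (f ^^ j) ` E n)"
    have ES': "E (Suc n) = E n \<union> D" unfolding ES D_def ..
    show ?case
    proof
      assume a: "(f ^^ j) x \<in> E (Suc n)"
      consider "x \<in> E n" "(f ^^ j) x \<in> E n" | "x \<in> E n" "(f ^^ j) x \<in> D"
        | "x \<in> D" "(f ^^ j) x \<in> E n" | "x \<in> D" "(f ^^ j) x \<in> D"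
        using a Suc.prems(1) unfolding ES' by blast
      then show False
      proof cases
        case 1
        then show ?thesis using Suc.IH[OF 1(1) Suc.prems(2,3)] by simp
      next
        case 2
        have "(f ^^ j) x \<in> (\<Union>j<N. (f ^^ j) ` E n)" using Suc.prems(3) 2(1) by auto
        then show ?thesis using 2(2) unfolding D_def by simp
      next
        case 3
        have "x \<in> (\<Union>j<N. (f ^^ j) -` E n)" using Suc.prems(3) 3(2) by auto
        then show ?thesis using 3(1) unfolding D_def by simp
      next
        case 4
        then have "(f ^^ j) x \<in> C n" "x \<in> C n" by (simp_all add: D_def)
        then show ?thesis using Suc.prems(2,3) unfolding C_def by simp
      qed
    qed
  qed (simp add: E0)
  show ?thesis
  proof (rule that)
    show "(\<Union>n. E n) \<in> sets \<mu>" using E by auto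
    show "(\<Union>n. E n) \<subseteq> X" using EX by blast
    show "(f ^^ j) x \<notin> (\<Union>n. E n)" if x: "x \<in> (\<Union>n. E n)" and j: "0 < j" "j < N" for x j
    proof
      assume "(f ^^ j) x \<in> (\<Union>n. E n)"
      then obtain a b where "x \<in> E a" "(f ^^ j) x \<in> E b" using x by blast
      then have "x \<in> E (max a b)" "(f ^^ j) x \<in> E (max a b)" using mono[of a "max a b"] mono[of b "max a b"] by auto
      then show False using sep j by blast
    qed
    show "\<exists>r. 1 \<le> r \<and> r < 2 * N \<and> (f ^^ r) x \<in> (\<Union>n. E n)" if x: "x \<in> X" for x
    proof -
      have inX: "(f ^^ i) x \<in> X" for i by (induction i) (use x X in auto)
      \<comment> \<open>Starting at time \<open>N\<close> leaves room for a visit up to \<open>N - 1\<close> steps before.\<close>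
      define z where "z = (f ^^ N) x"
      obtain n where n: "z \<in> C n" using X_C inX by (auto simp: z_def)
      consider "z \<in> E (Suc n)" | j where "j < N" "(f ^^ j) z \<in> E n" | j where "j < N" "z \<in> (f ^^ j) ` E n"
        using n unfolding ES by blast
      then show ?thesis
      proof cases
        case 1
        then show ?thesis using N by (intro exI[of _ N]) (auto simp: z_def)
      next
        case 2
        then show ?thesis using N by (intro exI[of _ "j + N"]) (auto simp: z_def funpow_add)
      next
        case 3
        then obtain w where w: "w \<in> E n" "z = (f ^^ j) w" by blast
        have "z = (f ^^ j) ((f ^^ (N - j)) x)"
          unfolding z_def using 3 by (simp flip: funpow_add o_apply[of "f ^^ j"])
        then have "(f ^^ (N - j)) x = w"
          using w automorphism_bij[OF fj, of j] by (metis bij_is_inj injD)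
        then show ?thesis using 3 w by (intro exI[of _ "N - j"]) auto
      qed
    qed
  qed
qed

text \<open>
  On the set \<open>P k\<close> of points of least period \<open>k\<close>, the map \<open>f\<close> has a fundamental domain \<open>D k\<close>. If \<open>T\<close> moves
  only points of the sets \<open>D k\<close>, and maps each \<open>D k\<close> to itself aperiodically, then the \<open>k\<close>-th iterate of
  \<open>f \<circ> T\<close> is \<open>T\<close> on \<open>D k\<close>, so \<open>f \<circ> T\<close> has almost no periodic points. The label \<open>l\<close> in the hypothesis lets \<open>T\<close>
  preserve finitely many prescribed sets and the period at the same time.
\<close>

lemma aperiodic_perturbation:
  fixes Ks :: "'a set list"
  assumes f: "f \<in> automorphisms \<mu>" and Ks: "set Ks \<subseteq> sets \<mu>"
    and ex: "\<And>D l. D \<in> sets \<mu> \<Longrightarrow> l \<in> measurable \<mu> (count_space UNIV) \<Longrightarrow>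
      \<exists>T\<in>automorphisms \<mu>. (\<forall>x. x \<notin> D \<longrightarrow> T x = x) \<and> (\<forall>x\<in>D. T x \<in> D) \<and>
        (\<forall>x. (l (T x) :: nat) = l x) \<and> (AE x in \<mu>. x \<in> D \<longrightarrow> (\<forall>m>0. (T ^^ m) x \<noteq> x))"
  shows "\<exists>T\<in>automorphisms \<mu>. (\<forall>K\<in>set Ks. T ` K = K) \<and> (AE x in \<mu>. \<forall>m>0. ((f \<circ> T) ^^ m) x \<noteq> x)"
proof -
  note fj = automorphism_funpow[OF f]
  define P where "P = (\<lambda>k. {x. (f ^^ k) x = x \<and> (\<forall>j\<in>{0<..<k}. (f ^^ j) x \<noteq> x)})"
  have P: "P k \<in> sets \<mu>" for k
  proof -
    have "{x. (f ^^ j) x = x} \<in> sets \<mu>" for j by (rule measurable_periodic_points[OF f])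
    then have "{x. (f ^^ k) x = x} - (\<Union>j\<in>{0<..<k}. {x. (f ^^ j) x = x}) \<in> sets \<mu>" for k
      by (intro sets.Diff sets.finite_UN) auto
    moreover have "P k = {x. (f ^^ k) x = x} - (\<Union>j\<in>{0<..<k}. {x. (f ^^ j) x = x})"
      by (auto simp: P_def)
    ultimately show ?thesis by simp
  qed
  have inj: "(f ^^ j) x = (f ^^ j) y \<longleftrightarrow> x = y" for j x y
    using automorphism_bij[OF fj, of j] by (metis bij_is_inj injD)
  have P_inv: "f x \<in> P k \<longleftrightarrow> x \<in> P k" for x k
  proof -
    have "(f ^^ j) (f x) = f x \<longleftrightarrow> (f ^^ j) x = x" for j
      using inj[of 1 "(f ^^ j) x" x] by (simp add: funpow_swap1)
    then show ?thesis by (simp add: P_def)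
  qed
  have P_inv': "(f ^^ i) x \<in> P k \<longleftrightarrow> x \<in> P k" for i x k
    by (induction i) (simp_all add: P_inv)
  have P_disj: "k = k'" if "x \<in> P k" "x \<in> P k'" "1 \<le> k" "1 \<le> k'" for x k k'
  proof (rule ccontr)
    assume "k \<noteq> k'"
    then consider "k < k'" | "k' < k" by linarith
    then show False using that by cases (auto simp: P_def)
  qed
  have "\<exists>E. E \<in> sets \<mu> \<and> E \<subseteq> P k \<and> (\<forall>x\<in>E. \<forall>j. 0 < j \<longrightarrow> j < k \<longrightarrow> (f ^^ j) x \<notin> E) \<and>
      (\<forall>x\<in>P k. \<exists>r. (f ^^ r) x \<in> E)" if k: "1 \<le> k" for k
  proof -
    have "(f ^^ j) x \<noteq> x" if "x \<in> P k" "0 < j" "j < k" for x j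
      using that by (simp add: P_def)
    then obtain E where "E \<in> sets \<mu>" "E \<subseteq> P k"
      "\<And>x j. x \<in> E \<Longrightarrow> 0 < j \<Longrightarrow> j < k \<Longrightarrow> (f ^^ j) x \<notin> E"
      "\<And>x. x \<in> P k \<Longrightarrow> \<exists>r. 1 \<le> r \<and> r < 2 * k \<and> (f ^^ r) x \<in> E"
      using marker_set[OF f k P, of k] P_inv by metis
    then show ?thesis by metis
  qed
  then obtain D where D: "\<And>k. 1 \<le> k \<Longrightarrow> D k \<in> sets \<mu>" "\<And>k. 1 \<le> k \<Longrightarrow> D k \<subseteq> P k"
    "\<And>k x j. 1 \<le> k \<Longrightarrow> x \<in> D k \<Longrightarrow> 0 < j \<Longrightarrow> j < k \<Longrightarrow> (f ^^ j) x \<notin> D k"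
    "\<And>k x. 1 \<le> k \<Longrightarrow> x \<in> P k \<Longrightarrow> \<exists>r. (f ^^ r) x \<in> D k"
    by metis
  define DD where "DD = (\<Union>k\<in>{1..}. D k)"
  have DD: "DD \<in> sets \<mu>" unfolding DD_def using D by (intro sets.countable_UN') auto
  have DD_P: "x \<in> DD \<longleftrightarrow> x \<in> D k" if "x \<in> P k" "1 \<le> k" for x k
  proof
    assume "x \<in> DD"
    then obtain k' where k': "1 \<le> k'" "x \<in> D k'" by (auto simp: DD_def)
    then have "x \<in> P k'" using D(2) by blast
    then have "k = k'" using P_disj that k' by blast
    then show "x \<in> D k" using k' by simp
  qed (use that in \<open>auto simp: DD_def\<close>)
  define l where "l = (\<lambda>x. to_nat (LEAST k. 1 \<le> k \<and> x \<in> P k, map (\<lambda>K. x \<in> K) Ks))"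
  have l: "l \<in> measurable \<mu> (count_space UNIV)"
  proof -
    have [measurable]: "Measurable.pred \<mu> (\<lambda>x. x \<in> P k)" for k
      using P by simp
    have "(\<lambda>x. LEAST k. 1 \<le> k \<and> x \<in> P k) \<in> measurable \<mu> (count_space UNIV)" by measurable
    moreover have "(\<lambda>x. map (\<lambda>K. x \<in> K) Ks) \<in> measurable \<mu> (count_space UNIV)"
      using Ks
    proof (induction Ks)
      case (Cons K Ks)
      have a: "(\<lambda>x. map (\<lambda>K. x \<in> K) Ks) \<in> measurable \<mu> (count_space UNIV)" "Measurable.pred \<mu> (\<lambda>x. x \<in> K)"
        using Cons by auto
      have "(\<lambda>x. (\<lambda>b bs. b # bs) (x \<in> K) (map (\<lambda>K. x \<in> K) Ks)) \<in> measurable \<mu> (count_space UNIV)"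
        by (rule measurable_compose_countable[OF _ a(1)]) (use a(2) in measurable)
      then show ?case by simp
    qed simp
    ultimately show ?thesis unfolding l_def
      by (rule measurable_to_nat_Pair)
  qed
  from ex[OF DD l] obtain T where T1: "T \<in> automorphisms \<mu>" and T2: "\<forall>x. x \<notin> DD \<longrightarrow> T x = x"
    and T3: "\<forall>x\<in>DD. T x \<in> DD" and T4: "\<forall>x. l (T x) = l x"
    and T5: "AE x in \<mu>. x \<in> DD \<longrightarrow> (\<forall>m>0. (T ^^ m) x \<noteq> x)"
    by (elim bexE conjE)
  note T = T1 T2[rule_format] T3[rule_format] T4[rule_format] T5
  have T_l: "(LEAST k. 1 \<le> k \<and> T x \<in> P k) = (LEAST k. 1 \<le> k \<and> x \<in> P k)"
      "map (\<lambda>K. T x \<in> K) Ks = map (\<lambda>K. x \<in> K) Ks" for x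
    using T(4)[of x] by (simp_all add: l_def)
  have T_K: "T x \<in> K \<longleftrightarrow> x \<in> K" if "K \<in> set Ks" for x K
    using T_l(2)[of x] that by (simp add: map_eq_conv)
  have least: "(LEAST k. 1 \<le> k \<and> x \<in> P k) = k" if "x \<in> P k" "1 \<le> k" for x k
    using that P_disj by (intro Least_equality) auto
  have T_D: "T x \<in> D k" if x: "x \<in> D k" and k: "1 \<le> k" for x k
  proof -
    have "x \<in> DD" using x k by (auto simp: DD_def)
    then obtain k' where k': "1 \<le> k'" "T x \<in> D k'" using T(3) by (auto simp: DD_def)
    have "T x \<in> P k'" "x \<in> P k" using D(2) k k' x by blast+
    then have "k' = k" using least[of "T x" k'] least[of x k] T_l(1)[of x] k k'(1) by simp
    then show ?thesis using k' by simp
  qed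
  define f' where "f' = f \<circ> T"
  have f': "f' \<in> automorphisms \<mu>" unfolding f'_def by (rule automorphism_comp[OF f T(1)])
  have stay: "(f' ^^ r) x = (f ^^ r) x" if "\<And>i. i < r \<Longrightarrow> (f ^^ i) x \<notin> DD" for r x
    using that by (induction r) (simp_all add: f'_def T(2))
  have ret1: "(f' ^^ k) x = T x" if x: "x \<in> D k" and k: "1 \<le> k" for x k
  proof -
    have TxP: "T x \<in> P k" using T_D[OF x k] D(2)[OF k] by blast
    have "(f' ^^ Suc i) x = (f ^^ Suc i) (T x)" if "Suc i \<le> k" for i
      using that
    proof (induction i)
      case (Suc i)
      have "(f ^^ Suc i) (T x) \<notin> D k" using D(3)[OF k T_D[OF x k], of "Suc i"] Suc.prems by simp
      then have "(f ^^ Suc i) (T x) \<notin> DD" using DD_P[OF P_inv'[THEN iffD2, OF TxP] k] by blast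
      then have "f' ((f ^^ Suc i) (T x)) = f ((f ^^ Suc i) (T x))" unfolding f'_def using T(2) by simp
      moreover have "(f' ^^ Suc (Suc i)) x = f' ((f' ^^ Suc i) x)" by simp
      ultimately show ?case using Suc by simp
    qed (simp add: f'_def)
    from this[of "k - 1"] have "(f' ^^ k) x = (f ^^ k) (T x)" using k by simp
    also have "\<dots> = T x" using TxP by (simp add: P_def)
    finally show ?thesis .
  qed
  have ret: "(f' ^^ (k * m)) x = (T ^^ m) x \<and> (T ^^ m) x \<in> D k" if x: "x \<in> D k" and k: "1 \<le> k" for x k m
  proof (induction m)
    case (Suc m)
    have "(f' ^^ (k * Suc m)) x = (f' ^^ k) ((f' ^^ (k * m)) x)" by (simp add: funpow_add)
    then show ?case using Suc ret1[OF _ k] T_D[OF _ k] by simp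
  qed (use x in simp)
  have "AE x in \<mu>. \<forall>r. (f' ^^ r) x \<in> DD \<longrightarrow> (\<forall>m>0. (T ^^ m) ((f' ^^ r) x) \<noteq> (f' ^^ r) x)"
    unfolding AE_all_countable using automorphism_AE[OF automorphism_funpow[OF f'] T(5)] by blast
  then have "AE x in \<mu>. \<forall>m>0. (f' ^^ m) x \<noteq> x"
  proof eventually_elim
    case (elim x)
    show ?case
    proof (intro allI impI notI)
      fix m :: nat assume m: "0 < m" "(f' ^^ m) x = x"
      show False
      proof (cases "\<exists>r. (f ^^ r) x \<in> DD")
        case False
        then have eq: "(f ^^ m) x = x" using stay[of m x] m by metis
        define k where "k = (LEAST k. 0 < k \<and> (f ^^ k) x = x)"
        have "0 < k \<and> (f ^^ k) x = x" unfolding k_def by (rule LeastI[of _ m]) (use m eq in simp)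
        moreover have "(f ^^ j) x \<noteq> x" if "j \<in> {0<..<k}" for j
          using not_less_Least[of j "\<lambda>k. 0 < k \<and> (f ^^ k) x = x"] that by (auto simp: k_def)
        ultimately have k: "1 \<le> k" "x \<in> P k" by (auto simp: P_def)
        then obtain r where "(f ^^ r) x \<in> D k" using D(4) by blast
        then show False using False k by (auto simp: DD_def)
      next
        case True
        define r where "r = (LEAST r. (f ^^ r) x \<in> DD)"
        have "(f ^^ r) x \<in> DD" unfolding r_def using True by (rule LeastI_ex)
        moreover have "(f' ^^ r) x = (f ^^ r) x"
          by (rule stay) (use not_less_Least in \<open>auto simp: r_def\<close>)
        ultimately have y: "(f' ^^ r) x \<in> DD" by simp
        define y where "y = (f' ^^ r) x"
        obtain k where k: "1 \<le> k" "y \<in> D k" using y by (auto simp: DD_def y_def)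
        have "(f' ^^ m) y = y"
          unfolding y_def using m(2) by (simp flip: funpow_add o_apply[of "f' ^^ _"] add: add.commute[of m r])
            (simp add: funpow_add)
        then have "((f' ^^ m) ^^ k) y = y" by (induction k) simp_all
        then have "(T ^^ m) y = y" using ret[OF k(2,1), of m] by (simp add: funpow_mult mult.commute)
        then show False using elim y m(1) by (auto simp: y_def)
      qed
    qed
  qed
  moreover have "T ` K = K" if "K \<in> set Ks" for K
  proof
    show "T ` K \<subseteq> K" using T_K[OF that] by blast
    show "K \<subseteq> T ` K"
    proof
      fix y assume "y \<in> K"
      obtain x where "y = T x" using automorphism_bij[OF T(1)] by (metis bij_pointE)
      then show "y \<in> T ` K" using T_K[OF that] \<open>y \<in> K\<close> by blast
    qed
  qed
  ultimately show ?thesis using T(1) by (auto simp: f'_def)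
qed

end

section \<open>Aperiodic automorphisms supported on a Borel set\<close>

text \<open>
  The real number with ternary digits \<open>b 0 . b 1 b 2 \<dots>\<close>, all of them 0 or 1; such a number determines
  its digits.
\<close>

definition ternary :: "(nat \<Rightarrow> bool) \<Rightarrow> real" where
  "ternary b = (\<Sum>k. of_bool (b k) * (1 / 3) ^ k)"

text \<open>
  The remainder of \<open>t\<close> after removal of its first \<open>k\<close> digits, scaled so that the next digit is 1 iff the
  remainder is at least 1. Meaningful for values \<open>t\<close> of \<open>ternary\<close>.
\<close>

primrec ternary_rest :: "nat \<Rightarrow> real \<Rightarrow> real" where
  "ternary_rest 0 t = t"
| "ternary_rest (Suc k) t = 3 * (ternary_rest k t - of_bool (1 \<le> ternary_rest k t))"

lemma ternary_summable: "summable (\<lambda>k. of_bool (b k) * (1 / 3 :: real) ^ k)"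
  by (rule summable_comparison_test'[of "\<lambda>k. (1 / 3 :: real) ^ k" 0])
    (auto intro: summable_geometric)

lemma ternary_bounds: "0 \<le> ternary b" "ternary b \<le> 3 / 2"
proof -
  show "0 \<le> ternary b"
    unfolding ternary_def by (intro suminf_nonneg ternary_summable) simp
  have "ternary b \<le> (\<Sum>k. (1 / 3 :: real) ^ k)"
    unfolding ternary_def by (intro suminf_le ternary_summable summable_geometric) auto
  also have "\<dots> = 3 / 2" by (subst suminf_geometric) auto
  finally show "ternary b \<le> 3 / 2" .
qed

lemma ternary_split: "ternary b = of_bool (b 0) + ternary (\<lambda>k. b (Suc k)) / 3"
proof -
  have "ternary b = (\<Sum>k. of_bool (b (Suc k)) * (1 / 3 :: real) ^ Suc k) + of_bool (b 0)"
    unfolding ternary_def using suminf_split_head[OF ternary_summable, of b] by simp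
  also have "(\<Sum>k. of_bool (b (Suc k)) * (1 / 3 :: real) ^ Suc k) = (\<Sum>k. of_bool (b (Suc k)) * (1 / 3 :: real) ^ k / 3)"
    by simp
  also have "\<dots> = ternary (\<lambda>k. b (Suc k)) / 3"
    unfolding ternary_def by (rule suminf_divide) (rule ternary_summable)
  finally show ?thesis by simp
qed

lemma ternary_ge_1_iff: "1 \<le> ternary b \<longleftrightarrow> b 0"
  using ternary_split[of b] ternary_bounds[of "\<lambda>k. b (Suc k)"] by (cases "b 0") auto

lemma ternary_rest_ternary: "ternary_rest k (ternary b) = ternary (\<lambda>j. b (j + k))"
proof (induction k)
  case (Suc k)
  have "ternary (\<lambda>j. b (j + k)) - of_bool (b k) = ternary (\<lambda>j. b (j + Suc k)) / 3"
    using ternary_split[of "\<lambda>j. b (j + k)"] by simp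
  then show ?case using Suc ternary_ge_1_iff[of "\<lambda>j. b (j + k)"] by simp
qed simp

lemma ternary_digit: "1 \<le> ternary_rest k (ternary b) \<longleftrightarrow> b k"
  by (simp add: ternary_rest_ternary ternary_ge_1_iff)

lemma ternary_rest_measurable [measurable]: "ternary_rest k \<in> borel_measurable borel"
proof (induction k)
  case 0
  have "ternary_rest 0 = (\<lambda>t. t)" by (rule ext) simp
  then show ?case by simp
next
  case (Suc k)
  note [measurable] = Suc
  have "ternary_rest (Suc k) = (\<lambda>t. 3 * (ternary_rest k t - (if 1 \<le> ternary_rest k t then 1 else 0)))"
    by (rule ext) simp
  moreover have "(\<lambda>t. 3 * (ternary_rest k t - (if 1 \<le> ternary_rest k t then 1 else 0))) \<in> borel_measurable borel"
    by measurable
  ultimately show ?case by simp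
qed

lemma SUP_rat_below: "(SUP q::rat. if of_rat q \<le> y then ereal (of_rat q) else - \<infinity>) = ereal y"
proof (rule SUP_eqI)
  show "(if real_of_rat q \<le> y then ereal (of_rat q) else - \<infinity>) \<le> ereal y" for q by simp
  fix z assume z: "\<And>q. q \<in> UNIV \<Longrightarrow> (if real_of_rat q \<le> y then ereal (of_rat q) else - \<infinity>) \<le> z"
  show "ereal y \<le> z"
  proof (rule ccontr)
    assume "\<not> ereal y \<le> z"
    then have "z < ereal y" by simp
    then obtain w where w: "z < ereal w" "w < y"
      by (metis ereal_dense2 less_ereal.simps(1) )
    obtain q :: rat where q: "w < of_rat q" "of_rat q < y" using of_rat_dense[OF w(2)] by blast
    have "ereal (of_rat q) \<le> z" using z[of q] q by simp
    then show False using q w by (meson ereal_less_eq(3) less_imp_le not_le order_trans)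
  qed
qed

text \<open>
  A point of \<open>real^'n\<close> is coded by one real number, whose ternary digits record all comparisons of
  its coordinates with rational numbers. A Borel left inverse is constructed along with the code, so
  that no theorem on images of Borel sets is needed.
\<close>

lemma borel_injection_into_real:
  obtains h :: "real^'n::finite \<Rightarrow> real" and g :: "real \<Rightarrow> real^'n"
  where "h \<in> borel_measurable borel" "g \<in> borel_measurable borel" "\<And>x. g (h x) = x"
proof -
  define e where "e = (from_nat :: nat \<Rightarrow> 'n \<times> rat)"
  define c where "c = (\<lambda>x k. of_rat (snd (e k)) \<le> (x :: real^'n) $ fst (e k))"
  define h where "h = (\<lambda>x. ternary (c x))"
  define g where "g = (\<lambda>t. (\<chi> i. real_of_ereal (SUP q. if 1 \<le> ternary_rest (to_nat (i, q)) t then ereal (of_rat q) else - \<infinity>)) :: real^'n)"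
  have hm: "h \<in> borel_measurable borel"
    unfolding h_def ternary_def
  proof (rule borel_measurable_suminf)
    fix k
    have "(\<lambda>x. if of_rat (snd (e k)) \<le> (x :: real^'n) $ fst (e k) then 1 else 0 :: real) \<in> borel_measurable borel"
      by measurable
    then show "(\<lambda>x. of_bool (c x k) * (1 / 3 :: real) ^ k) \<in> borel_measurable borel"
      unfolding c_def of_bool_def by measurable
  qed
  have gm: "g \<in> borel_measurable borel"
    unfolding borel_measurable_euclidean_space[of g]
  proof
    fix b :: "real^'n" assume "b \<in> Basis"
    then obtain i where b: "b = axis i 1" by (auto simp: Basis_vec_def)
    have "(\<lambda>t. if 1 \<le> ternary_rest (to_nat (i, q)) t then ereal (of_rat q) else - \<infinity>) \<in> borel_measurable borel" for q
      by measurable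
    then have "(\<lambda>t. real_of_ereal (SUP q. if 1 \<le> ternary_rest (to_nat (i, q)) t then ereal (of_rat q) else - \<infinity>)) \<in> borel_measurable borel"
      by (intro borel_measurable_real_of_ereal borel_measurable_SUP) auto
    then show "(\<lambda>t. g t \<bullet> b) \<in> borel_measurable borel"
      by (simp add: g_def b inner_axis)
  qed
  have "g (h x) = x" for x
  proof -
    have "1 \<le> ternary_rest (to_nat (i, q)) (h x) \<longleftrightarrow> of_rat q \<le> x $ i" for i q
      by (simp add: h_def ternary_digit c_def e_def)
    then have "(SUP q. if 1 \<le> ternary_rest (to_nat (i, q)) (h x) then ereal (of_rat q) else - \<infinity>) = ereal (x $ i)" for i
      by (simp only: SUP_rat_below)
    then show ?thesis by (simp only: g_def vec_eq_iff vec_lambda_beta real_of_ereal.simps) simp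
  qed
  with hm gm show ?thesis by (rule that)
qed

lemma frac_add_frac: "frac (frac a + b) = frac (a + b :: real)"
  unfolding frac_def by (simp add: floor_add_int[symmetric] algebra_simps)

text \<open>
  Rotations of the circle \<open>[0, 1)\<close> preserve Lebesgue measure.
\<close>

lemma rotation_preserves_lborel:
  fixes t :: real
  assumes G: "G \<in> sets borel" "G \<subseteq> {0..<1}"
  shows "emeasure lborel {s \<in> {0..<1}. frac (s + t) \<in> G} = emeasure lborel G"
proof -
  define r where "r = frac t"
  have r: "0 \<le> r" "r < 1" by (simp_all add: r_def frac_lt_1)
  have shift: "emeasure lborel {s. s + c \<in> B} = emeasure lborel B" if "B \<in> sets borel" for c :: real and B
  proof -
    have "emeasure (distr lborel borel ((+) c)) B = emeasure lborel ((+) c -` B \<inter> space lborel)"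
      using that by (intro emeasure_distr) auto
    then show ?thesis by (simp add: lborel_distr_plus vimage_def add.commute)
  qed
  define G1 G2 where "G1 = G \<inter> {r..<1}" and "G2 = G \<inter> {0..<r}"
  have G12: "G1 \<in> sets borel" "G2 \<in> sets borel" using G by (auto simp: G1_def G2_def)
  have frac: "frac (s + t) = (if s + r < 1 then s + r else s + r - 1)" if "s \<in> {0..<1}" for s
  proof -
    have "frac (s + t) = frac (s + r)" using frac_add_frac[of t s] by (simp add: r_def add.commute)
    also have "\<dots> = (if s + r < 1 then s + r else s + r - 1)"
    proof (cases "s + r < 1")
      case True
      then show ?thesis using that r by (simp add: frac_eq)
    next
      case False
      then have "\<lfloor>s + r\<rfloor> = 1" using that r by (intro floor_unique) auto
      then show ?thesis using False by (simp add: frac_def)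
    qed
    finally show ?thesis .
  qed
  have "{s \<in> {0..<1}. frac (s + t) \<in> G} = {s. s + r \<in> G1} \<union> {s. s + (r - 1) \<in> G2}" (is "?L = ?R")
  proof (intro set_eqI iffI)
    fix s assume "s \<in> ?L"
    then show "s \<in> ?R" using frac[of s] r by (auto simp: G1_def G2_def algebra_simps split: if_splits)
  next
    fix s assume "s \<in> ?R"
    then consider "s + r \<in> G1" | "s + (r - 1) \<in> G2" by blast
    then show "s \<in> ?L"
    proof cases
      case 1
      then show ?thesis using frac[of s] r by (auto simp: G1_def)
    next
      case 2
      then have s: "s \<in> {0..<1}" "\<not> s + r < 1" using r by (auto simp: G2_def)
      then have "frac (s + t) = s + (r - 1)" using frac[of s] by simp
      then show ?thesis using 2 s(1) by (simp add: G2_def)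
    qed
  qed
  also have "emeasure lborel \<dots> = emeasure lborel {s. s + r \<in> G1} + emeasure lborel {s. s + (r - 1) \<in> G2}"
  proof (rule plus_emeasure[symmetric])
    have [measurable]: "G1 \<in> sets borel" "G2 \<in> sets borel" using G12 by auto
    have "{s \<in> space lborel. s + r \<in> G1} \<in> sets lborel" "{s \<in> space lborel. s + (r - 1) \<in> G2} \<in> sets lborel" by measurable
    then show "{s. s + r \<in> G1} \<in> sets lborel" "{s. s + (r - 1) \<in> G2} \<in> sets lborel" by simp_all
    show "{s. s + r \<in> G1} \<inter> {s. s + (r - 1) \<in> G2} = {}" by (auto simp: G1_def G2_def)
  qed
  also have "\<dots> = emeasure lborel G1 + emeasure lborel G2" using G12 by (simp add: shift)
  also have "\<dots> = emeasure lborel (G1 \<union> G2)"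
    using G12 by (intro plus_emeasure) (auto simp: G1_def G2_def)
  also have "G1 \<union> G2 = G" using G(2) by (auto simp: G1_def G2_def)
  finally show ?thesis .
qed

lemma ex_irrational: "\<exists>a::real. a \<notin> \<rat>"
proof (rule ccontr)
  assume "\<nexists>a::real. a \<notin> \<rat>"
  then have "(UNIV :: real set) = \<rat>" by auto
  then show False using countable_rat uncountable_UNIV_real by metis
qed

context finite_measure_on_borel
begin

text \<open>
  An irrational rotation transported to \<open>Q\<close>. Let \<open>C\<close> be the distribution function of the code \<open>h\<close> under
  the normalised measure on \<open>Q\<close>; it is continuous since there are no atoms. Then \<open>K = C \<circ> h\<close> and
  \<open>J = g \<circ> I\<close>, with \<open>I\<close> the quantile function, are inverse to each other up to null sets and carry the
  measure on \<open>Q\<close> to Lebesgue measure on \<open>[0, 1)\<close>. Outside a rotation invariant null set \<open>N\<close> they are exact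
  inverses, so \<open>J \<circ> rotation \<circ> K\<close>, extended by the identity, is a bijection of the whole space.
\<close>

lemma aperiodic_on_coded_set:
  fixes h :: "'a \<Rightarrow> real" and g :: "real \<Rightarrow> 'a"
  assumes Q: "Q \<in> sets \<mu>" and h: "h \<in> borel_measurable \<mu>" and g: "g \<in> measurable borel \<mu>"
    and gh: "\<And>x. x \<in> Q \<Longrightarrow> g (h x) = x" and atomless: "\<And>x. measure \<mu> {x} = 0"
  shows "\<exists>T\<in>automorphisms \<mu>. (\<forall>x. x \<notin> Q \<longrightarrow> T x = x) \<and> (\<forall>x\<in>Q. T x \<in> Q) \<and>
    (AE x in \<mu>. x \<in> Q \<longrightarrow> (\<forall>m>0. (T ^^ m) x \<noteq> x))"
proof (cases "measure \<mu> Q = 0")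
  case True
  then have "Q \<in> null_sets \<mu>" using Q by (simp add: null_sets_def emeasure_eq_measure)
  then have "AE x in \<mu>. x \<notin> Q" by (rule AE_not_in)
  then have "AE x in \<mu>. x \<in> Q \<longrightarrow> (\<forall>m>0. (id ^^ m) x \<noteq> x)" by eventually_elim simp
  then show ?thesis using automorphism_id by (intro bexI[of _ id]) auto
next
  case False
  note [measurable] = Q h g
  define m where "m = measure \<mu> Q"
  have m: "0 < m" using False by (simp add: m_def less_le)
  have mQ: "emeasure \<mu> Q = ennreal m" by (simp add: m_def emeasure_eq_measure)
  define PQ where "PQ = uniform_measure \<mu> Q"
  have PQ: "prob_space PQ" unfolding PQ_def by (rule prob_space_uniform_measure) (use m in \<open>auto simp: mQ\<close>)
  have [measurable_cong]: "sets PQ = sets \<mu>" by (simp add: PQ_def)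
  define \<kappa> where "\<kappa> = distr PQ borel h"
  have hPQ: "h \<in> borel_measurable PQ" by measurable
  have rd: "real_distribution \<kappa>"
    unfolding \<kappa>_def by (rule prob_space.real_distribution_distr[OF PQ hPQ])
  interpret \<kappa>: cdf_distribution \<kappa> by (simp add: cdf_distribution_def rd)
  have h_vimage: "h -` B \<in> sets \<mu>" if "B \<in> sets borel" for B
    using measurable_sets[OF h that] by simp
  have g_vimage: "g -` B \<in> sets borel" if "B \<in> sets \<mu>" for B
    using measurable_sets[OF g that] by simp
  have em\<kappa>: "emeasure \<kappa> B = ennreal (measure \<mu> (Q \<inter> h -` B) / m)" if B: "B \<in> sets borel" for B
  proof -
    have "emeasure \<kappa> B = emeasure PQ (h -` B \<inter> space PQ)"
      unfolding \<kappa>_def by (rule emeasure_distr[OF hPQ B])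
    also have "\<dots> = emeasure \<mu> (Q \<inter> h -` B) / emeasure \<mu> Q"
      unfolding PQ_def using h_vimage[OF B] Q by simp
    also have "\<dots> = ennreal (measure \<mu> (Q \<inter> h -` B) / m)"
      unfolding mQ using m by (simp add: emeasure_eq_measure divide_ennreal)
    finally show ?thesis .
  qed
  define I where "I = (\<lambda>s. if s \<in> {0<..<1} then \<kappa>.I s else 0)"
  have [measurable]: "I \<in> borel_measurable borel"
    unfolding I_def using \<kappa>.measurable_CI
    by (subst (asm) measurable_restrict_space_iff[of _ _ 0]) auto
  have law: "measure lborel {s \<in> {0<..<1}. I s \<in> B} = measure \<mu> (Q \<inter> h -` B) / m" if B: "B \<in> sets borel" for B
  proof -
    have "emeasure \<kappa> B = emeasure (distr (restrict_space lborel {0<..<1}) borel \<kappa>.I) B"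
      by (simp only: \<kappa>.distr_I_eq_M)
    also have "\<dots> = emeasure (restrict_space lborel {0<..<1}) (\<kappa>.I -` B \<inter> space (restrict_space lborel {0<..<1}))"
      using \<kappa>.measurable_CI B by (intro emeasure_distr) (auto simp: measurable_restrict_space_iff)
    also have "\<kappa>.I -` B \<inter> space (restrict_space lborel {0<..<1}) = {s \<in> {0<..<1}. I s \<in> B}"
      by (auto simp: I_def space_restrict_space)
    also have "emeasure (restrict_space lborel {0<..<1}) \<dots> = emeasure lborel {s \<in> {0<..<1}. I s \<in> B}"
      by (intro emeasure_restrict_space) auto
    finally have "emeasure lborel {s \<in> {0<..<1}. I s \<in> B} = ennreal (measure \<mu> (Q \<inter> h -` B) / m)"
      using em\<kappa>[OF B] by simp
    then show ?thesis using m by (simp add: measure_def)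
  qed
  define C where "C = cdf \<kappa>"
  have [measurable]: "C \<in> borel_measurable borel" unfolding C_def by (rule \<kappa>.measurable_C)
  have C_cont: "isCont C t" for t
  proof -
    have "measure \<mu> (Q \<inter> h -` {t}) \<le> measure \<mu> {g t}"
      using gh by (intro finite_measure_mono) (auto simp: sets_eq_borel)
    then have "measure \<mu> (Q \<inter> h -` {t}) = 0" using atomless by (simp add: antisym)
    then have "measure \<kappa> {t} = 0" using em\<kappa>[of "{t}"] by (simp add: measure_def)
    then show ?thesis unfolding C_def by (simp add: \<kappa>.isCont_cdf)
  qed
  have C_I: "C (I s) = s" if s: "s \<in> {0<..<1}" for s
  proof (rule antisym)
    have inv: "s \<le> C x \<longleftrightarrow> I s \<le> x" for x
      using \<kappa>.pseudoinverse[of s x] s by (simp add: C_def I_def)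
    show "s \<le> C (I s)" using inv by simp
    have "(C \<longlongrightarrow> C (I s)) (at_left (I s))"
      using C_cont[of "I s"] by (simp add: isCont_def filterlim_at_split)
    moreover have "\<forall>\<^sub>F x in at_left (I s). C x \<le> s"
      unfolding eventually_at_filter
      by (intro always_eventually allI impI) (use inv in \<open>auto simp: not_le less_imp_le dest: leI\<close>, meson inv leD less_imp_le linear)
    ultimately show "C (I s) \<le> s"
      by (rule tendsto_upperbound) simp
  qed
  define K where "K = (\<lambda>x. C (h x))"
  define J where "J = (\<lambda>s. g (I s))"
  have [measurable]: "K \<in> borel_measurable \<mu>" "J \<in> measurable borel \<mu>"
    unfolding K_def J_def by measurable

  \<comment> \<open>The null set on which \<open>J\<close> fails to be a section of \<open>K\<close> with values in \<open>Q\<close>.\<close>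
  define N0 where "N0 = {s \<in> {0..<1}. \<not> (s \<noteq> 0 \<and> h (J s) = I s \<and> J s \<in> Q)}"
  have hJ [measurable]: "(\<lambda>s. h (J s)) \<in> borel_measurable borel" by measurable
  have N0_sets: "N0 \<in> sets borel"
  proof -
    have "{s \<in> space borel. s \<in> {0..<1} \<and> \<not> (s \<noteq> 0 \<and> h (J s) = I s \<and> J s \<in> Q)} \<in> sets borel" by measurable
    then show ?thesis by (simp add: N0_def)
  qed
  have N0: "emeasure lborel N0 = 0"
  proof -
    have hg [measurable]: "(\<lambda>t. h (g t)) \<in> borel_measurable borel" by measurable
    have B: "{t. \<not> (h (g t) = t \<and> g t \<in> Q)} \<in> sets borel" (is "?B \<in> _")
    proof -
      have "{t \<in> space borel. \<not> (h (g t) = t \<and> g t \<in> Q)} \<in> sets borel" by measurable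
      then show ?thesis by simp
    qed
    have "Q \<inter> h -` ?B = {}" using gh by auto
    then have 0: "measure lborel {s \<in> {0<..<1}. I s \<in> ?B} = 0" using law[OF B] by simp
    have IB: "{s \<in> {0<..<1}. I s \<in> ?B} \<in> sets borel"
    proof -
      note [measurable] = B
      have "{s \<in> space borel. s \<in> {0<..<1} \<and> I s \<in> ?B} \<in> sets borel" by measurable
      then show ?thesis by simp
    qed
    have "emeasure lborel {s \<in> {0<..<1}. I s \<in> ?B} \<le> emeasure lborel {0<..<1::real}"
      using IB by (intro emeasure_mono) auto
    then have "emeasure lborel {s \<in> {0<..<1}. I s \<in> ?B} \<noteq> \<infinity>" by (auto simp: top_unique)
    then have "emeasure lborel {s \<in> {0<..<1}. I s \<in> ?B} = 0" using 0 by (simp add: emeasure_eq_ennreal_measure)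
    then have "{s \<in> {0<..<1}. I s \<in> ?B} \<in> null_sets lborel" using IB by (simp add: null_sets_def)
    moreover have "{0 :: real} \<in> null_sets lborel" by (rule null_setsI) simp_all
    ultimately have "{s \<in> {0<..<1}. I s \<in> ?B} \<union> {0} \<in> null_sets lborel" by (rule null_sets.Un)
    moreover have "N0 \<subseteq> {s \<in> {0<..<1}. I s \<in> ?B} \<union> {0}" by (auto simp: N0_def J_def)
    ultimately have "N0 \<in> null_sets lborel" using N0_sets null_sets_subset[of _ lborel N0] by auto
    then show ?thesis by (simp add: null_sets_def)
  qed
  obtain a :: real where a: "a \<notin> \<rat>" using ex_irrational by blast
  define N where "N = (\<Union>i::int. {s \<in> {0..<1}. frac (s + of_int i * a) \<in> N0})"
  have N_sets: "{s \<in> {0..<1}. frac (s + c) \<in> B} \<in> sets borel" if "B \<in> sets borel" for c and B :: "real set"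
  proof -
    note [measurable] = that
    have "{s \<in> space borel. s \<in> {0..<1} \<and> frac (s + c) \<in> B} \<in> sets borel" unfolding frac_def by measurable
    then show ?thesis by simp
  qed
  have N: "N \<in> null_sets lborel"
    unfolding N_def
  proof (rule null_sets_UN)
    fix i :: int
    have "emeasure lborel {s \<in> {0..<1}. frac (s + of_int i * a) \<in> N0} = emeasure lborel N0"
      by (rule rotation_preserves_lborel[OF N0_sets]) (auto simp: N0_def)
    then show "{s \<in> {0..<1}. frac (s + of_int i * a) \<in> N0} \<in> null_sets lborel"
      using N0 N_sets[OF N0_sets] by (simp add: null_sets_def)
  qed
  then have [measurable]: "N \<in> sets borel" by (auto simp: null_sets_def)
  have N_rot: "frac (s + of_int j * a) \<in> N \<longleftrightarrow> s \<in> N" if s: "s \<in> {0..<1}" for s j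
  proof -
    have "frac (frac (s + of_int j * a) + of_int i * a) = frac (s + of_int (j + i) * a)" for i
      unfolding frac_add_frac by (simp add: algebra_simps)
    then have "frac (s + of_int j * a) \<in> N \<longleftrightarrow> (\<exists>i. frac (s + of_int (j + i) * a) \<in> N0)"
      by (simp add: N_def frac_lt_1)
    also have "\<dots> \<longleftrightarrow> (\<exists>i. frac (s + of_int i * a) \<in> N0)"
      by (metis add_diff_cancel_left' add_diff_eq)
    also have "\<dots> \<longleftrightarrow> s \<in> N" using s by (simp add: N_def)
    finally show ?thesis .
  qed
  have N0_N: "N0 \<subseteq> N"
  proof
    fix s assume s: "s \<in> N0"
    then have "s \<in> {0..<1}" "frac (s + of_int 0 * a) \<in> N0" by (auto simp: N0_def frac_eq)
    then show "s \<in> N" unfolding N_def by blast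
  qed
  have good: "s \<noteq> 0" "K (J s) = s" "J s \<in> Q" if "s \<in> {0..<1} - N" for s
  proof -
    have "s \<notin> N0" using that N0_N by blast
    then have s: "s \<noteq> 0" "h (J s) = I s" "J s \<in> Q" using that by (auto simp: N0_def)
    then show "s \<noteq> 0" "J s \<in> Q" by auto
    show "K (J s) = s" using C_I[of s] s that by (simp add: K_def)
  qed
  define Q' where "Q' = {x \<in> Q. K x \<in> {0..<1} - N \<and> J (K x) = x}"
  have Q'_sets: "Q' \<in> sets \<mu>"
  proof -
    have JK: "(\<lambda>x. J (K x)) \<in> measurable \<mu> \<mu>" by measurable
    then have "(\<lambda>x. J (K x)) \<in> borel_measurable \<mu>" using measurable_cong_sets[OF refl sets_eq_borel] by blast
    moreover have "(\<lambda>x. x) \<in> borel_measurable \<mu>" using measurable_ident_sets[OF sets_eq_borel] by simp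
    ultimately have 1: "{x \<in> space \<mu>. J (K x) = x} \<in> sets \<mu>" by (rule measurable_equality_set)
    have 2: "{x \<in> space \<mu>. x \<in> Q \<and> K x \<in> {0..<1} - N} \<in> sets \<mu>" by measurable
    have "Q' = {x \<in> space \<mu>. J (K x) = x} \<inter> {x \<in> space \<mu>. x \<in> Q \<and> K x \<in> {0..<1} - N}" by (auto simp: Q'_def)
    then show ?thesis using sets.Int[OF 1 2] by simp
  qed
  have J_Q': "J s \<in> Q'" if "s \<in> {0..<1} - N" for s
    using good[OF that] that by (simp add: Q'_def)
  have law_J: "measure \<mu> (Q \<inter> B) = m * measure lborel {s \<in> {0..<1} - N. J s \<in> B}" if B: "B \<in> sets \<mu>" for B
  proof -
    have "Q \<inter> h -` (g -` B) = Q \<inter> B" using gh by auto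
    then have "measure \<mu> (Q \<inter> B) = m * measure lborel {s \<in> {0<..<1}. I s \<in> g -` B}"
      using law[OF g_vimage[OF B]] m by simp
    also have "measure lborel {s \<in> {0<..<1}. I s \<in> g -` B} = measure lborel {s \<in> {0..<1} - N. J s \<in> B}"
    proof (rule measure_eq_AE)
      show "AE s in lborel. (s \<in> {s \<in> {0<..<1}. I s \<in> g -` B}) = (s \<in> {s \<in> {0..<1} - N. J s \<in> B})"
        using AE_not_in[OF N]
      proof eventually_elim
        case (elim s)
        then have "s \<in> {0..<1} \<Longrightarrow> s \<noteq> 0" using good(1)[of s] by blast
        then show ?case using elim by (auto simp: J_def less_le)
      qed
      note [measurable] = B g_vimage[OF B]
      have "{s \<in> space borel. s \<in> {0<..<1} \<and> I s \<in> g -` B} \<in> sets borel"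
        "{s \<in> space borel. s \<in> {0..<1} - N \<and> J s \<in> B} \<in> sets borel" by measurable
      then show "{s \<in> {0<..<1}. I s \<in> g -` B} \<in> sets lborel" "{s \<in> {0..<1} - N. J s \<in> B} \<in> sets lborel" by simp_all
    qed
    finally show ?thesis .
  qed
  define R where "R = (\<lambda>j x. if x \<in> Q' then J (frac (K x + of_int j * a)) else x)"
  have R_meas: "R j \<in> measurable \<mu> \<mu>" for j
  proof -
    note [measurable] = Q'_sets
    have "(\<lambda>x. frac (K x + of_int j * a)) \<in> borel_measurable \<mu>" unfolding frac_def by measurable
    then show ?thesis unfolding R_def by measurable
  qed
  have rot: "frac (K x + of_int j * a) \<in> {0..<1} - N" if "x \<in> Q'" for x j
    using N_rot[of "K x" j] that by (simp add: Q'_def frac_lt_1)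
  have R_Q': "R j x \<in> Q'" "K (R j x) = frac (K x + of_int j * a)" if "x \<in> Q'" for x j
    using that J_Q'[OF rot[OF that]] good(2)[OF rot[OF that]] by (simp_all add: R_def)
  have R_comp: "R i (R j x) = R (i + j) x" for i j x
  proof (cases "x \<in> Q'")
    case True
    have "frac (frac (K x + of_int j * a) + of_int i * a) = frac (K x + of_int (i + j) * a)"
      unfolding frac_add_frac by (simp add: algebra_simps)
    then show ?thesis using True R_Q'[OF True, of j] by (simp add: R_def)
  qed (simp add: R_def)
  have R_0: "R 0 x = x" for x
    by (auto simp: R_def Q'_def frac_eq)
  have R_aut: "R 1 \<in> automorphisms \<mu>"
  proof (rule automorphismI(1))
    show "R 1 \<in> measurable \<mu> \<mu>" "R (-1) \<in> measurable \<mu> \<mu>" by (rule R_meas)+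
    show "R (-1) (R 1 x) = x" "R 1 (R (-1) x) = x" for x by (simp_all add: R_comp R_0)
    fix B assume B: "B \<in> sets \<mu>"
    have RB: "R 1 -` B \<in> sets \<mu>" using measurable_sets[OF R_meas B, of 1] by simp
    define G where "G = {s \<in> {0..<1} - N. J s \<in> B}"
    have G: "G \<in> sets borel"
    proof -
      note [measurable] = B
      have "{s \<in> space borel. s \<in> {0..<1} - N \<and> J s \<in> B} \<in> sets borel" by measurable
      then show ?thesis by (simp add: G_def)
    qed
    have QQ': "Q \<inter> (Q' \<inter> D) = Q' \<inter> D" for D by (auto simp: Q'_def)
    have "{s \<in> {0..<1} - N. J s \<in> Q' \<inter> R 1 -` B} = {s \<in> {0..<1} - N. J (frac (s + a)) \<in> B}"
      using J_Q' good(2) by (auto simp: R_def)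
    also have "\<dots> = {s \<in> {0..<1}. frac (s + a) \<in> G}"
      using N_rot[of _ 1] by (auto simp: G_def frac_lt_1)
    finally have "measure lborel {s \<in> {0..<1} - N. J s \<in> Q' \<inter> R 1 -` B} = measure lborel G"
      using rotation_preserves_lborel[OF G, of a] unfolding measure_def by (simp add: G_def subset_iff)
    also have "G = {s \<in> {0..<1} - N. J s \<in> Q' \<inter> B}" using J_Q' by (auto simp: G_def)
    finally have 1: "measure \<mu> (Q' \<inter> R 1 -` B) = measure \<mu> (Q' \<inter> B)"
      using law_J[of "Q' \<inter> R 1 -` B"] law_J[of "Q' \<inter> B"] Q'_sets RB B by (simp add: QQ' sets.Int)
    have "R 1 -` B - Q' = B - Q'" by (auto simp: R_def)
    then have "measure \<mu> (R 1 -` B) = measure \<mu> B"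
      using 1 finite_measure_Diff'[OF RB Q'_sets] finite_measure_Diff'[OF B Q'_sets] by (simp add: Int_commute)
    then show "emeasure \<mu> (R 1 -` B) = emeasure \<mu> B" by (simp add: emeasure_eq_measure)
  qed
  have R_pow: "(R 1 ^^ n) x = R (int n) x" for n x
    by (induction n) (simp_all add: R_0 R_comp)
  have aper: "(R 1 ^^ n) x \<noteq> x" if x: "x \<in> Q'" and n: "0 < n" for n x
  proof
    assume "(R 1 ^^ n) x = x"
    then have "frac (K x + of_int (int n) * a) = K x" using R_Q'(2)[OF x, of "int n"] by (simp add: R_pow)
    then have "real n * a = of_int \<lfloor>K x + real n * a\<rfloor>" by (simp add: frac_def algebra_simps)
    then have "a = of_int \<lfloor>K x + real n * a\<rfloor> / of_nat n" using n by (simp add: field_simps)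
    then have "a \<in> \<rat>" by (metis Rats_divide Rats_of_int Rats_of_nat)
    then show False using a by simp
  qed
  have "measure \<mu> (Q \<inter> (- Q')) = m * measure lborel {s \<in> {0..<1} - N. J s \<in> - Q'}"
    using sets.compl_sets[OF Q'_sets] by (intro law_J) (simp add: Compl_eq_Diff_UNIV)
  also have "{s \<in> {0..<1} - N. J s \<in> - Q'} = {}" using J_Q' by auto
  finally have "measure \<mu> (Q - Q') = 0" by (simp add: Diff_eq)
  then have "Q - Q' \<in> null_sets \<mu>" using Q Q'_sets by (simp add: null_sets_def emeasure_eq_measure sets.Diff)
  then have "AE x in \<mu>. x \<notin> Q - Q'" by (rule AE_not_in)
  then have "AE x in \<mu>. x \<in> Q \<longrightarrow> (\<forall>n>0. (R 1 ^^ n) x \<noteq> x)"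
    by eventually_elim (use aper in blast)
  moreover have "R 1 x \<in> Q" if "x \<in> Q" for x
  proof (cases "x \<in> Q'")
    case True
    then show ?thesis using R_Q'(1)[of x 1] by (simp add: Q'_def)
  qed (simp add: R_def that)
  moreover have "R 1 x = x" if "x \<notin> Q" for x using that by (simp add: R_def Q'_def)
  ultimately show ?thesis using R_aut by (intro bexI[of _ "R 1"]) auto
qed

text \<open>
  Automorphisms supported on the cells of a countable partition act together as one automorphism.
\<close>

lemma glue_automorphisms:
  fixes l :: "'a \<Rightarrow> nat"
  assumes l: "l \<in> measurable \<mu> (count_space UNIV)"
    and T: "\<And>c. T c \<in> automorphisms \<mu>" "\<And>c x. l x = c \<Longrightarrow> l (T c x) = c" "\<And>c x. l x \<noteq> c \<Longrightarrow> T c x = x"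
  shows "(\<lambda>x. T (l x) x) \<in> automorphisms \<mu>"
proof (rule automorphismI(1))
  have iff: "l (T c x) = c \<longleftrightarrow> l x = c" for c x
    using T(2)[of x c] T(3)[of x c] by (cases "l x = c") auto
  have T_inv: "T c (inv (T c) x) = x" "inv (T c) (T c x) = x" for c x
    using automorphism_bij[OF T(1)] by (simp_all add: bij_is_inj bij_is_surj surj_f_inv_f)
  have inv_l: "l (inv (T c) x) = c \<longleftrightarrow> l x = c" for c x
    using iff[of c "inv (T c) x"] by (simp add: T_inv)
  show "(\<lambda>x. T (l x) x) \<in> measurable \<mu> \<mu>" "(\<lambda>x. inv (T (l x)) x) \<in> measurable \<mu> \<mu>"
    by (rule measurable_compose_countable[OF _ l]; rule automorphism_measurable[OF T(1)] automorphism_inv_measurable[OF T(1)])+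
  show "inv (T (l (T (l x) x))) (T (l x) x) = x" for x
    using iff[of "l x" x] by (simp add: T_inv)
  show "T (l (inv (T (l x)) x)) (inv (T (l x)) x) = x" for x
    using inv_l[of "l x" x] by (simp add: T_inv)
  fix B assume B: "B \<in> sets \<mu>"
  have cell: "{x. l x = c} \<in> sets \<mu>" for c
    using measurable_sets[OF l, of "{c}"] by (simp add: vimage_def)
  define V where "V = (\<lambda>c. T c -` (B \<inter> {x. l x = c}))"
  have V: "V c \<in> sets \<mu>" "emeasure \<mu> (V c) = emeasure \<mu> (B \<inter> {x. l x = c})" for c
    unfolding V_def
    by (rule automorphism_vimage_sets automorphism_emeasure_vimage, rule T(1), intro sets.Int B cell)+
  have V_eq: "V c = {x. l x = c \<and> T c x \<in> B}" for c
    by (auto simp: V_def iff)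
  have "(\<lambda>x. T (l x) x) -` B = (\<Union>c. V c)" by (auto simp: V_eq)
  also have "emeasure \<mu> (\<Union>c. V c) = (\<Sum>c. emeasure \<mu> (V c))"
    using V by (intro suminf_emeasure[symmetric]) (auto simp: disjoint_family_on_def V_eq)
  also have "\<dots> = (\<Sum>c. emeasure \<mu> (B \<inter> {x. l x = c}))" by (simp add: V)
  also have "\<dots> = emeasure \<mu> (\<Union>c. B \<inter> {x. l x = c})"
    using B cell by (intro suminf_emeasure) (auto simp: disjoint_family_on_def)
  also have "(\<Union>c. B \<inter> {x. l x = c}) = B" by auto
  finally show "emeasure \<mu> ((\<lambda>x. T (l x) x) -` B) = emeasure \<mu> B" .
qed

end

lemma continuous_on_det:
  fixes f :: "'x::topological_space \<Rightarrow> real^'n::finite^'n"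
  shows "continuous_on S f \<Longrightarrow> continuous_on S (\<lambda>x. det (f x))"
  unfolding det_def by (intro continuous_intros) auto

context finite_measure_on_borel
begin

text \<open>
  The space is cut into countably many cells on which a code is available and the label is constant.
\<close>

lemma aperiodic_on_set:
  fixes U :: "nat \<Rightarrow> 'a set" and h :: "nat \<Rightarrow> 'a \<Rightarrow> real" and g :: "nat \<Rightarrow> real \<Rightarrow> 'a"
  assumes atomless: "\<And>x. measure \<mu> {x} = 0"
    and U: "\<And>i. U i \<in> sets \<mu>" "(\<Union>i. U i) = UNIV"
    and hg: "\<And>i. h i \<in> borel_measurable \<mu>" "\<And>i. g i \<in> measurable borel \<mu>" "\<And>i x. x \<in> U i \<Longrightarrow> g i (h i x) = x"
    and D: "D \<in> sets \<mu>" and l: "l \<in> measurable \<mu> (count_space UNIV)"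
  shows "\<exists>T\<in>automorphisms \<mu>. (\<forall>x. x \<notin> D \<longrightarrow> T x = x) \<and> (\<forall>x\<in>D. T x \<in> D) \<and>
        (\<forall>x. (l (T x) :: nat) = l x) \<and> (AE x in \<mu>. x \<in> D \<longrightarrow> (\<forall>m>0. (T ^^ m) x \<noteq> x))"
proof -
  define idx where "idx = (\<lambda>x. LEAST i. x \<in> U i)"
  have idx: "x \<in> U (idx x)" for x
    unfolding idx_def by (rule LeastI_ex) (use U(2) in blast)
  have idx_meas: "idx \<in> measurable \<mu> (count_space UNIV)"
  proof -
    note [measurable] = U(1)
    show ?thesis unfolding idx_def by measurable
  qed
  define l' where "l' = (\<lambda>x. to_nat (l x, idx x))"
  have l': "l' \<in> measurable \<mu> (count_space UNIV)"
    unfolding l'_def by (rule measurable_to_nat_Pair[OF l idx_meas])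
  define Q where "Q = (\<lambda>c. D \<inter> {x. l' x = c})"
  have Q: "Q c \<in> sets \<mu>" for c
    unfolding Q_def using D measurable_sets[OF l', of "{c}"] by (simp add: vimage_def sets.Int)
  have "\<exists>T. T \<in> automorphisms \<mu> \<and> (\<forall>x. x \<notin> Q c \<longrightarrow> T x = x) \<and> (\<forall>x\<in>Q c. T x \<in> Q c) \<and>
    (AE x in \<mu>. x \<in> Q c \<longrightarrow> (\<forall>m>0. (T ^^ m) x \<noteq> x))" for c
  proof -
    define i where "i = snd (from_nat c :: nat \<times> nat)"
    have "g i (h i x) = x" if "x \<in> Q c" for x
    proof -
      have "idx x = i" using that by (auto simp: Q_def i_def l'_def)
      then show ?thesis using hg(3)[of x i] idx[of x] by simp
    qed
    then show ?thesis
      using aperiodic_on_coded_set[OF Q hg(1,2) _ atomless, of c i] by blast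
  qed
  then have "\<forall>c. \<exists>T. T \<in> automorphisms \<mu> \<and> (\<forall>x. x \<notin> Q c \<longrightarrow> T x = x) \<and> (\<forall>x\<in>Q c. T x \<in> Q c) \<and>
    (AE x in \<mu>. x \<in> Q c \<longrightarrow> (\<forall>m>0. (T ^^ m) x \<noteq> x))" by (rule allI)
  from choice[OF this] obtain T where T: "\<forall>c. T c \<in> automorphisms \<mu> \<and> (\<forall>x. x \<notin> Q c \<longrightarrow> T c x = x) \<and>
    (\<forall>x\<in>Q c. T c x \<in> Q c) \<and> (AE x in \<mu>. x \<in> Q c \<longrightarrow> (\<forall>m>0. (T c ^^ m) x \<noteq> x))" ..
  have T: "\<And>c. T c \<in> automorphisms \<mu>" "\<And>c x. x \<notin> Q c \<Longrightarrow> T c x = x" "\<And>c x. x \<in> Q c \<Longrightarrow> T c x \<in> Q c"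
    "\<And>c. AE x in \<mu>. x \<in> Q c \<longrightarrow> (\<forall>m>0. (T c ^^ m) x \<noteq> x)"
    using T by blast+
  define S where "S = (\<lambda>x. T (l' x) x)"
  have Tl: "l' (T c x) = l' x" for c x
  proof (cases "x \<in> Q c")
    case True
    then show ?thesis using T(3)[OF True] by (simp add: Q_def)
  qed (simp add: T(2))
  have S: "S \<in> automorphisms \<mu>"
    unfolding S_def
  proof (rule glue_automorphisms[OF l' T(1)])
    show "l' (T c x) = c" if "l' x = c" for c x using that by (simp add: Tl)
    show "T c x = x" if "l' x \<noteq> c" for c x using that by (intro T(2)) (simp add: Q_def)
  qed
  have S_l: "l' (S x) = l' x" for x by (simp add: S_def Tl)
  have S_pow: "(S ^^ m) x = (T (l' x) ^^ m) x \<and> l' ((S ^^ m) x) = l' x" for m x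
  proof (induction m)
    case (Suc m)
    then have IH: "(S ^^ m) x = (T (l' x) ^^ m) x" "l' ((S ^^ m) x) = l' x" by auto
    have "(S ^^ Suc m) x = S ((S ^^ m) x)" by simp
    also have "\<dots> = T (l' ((S ^^ m) x)) ((S ^^ m) x)" by (simp only: S_def)
    also have "\<dots> = (T (l' x) ^^ Suc m) x" unfolding IH(2) unfolding IH(1) by simp
    finally have "(S ^^ Suc m) x = (T (l' x) ^^ Suc m) x" .
    moreover have "l' ((S ^^ Suc m) x) = l' x" using S_l[of "(S ^^ m) x"] IH(2) by simp
    ultimately show ?case by blast
  qed simp
  have "AE x in \<mu>. \<forall>c. x \<in> Q c \<longrightarrow> (\<forall>m>0. (T c ^^ m) x \<noteq> x)"
    unfolding AE_all_countable using T(4) by blast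
  then have ae: "AE x in \<mu>. x \<in> D \<longrightarrow> (\<forall>m>0. (S ^^ m) x \<noteq> x)"
  proof eventually_elim
    case (elim x)
    show ?case
    proof (intro impI allI)
      fix m :: nat assume "x \<in> D" "0 < m"
      then have "(T (l' x) ^^ m) x \<noteq> x" using elim by (simp add: Q_def)
      then show "(S ^^ m) x \<noteq> x" using S_pow[of m x] by simp
    qed
  qed
  have 1: "S x = x" if "x \<notin> D" for x
    unfolding S_def using that by (intro T(2)) (simp add: Q_def)
  have 2: "S x \<in> D" if "x \<in> D" for x
    using T(3)[of x "l' x"] that by (simp add: Q_def S_def)
  have 3: "l (S x) = l x" for x
    using S_l[of x] by (simp add: l'_def)
  show ?thesis using S 1 2 3 ae by blast
qed

end

section \<open>Charts and the Riemannian volume\<close>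

lemma chart_coding:
  fixes c :: "('a::{t2_space, second_countable_topology}, 'n::finite) chart"
  assumes "is_chart c"
  obtains h :: "'a \<Rightarrow> real" and g :: "real \<Rightarrow> 'a"
  where "h \<in> borel_measurable borel" "g \<in> borel_measurable borel" "\<And>x. x \<in> fst c \<Longrightarrow> g (h x) = x"
proof -
  obtain U \<phi> where c: "c = (U, \<phi>)" by fastforce
  have U: "open U" "open (\<phi> ` U)" "homeomorphism U (\<phi> ` U) \<phi> (inv_into U \<phi>)"
    using assms by (simp_all add: is_chart_def c)
  obtain h0 :: "real^'n \<Rightarrow> real" and g0 :: "real \<Rightarrow> real^'n"
    where h0: "h0 \<in> borel_measurable borel" and g0: "g0 \<in> borel_measurable borel" and gh: "\<And>x. g0 (h0 x) = x"
    using borel_injection_into_real by blast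
  have ext: "(\<lambda>x. if x \<in> S then f x else b) \<in> borel_measurable borel"
    if "open S" "continuous_on S f" for S :: "'x::topological_space set" and f :: "'x \<Rightarrow> 'y::topological_space" and b
    using borel_measurable_continuous_on_restrict[OF that(2)] that(1)
    by (subst (asm) measurable_restrict_space_iff[of _ _ b]) auto
  have 1: "(\<lambda>x. if x \<in> U then \<phi> x else 0) \<in> borel_measurable borel"
    using U by (intro ext) (auto simp: homeomorphism_def)
  have 2: "(\<lambda>y. if y \<in> \<phi> ` U then inv_into U \<phi> y else undefined) \<in> borel_measurable borel"
    using U by (intro ext) (auto simp: homeomorphism_def)
  show ?thesis
  proof (rule that)
    show "(\<lambda>x. h0 (if x \<in> U then \<phi> x else 0)) \<in> borel_measurable borel"
      by (rule measurable_compose[OF 1 h0])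
    show "(\<lambda>t. (\<lambda>y. if y \<in> \<phi> ` U then inv_into U \<phi> y else undefined) (g0 t)) \<in> borel_measurable borel"
      by (rule measurable_compose[OF g0 2])
    fix x assume "x \<in> fst c"
    then have "x \<in> U" "inv_into U \<phi> (\<phi> x) = x" using U(3) by (auto simp: c homeomorphism_def)
    then show "(\<lambda>y. if y \<in> \<phi> ` U then inv_into U \<phi> y else undefined) (g0 (h0 (if x \<in> U then \<phi> x else 0))) = x"
      by (simp add: gh)
  qed
qed

text \<open>
  Small balls in a chart have finite volume because the density is continuous, and compactness gives
  finiteness of the total volume. Points are Lebesgue null in a chart.
\<close>

lemma riemannian_volume_finite_atomless:
  fixes \<A> :: "('a::{t2_space, second_countable_topology}, 'n::finite) chart set"
  assumes compact: "compact (UNIV :: 'a set)" and atlas: "smooth_atlas \<A>"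
    and metric: "riemannian_metric \<A> g" and vol: "riemannian_volume \<A> g \<mu>"
  shows "finite_measure_on_borel \<mu>" and "measure \<mu> {x} = 0"
proof -
  have sets: "sets \<mu> = sets borel" using vol by (simp add: riemannian_volume_def)
  have sp: "space \<mu> = UNIV" using sets_eq_imp_space_eq[OF sets] by simp
  have vol: "emeasure \<mu> E = (\<integral>\<^sup>+y \<in> snd c ` E. ennreal (sqrt (det (g c y))) \<partial>lborel)"
    if "c \<in> \<A>" "E \<in> sets borel" "E \<subseteq> fst c" for c E
    using vol that by (simp add: riemannian_volume_def)
  have cover: "\<exists>c\<in>\<A>. x \<in> fst c" for x using atlas by (auto simp: smooth_atlas_def)
  have local: "\<exists>V. open V \<and> x \<in> V \<and> emeasure \<mu> V < \<infinity>" for x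
  proof -
    obtain c where c: "c \<in> \<A>" "x \<in> fst c" using cover by blast
    obtain U \<phi> where Up: "c = (U, \<phi>)" by fastforce
    have U: "open U" "open (\<phi> ` U)" "homeomorphism U (\<phi> ` U) \<phi> (inv_into U \<phi>)"
      using atlas c by (auto simp: smooth_atlas_def is_chart_def Up)
    have x: "x \<in> U" using c by (simp add: Up)
    obtain r where r: "0 < r" "cball (\<phi> x) r \<subseteq> \<phi> ` U"
      using U(2) x by (meson imageI open_contains_cball)
    define V where "V = U \<inter> \<phi> -` ball (\<phi> x) r"
    have V: "open V" unfolding V_def using U by (intro continuous_open_preimage) (auto simp: homeomorphism_def)
    have "ball (\<phi> x) r \<subseteq> \<phi> ` U" using r(2) ball_subset_cball by (rule order_trans[rotated])
    then have \<phi>V: "\<phi> ` V = ball (\<phi> x) r" unfolding V_def by blast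
    have "continuous_on (\<phi> ` U) (g c)"
    proof -
      have "smooth_on (g c) (snd c ` fst c)" 
        using metric c(1) unfolding riemannian_metric_def by blast
      then have "Ck_on 0 (g c) (snd c ` fst c)" unfolding smooth_on_def by (rule spec)
      then show ?thesis by (simp add: Up)
    qed
    then have "continuous_on (cball (\<phi> x) r) (g c)" using r(2) by (rule continuous_on_subset)
    then have "continuous_on (cball (\<phi> x) r) (\<lambda>y. sqrt (det (g c y)))"
      by (intro continuous_on_real_sqrt continuous_on_det)
    then have "bounded ((\<lambda>y. sqrt (det (g c y))) ` cball (\<phi> x) r)"
      by (intro compact_imp_bounded compact_continuous_image) auto
    then obtain B where "\<forall>z\<in>(\<lambda>y. sqrt (det (g c y))) ` cball (\<phi> x) r. norm z \<le> B"
      unfolding bounded_iff by blast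
    then have B: "\<bar>sqrt (det (g c y))\<bar> \<le> B" if "y \<in> cball (\<phi> x) r" for y
      using that unfolding real_norm_def by blast
    have "emeasure \<mu> V = (\<integral>\<^sup>+y \<in> ball (\<phi> x) r. ennreal (sqrt (det (g c y))) \<partial>lborel)"
      using vol[OF c(1), of V] V \<phi>V by (simp add: Up V_def)
    also have "\<dots> \<le> (\<integral>\<^sup>+y. ennreal B * indicator (ball (\<phi> x) r) y \<partial>lborel)"
    proof (rule nn_integral_mono)
      fix y
      show "ennreal (sqrt (det (g c y))) * indicator (ball (\<phi> x) r) y \<le> ennreal B * indicator (ball (\<phi> x) r) y"
        using B[of y] by (auto simp: indicator_def intro!: ennreal_leI)
    qed
    also have "\<dots> = ennreal B * emeasure lborel (ball (\<phi> x) r)"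
      by (intro nn_integral_cmult_indicator) auto
    also have "\<dots> < \<infinity>" using emeasure_bounded_finite[OF bounded_ball] by (auto simp: ennreal_mult_less_top)
    finally show ?thesis using V x r by (intro exI[of _ V]) (auto simp: V_def)
  qed
  then obtain V where V: "\<And>x. open (V x)" "\<And>x. x \<in> V x" "\<And>x. emeasure \<mu> (V x) < \<infinity>" by metis
  obtain F where F: "finite F" "UNIV \<subseteq> (\<Union>x\<in>F. V x)"
    by (rule compactE_image[OF compact, of UNIV V]) (use V in auto)
  have "emeasure \<mu> UNIV \<le> emeasure \<mu> (\<Union>x\<in>F. V x)"
    using F V by (intro emeasure_mono) (auto simp: sets)
  also have "\<dots> \<le> (\<Sum>x\<in>F. emeasure \<mu> (V x))"
    using F V by (intro emeasure_subadditive_finite) (auto simp: sets)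
  also have "\<dots> < \<infinity>" using V F by (simp add: ennreal_sum_less_top less_top)
  finally have "finite_measure \<mu>" by (intro finite_measureI) (simp add: sp)
  then show "finite_measure_on_borel \<mu>"
    by (simp add: finite_measure_on_borel_def finite_measure_on_borel_axioms_def sets)
  obtain c where c: "c \<in> \<A>" "x \<in> fst c" using cover by blast
  have "emeasure \<mu> {x} = (\<integral>\<^sup>+y \<in> {snd c x}. ennreal (sqrt (det (g c y))) \<partial>lborel)"
    using vol[OF c(1), of "{x}"] c(2) by simp
  also have "\<dots> = 0" by (intro nn_integral_null_set null_setsI) auto
  finally show "measure \<mu> {x} = 0" by (simp add: measure_def)
qed

section \<open>Slowing down a cocycle by rare rotations\<close>

lemma cocycle_cong:
  assumes "\<And>l. l < n \<Longrightarrow> A ((f ^^ l) x) = B ((f ^^ l) x)"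
  shows "cocycle f A n x = cocycle f B n x"
  using assms by (induction n) auto

lemma cocycle_split_first: "cocycle f A (Suc n) x = cocycle f A n (f x) ** A x"
  using cocycle_add[of f A n 1 x] by simp

text \<open>
  In a product of \<open>r\<close> matrices of norm at most \<open>C\<close>, the last position at which the norm of the initial
  part is at most that of the final part splits the product into factors whose norms have ratio at
  most \<open>C\<^sup>2\<close>. One rotation inserted there makes the norm of the whole product bounded independently of \<open>r\<close>.
\<close>

lemma balanced_rotation_exists:
  assumes B: "range B \<subseteq> SL2" "\<And>x. matrix_norm (B x) \<le> C" and r: "1 \<le> r"
  shows "\<exists>i<r. \<exists>q::rat. matrix_norm (cocycle f B (r - i) ((f ^^ i) x) ** (rotation (of_rat q) ** cocycle f B i x)) < C\<^sup>2 + 1"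
proof -
  define N1 N2 where "N1 = (\<lambda>i. matrix_norm (cocycle f B i x))"
    and "N2 = (\<lambda>i. matrix_norm (cocycle f B (r - i) ((f ^^ i) x)))"
  have ge1: "1 \<le> N1 i" "1 \<le> N2 i" for i
    unfolding N1_def N2_def by (intro matrix_norm_SL2 cocycle_SL2 B)+
  have "B x \<in> SL2" using B(1) by blast
  then have C: "1 \<le> C" using matrix_norm_SL2 B(2)[of x] order_trans by blast
  define S where "S = {i. i < r \<and> N1 i \<le> N2 i}"
  have S: "finite S" "0 \<in> S" using r ge1(2)[of 0] by (auto simp: S_def N1_def)
  define i where "i = Max S"
  have i: "i < r" "N1 i \<le> N2 i" 
  proof -
    have "i \<in> S" unfolding i_def using S by (intro Max_in) auto
    then show "i < r" "N1 i \<le> N2 i" by (simp_all add: S_def)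
  qed
  have step1: "N1 (Suc i) \<le> C * N1 i"
  proof -
    have "N1 (Suc i) \<le> matrix_norm (B ((f ^^ i) x)) * N1 i"
      unfolding N1_def by (simp add: matrix_norm_mult)
    also have "\<dots> \<le> C * N1 i" using B(2) ge1(1)[of i] by (intro mult_right_mono) auto
    finally show ?thesis .
  qed
  have step2: "N2 i \<le> N2 (Suc i) * C"
  proof -
    have "r - i = Suc (r - Suc i)" using i by simp
    then have "N2 i = matrix_norm (cocycle f B (r - Suc i) ((f ^^ Suc i) x) ** B ((f ^^ i) x))"
      unfolding N2_def using cocycle_split_first[of f B "r - Suc i" "(f ^^ i) x"] by simp
    also have "\<dots> \<le> N2 (Suc i) * matrix_norm (B ((f ^^ i) x))"
      unfolding N2_def by (rule matrix_norm_mult)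
    also have "\<dots> \<le> N2 (Suc i) * C" using B(2) ge1(2)[of "Suc i"] by (intro mult_left_mono) auto
    finally show ?thesis .
  qed
  have "N2 i \<le> C\<^sup>2 * N1 i"
  proof (cases "Suc i < r")
    case True
    have "Suc i \<notin> S" using Max_ge[OF S(1), of "Suc i"] by (auto simp: i_def)
    then have "N2 (Suc i) \<le> N1 (Suc i)" using True by (simp add: S_def)
    then have "N2 (Suc i) * C \<le> (C * N1 i) * C" using step1 C by (intro mult_right_mono) auto
    then show ?thesis using step2 by (simp add: power2_eq_square mult.commute mult.left_commute)
  next
    case False
    then have "N2 (Suc i) = 1" using i by (simp add: N2_def)
    then have "N2 i \<le> C" using step2 by simp
    also have "C \<le> C\<^sup>2 * N1 i"
      using mult_mono[of C "C\<^sup>2" 1 "N1 i"] C ge1(1)[of i] by (simp add: self_le_power)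
    finally show ?thesis .
  qed
  then have "N2 i / N1 i \<le> C\<^sup>2" using ge1(1)[of i] by (simp add: divide_le_eq)
  moreover have "N1 i / N2 i \<le> C\<^sup>2"
  proof -
    have "N1 i / N2 i \<le> 1" using i ge1(2)[of i] by (simp add: divide_le_eq)
    also have "1 \<le> C\<^sup>2" using C by simp
    finally show ?thesis .
  qed
  ultimately have "\<exists>q::rat. matrix_norm (cocycle f B (r - i) ((f ^^ i) x) ** (rotation (of_rat q) ** cocycle f B i x)) < C\<^sup>2 + 1"
    unfolding N1_def N2_def by (intro rational_rotation_balance cocycle_SL2 B)
  then show ?thesis using i by blast
qed

context finite_measure_on_borel
begin

lemma marker_measure:
  assumes f: "f \<in> automorphisms \<mu>" and N: "1 \<le> N" and E: "E \<in> sets \<mu>"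
    and sep: "\<And>x j. x \<in> E \<Longrightarrow> 0 < j \<Longrightarrow> j < N \<Longrightarrow> (f ^^ j) x \<notin> E"
  shows "measure \<mu> E \<le> measure \<mu> UNIV / real N"
proof -
  note fj = automorphism_funpow[OF f]
  have disj: "disjoint_family_on (\<lambda>j. (f ^^ j) -` E) {..<N}"
    unfolding disjoint_family_on_def
  proof (intro ballI impI)
    have *: "(f ^^ i) -` E \<inter> (f ^^ j) -` E = {}" if "i < j" "j < N" for i j
    proof -
      have "(f ^^ j) x = (f ^^ (j - i)) ((f ^^ i) x)" for x
        using that funpow_add[of "j - i" i f] by simp
      then show ?thesis using sep[of _ "j - i"] that by auto
    qed
    fix i j assume "i \<in> {..<N}" "j \<in> {..<N}" "i \<noteq> j"
    then show "(f ^^ i) -` E \<inter> (f ^^ j) -` E = {}"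
      using *[of i j] *[of j i] by (cases "i < j") (auto simp: Int_commute)
  qed
  have "real N * measure \<mu> E = (\<Sum>j<N. measure \<mu> ((f ^^ j) -` E))"
    using automorphism_measure_vimage[OF fj E] by simp
  also have "\<dots> = measure \<mu> (\<Union>j<N. (f ^^ j) -` E)"
    using automorphism_vimage_sets[OF fj E] disj by (intro finite_measure_finite_Union[symmetric]) auto
  also have "\<dots> \<le> measure \<mu> UNIV"
    using sets.top[of \<mu>] by (intro finite_measure_mono) auto
  finally show ?thesis using N by (simp add: field_simps)
qed

lemma integral_small_on_small_sets:
  fixes w :: "'a \<Rightarrow> real"
  assumes w: "integrable \<mu> w" and e: "0 < e"
  obtains d where "0 < d" "\<And>Z. Z \<in> sets \<mu> \<Longrightarrow> measure \<mu> Z < d \<Longrightarrow> (\<integral>x. indicator Z x * w x \<partial>\<mu>) < e"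
proof -
  obtain c where c: "0 \<le> c" "(\<integral>x. max 0 (w x - c) \<partial>\<mu>) < e / 2"
    using truncation_tail_small[OF w, of "e / 2"] e by auto
  define d where "d = e / (2 * (c + 1))"
  have d: "0 < d" using c e by (simp add: d_def)
  show ?thesis
  proof (rule that[OF d])
    fix Z assume Z: "Z \<in> sets \<mu>" "measure \<mu> Z < d"
    have i: "integrable \<mu> (\<lambda>x. c * indicator Z x)" "integrable \<mu> (\<lambda>x. max 0 (w x - c))"
      using Z w by (auto intro!: integrable_real_indicator simp: emeasure_eq_measure)
    have "(\<integral>x. indicator Z x * w x \<partial>\<mu>) \<le> (\<integral>x. c * indicator Z x + max 0 (w x - c) \<partial>\<mu>)"
    proof (rule integral_mono)
      show "integrable \<mu> (\<lambda>x. indicator Z x * w x)"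
        using integrable_real_mult_indicator[OF Z(1) w] by (simp add: mult.commute)
      show "integrable \<mu> (\<lambda>x. c * indicator Z x + max 0 (w x - c))" using i by (rule Bochner_Integration.integrable_add)
      show "indicator Z x * w x \<le> c * indicator Z x + max 0 (w x - c)" for x
        by (auto simp: indicator_def)
    qed
    also have "\<dots> = c * measure \<mu> Z + (\<integral>x. max 0 (w x - c) \<partial>\<mu>)" using i Z by simp
    also have "c * measure \<mu> Z \<le> c * d" using Z c by (intro mult_left_mono) auto
    also have "c * d \<le> e / 2" using c e by (simp add: d_def field_simps)
    finally show "(\<integral>x. indicator Z x * w x \<partial>\<mu>) < e" using c by simp
  qed
qed

text \<open>
  A column is the orbit segment of a point of the marker set \<open>E\<close> up to its return to \<open>E\<close>, of length
  \<open>r x\<close> between \<open>N\<close> and \<open>2 N\<close>. One rotation per column, at a position and with a rational angle chosen with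
  least index among the suitable ones, keeps the norm of the product along the column below
  \<open>C\<^sup>2 + 1\<close>. Since a time interval of length \<open>n\<close> contains at most \<open>n / N\<close> complete columns, the growth rate
  is small for large \<open>N\<close>, and the modified set has at most the measure of \<open>E\<close>.
\<close>

lemma bounded_cocycle_slowed:
  assumes f: "f \<in> automorphisms \<mu>" and aper: "AE x in \<mu>. \<forall>m>0. (f ^^ m) x \<noteq> x"
    and B: "B \<in> borel_measurable \<mu>" "range B \<subseteq> SL2" "\<And>x. matrix_norm (B x) \<le> C" and N: "1 \<le> N"
  obtains A where "A \<in> borel_measurable \<mu>" "range A \<subseteq> SL2" "\<And>x. matrix_norm (A x) = matrix_norm (B x)"
    and "{x. A x \<noteq> B x} \<in> sets \<mu>" "measure \<mu> {x. A x \<noteq> B x} \<le> measure \<mu> UNIV / real N"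
    and "AE x in \<mu>. \<forall>n. log_growth f A n x \<le> 4 * real N * ln C + real (n div N) * ln (C\<^sup>2 + 1)"
proof -
  note fj = automorphism_funpow[OF f]
  note [measurable] = automorphism_measurable[OF f] automorphism_measurable[OF fj] B(1)
  have "B undefined \<in> SL2" using B(2) by blast
  then have C: "1 \<le> C" using matrix_norm_SL2 B(3)[of undefined] order_trans by blast
  have inj: "(f ^^ j) x = (f ^^ j) y \<longleftrightarrow> x = y" for j x y
    using automorphism_bij[OF fj, of j] by (metis bij_is_inj injD)
  define X where "X = {x. \<forall>m>0. (f ^^ m) x \<noteq> x}"
  have "X = UNIV - (\<Union>m\<in>{0<..}. {x. (f ^^ m) x = x})" by (auto simp: X_def)
  also have "\<dots> \<in> sets \<mu>"
    using sets.top[of \<mu>] measurable_periodic_points[OF f] by (intro sets.Diff sets.countable_UN') auto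
  finally have X: "X \<in> sets \<mu>" .
  have X_f: "f x \<in> X" if "x \<in> X" for x
  proof -
    have "(f ^^ j) (f x) = f x \<longleftrightarrow> (f ^^ j) x = x" for j
      using inj[of 1 "(f ^^ j) x" x] by (simp add: funpow_swap1)
    then show ?thesis using that by (simp add: X_def)
  qed
  have free: "(f ^^ j) x \<noteq> x" if "x \<in> X" "0 < j" "j < N" for x j using that by (simp add: X_def)
  obtain E where E: "E \<in> sets \<mu>" "E \<subseteq> X"
    and sep: "\<And>x j. x \<in> E \<Longrightarrow> 0 < j \<Longrightarrow> j < N \<Longrightarrow> (f ^^ j) x \<notin> E"
    and hit: "\<And>x. x \<in> X \<Longrightarrow> \<exists>r. 1 \<le> r \<and> r < 2 * N \<and> (f ^^ r) x \<in> E"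
    using marker_set[OF f N X] X_f free by metis
  define r where "r = (\<lambda>x. LEAST r. 1 \<le> r \<and> (f ^^ r) x \<in> E)"
  have r: "1 \<le> r x" "(f ^^ r x) x \<in> E" "r x < 2 * N" if "x \<in> X" for x
  proof -
    obtain s where s: "1 \<le> s" "s < 2 * N" "(f ^^ s) x \<in> E" using hit[OF \<open>x \<in> X\<close>] by blast
    have "1 \<le> r x \<and> (f ^^ r x) x \<in> E" unfolding r_def by (rule LeastI[of _ s]) (use s in simp)
    then show "1 \<le> r x" "(f ^^ r x) x \<in> E" by auto
    have "r x \<le> s" unfolding r_def by (rule Least_le) (use s in simp)
    then show "r x < 2 * N" using s by simp
  qed
  have r_min: "(f ^^ j) x \<notin> E" if "1 \<le> j" "j < r x" for x j
    using not_less_Least[of j "\<lambda>r. 1 \<le> r \<and> (f ^^ r) x \<in> E"] that by (simp add: r_def)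
  have r_N: "N \<le> r x" if "x \<in> E" for x
  proof (rule ccontr)
    assume "\<not> N \<le> r x"
    then show False using sep[of x "r x"] r[of x] that E(2) by auto
  qed
  have r_meas [measurable]: "r \<in> measurable \<mu> (count_space UNIV)"
  proof -
    note [measurable] = E(1)
    show ?thesis unfolding r_def by measurable
  qed
  \<comment> \<open>The number \<open>j\<close> encodes a position in the column and a rational angle that suit the base point \<open>x\<close>.\<close>
  define P where "P = (\<lambda>x j. let i = fst (from_nat j :: nat \<times> rat); q = snd (from_nat j :: nat \<times> rat) in
     i < r x \<and> matrix_norm (cocycle f B (r x - i) ((f ^^ i) x) ** (rotation (of_rat q) ** cocycle f B i x)) < C\<^sup>2 + 1)"
  define code where "code = (\<lambda>x. LEAST j. P x j)"
  define idx rot where "idx = (\<lambda>j. fst (from_nat j :: nat \<times> rat))"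
    and "rot = (\<lambda>j. rotation (of_rat (snd (from_nat j :: nat \<times> rat))))"
  have P_ex: "\<exists>j. P x j" if "x \<in> X" for x
  proof -
    note r1 = r(1)[OF that]
    obtain i q where iq: "i < r x"
      "matrix_norm (cocycle f B (r x - i) ((f ^^ i) x) ** (rotation (of_rat (q::rat)) ** cocycle f B i x)) < C\<^sup>2 + 1"
      using balanced_rotation_exists[where f = f and x = x, OF B(2,3) r1] by blast
    then have "P x (to_nat (i, q))" by (simp add: P_def)
    then show ?thesis by blast
  qed
  have P_code: "idx (code x) < r x"
    "matrix_norm (cocycle f B (r x - idx (code x)) ((f ^^ idx (code x)) x) ** (rot (code x) ** cocycle f B (idx (code x)) x)) < C\<^sup>2 + 1"
    if "x \<in> X" for x
  proof -
    have "P x (code x)" unfolding code_def by (rule LeastI_ex[OF P_ex[OF that]])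
    then show "idx (code x) < r x"
      "matrix_norm (cocycle f B (r x - idx (code x)) ((f ^^ idx (code x)) x) ** (rot (code x) ** cocycle f B (idx (code x)) x)) < C\<^sup>2 + 1"
      by (simp_all add: P_def idx_def rot_def Let_def)
  qed
  have P_meas: "Measurable.pred \<mu> (\<lambda>x. P x j)" for j
  proof -
    define i q where "i = fst (from_nat j :: nat \<times> rat)" and "q = snd (from_nat j :: nat \<times> rat)"
    have c [measurable]: "cocycle f B s \<in> borel_measurable \<mu>" for s by (rule cocycle_measurable) measurable
    have "Measurable.pred \<mu> (\<lambda>x. \<exists>s. r x = s \<and> i < s \<and>
        matrix_norm (cocycle f B (s - i) ((f ^^ i) x) ** (rotation (of_rat q) ** cocycle f B i x)) < C\<^sup>2 + 1)"
      by measurable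
    then show ?thesis by (simp add: P_def i_def q_def Let_def)
  qed
  have code_meas: "code \<in> measurable \<mu> (count_space UNIV)"
    unfolding code_def using P_meas by measurable
  define Ej where "Ej = (\<lambda>j. E \<inter> {x. code x = j})"
  have Ej: "Ej j \<in> sets \<mu>" for j
    unfolding Ej_def using E(1) measurable_sets[OF code_meas, of "{j}"] by (simp add: vimage_def sets.Int)
  \<comment> \<open>The points at which the rotation with code \<open>j\<close> is inserted.\<close>
  define Y where "Y = (\<lambda>j. (f ^^ idx j) ` Ej j)"
  have Y: "Y j \<in> sets \<mu>" "measure \<mu> (Y j) = measure \<mu> (Ej j)" for j
    unfolding Y_def by (rule automorphism_image_sets[OF fj Ej] automorphism_measure_image[OF fj Ej])+
  have col: "l = l' \<and> x = x'" if "x \<in> E" "x' \<in> E" "l < r x" "l' < r x'" "(f ^^ l) x = (f ^^ l') x'" for x x' l l'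
  proof -
    have *: "l' \<le> l" if h: "x \<in> E" "x' \<in> E" "l < r x" "l' < r x'" "(f ^^ l) x = (f ^^ l') x'" for x x' l l'
    proof (rule ccontr)
      assume "\<not> l' \<le> l"
      then have "(f ^^ l') x' = (f ^^ l) ((f ^^ (l' - l)) x')" using funpow_add[of l "l' - l" f] by simp
      then have "x = (f ^^ (l' - l)) x'" using h(5) inj by simp
      then show False using r_min[of "l' - l" x'] h \<open>\<not> l' \<le> l\<close> by auto
    qed
    have "l = l'" using *[OF that] *[of x' x l' l] that by auto
    then show ?thesis using that(5) inj by simp
  qed
  have Y_iff: "(f ^^ l) x \<in> Y j \<longleftrightarrow> l = idx j \<and> code x = j" if "x \<in> E" "l < r x" for x l j
  proof
    assume "(f ^^ l) x \<in> Y j"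
    then obtain x' where x': "x' \<in> E" "code x' = j" "(f ^^ l) x = (f ^^ idx j) x'" by (auto simp: Y_def Ej_def)
    then have "idx j < r x'" using P_code(1)[of x'] E(2) by auto
    then have "l = idx j \<and> x = x'" using col[OF that(1) x'(1) that(2) _ x'(3)] by blast
    then show "l = idx j \<and> code x = j" using x' by simp
  next
    assume "l = idx j \<and> code x = j"
    then show "(f ^^ l) x \<in> Y j" using that by (auto simp: Y_def Ej_def)
  qed
  define jj where "jj = (\<lambda>y. LEAST j. y \<in> Y j)"
  define Z where "Z = (\<Union>j. Y j)"
  have Z: "Z \<in> sets \<mu>" unfolding Z_def using Y by auto
  define A where "A = (\<lambda>y. B y ** (if y \<in> Z then rot (jj y) else mat 1))"
  have jj_meas: "jj \<in> measurable \<mu> (count_space UNIV)"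
  proof -
    note [measurable] = Y(1)
    show ?thesis unfolding jj_def by measurable
  qed
  have A_meas: "A \<in> borel_measurable \<mu>"
  proof -
    have [measurable]: "(\<lambda>y. rot (jj y)) \<in> borel_measurable \<mu>"
      by (rule measurable_compose_countable[where f = "\<lambda>j y. rot j", OF _ jj_meas]) simp
    note [measurable] = Z
    show ?thesis unfolding A_def by measurable
  qed
  have A_norm: "matrix_norm (A x) = matrix_norm (B x)" for x
    by (simp add: A_def rot_def matrix_norm_mult_rotation)
  have A_SL2: "range A \<subseteq> SL2"
    using B(2) by (auto simp: A_def rot_def intro!: SL2_mult SL2_one rotation_SL2)
  have A_B: "A y = B y" if "y \<notin> Z" for y using that by (simp add: A_def)
  have A_col: "A ((f ^^ l) x) = B ((f ^^ l) x)" if "x \<in> E" "l < r x" "l \<noteq> idx (code x)" for x l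
    using Y_iff[OF that(1,2)] that(3) by (intro A_B) (auto simp: Z_def)
  have A_rot: "A ((f ^^ idx (code x)) x) = B ((f ^^ idx (code x)) x) ** rot (code x)" if "x \<in> E" for x
  proof -
    have l: "idx (code x) < r x" using P_code(1) that E(2) by blast
    have "(f ^^ idx (code x)) x \<in> Y (code x)" using Y_iff[OF that l] by blast
    moreover have "jj ((f ^^ idx (code x)) x) = code x"
      unfolding jj_def using Y_iff[OF that l] by (intro Least_equality) auto
    ultimately show ?thesis by (auto simp: A_def Z_def)
  qed
  have column: "log_growth f A (r x) x \<le> ln (C\<^sup>2 + 1)" if x: "x \<in> E" for x
  proof -
    define i where "i = idx (code x)"
    have i: "i < r x" using P_code(1) x E(2) by (auto simp: i_def)
    have c1: "cocycle f A i x = cocycle f B i x"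
      using i by (intro cocycle_cong A_col[OF x]) (auto simp: i_def)
    have s: "r x - i = Suc (r x - Suc i)" using i by simp
    have "A ((f ^^ l) (f ((f ^^ i) x))) = B ((f ^^ l) (f ((f ^^ i) x)))" if "l < r x - Suc i" for l
    proof -
      have "(f ^^ l) (f ((f ^^ i) x)) = (f ^^ (l + Suc i)) x" by (simp add: funpow_add funpow_swap1)
      then show ?thesis using A_col[OF x, of "l + Suc i"] that by (simp add: i_def)
    qed
    then have "cocycle f A (r x - Suc i) (f ((f ^^ i) x)) = cocycle f B (r x - Suc i) (f ((f ^^ i) x))"
      by (rule cocycle_cong)
    then have "cocycle f A (r x - i) ((f ^^ i) x) = cocycle f B (r x - i) ((f ^^ i) x) ** rot (code x)"
      unfolding s cocycle_split_first using A_rot[OF x] by (simp add: i_def matrix_mul_assoc)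
    moreover have "cocycle f A (r x) x = cocycle f A (r x - i) ((f ^^ i) x) ** cocycle f A i x"
      using cocycle_add[of f A "r x - i" i x] i by simp
    ultimately have "cocycle f A (r x) x = cocycle f B (r x - i) ((f ^^ i) x) ** (rot (code x) ** cocycle f B i x)"
      using c1 by (simp add: matrix_mul_assoc)
    then have "matrix_norm (cocycle f A (r x) x) < C\<^sup>2 + 1" using P_code(2)[of x] x E(2) by (auto simp: i_def)
    moreover have "1 \<le> matrix_norm (cocycle f A (r x) x)" by (intro matrix_norm_SL2 cocycle_SL2 A_SL2)
    ultimately show ?thesis unfolding log_growth_def by (intro ln_mono) auto
  qed
  have lnC: "0 \<le> ln C" and lnC2: "0 \<le> ln (C\<^sup>2 + 1)" using C by simp_all
  have crude: "log_growth f A n y \<le> real n * ln C" for n y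
  proof -
    have "log_growth f A n y \<le> (\<Sum>j<n. ln (matrix_norm (A ((f ^^ j) y))))" by (rule log_growth_le_sum[OF A_SL2])
    also have "\<dots> \<le> (\<Sum>j<n. ln C)"
    proof (rule sum_mono)
      fix j
      have "A ((f ^^ j) y) \<in> SL2" using A_SL2 by blast
      then have "1 \<le> matrix_norm (A ((f ^^ j) y))" by (rule matrix_norm_SL2)
      moreover have "matrix_norm (A ((f ^^ j) y)) \<le> C" using A_norm B(3) by simp
      ultimately show "ln (matrix_norm (A ((f ^^ j) y))) \<le> ln C" by (intro ln_mono) auto
    qed
    finally show ?thesis by simp
  qed
  have crude2: "log_growth f A n y \<le> 2 * real N * ln C" if "n < 2 * N" for n y
  proof -
    have "real n * ln C \<le> real (2 * N) * ln C" using that lnC by (intro mult_right_mono) auto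
    then show ?thesis using crude[of n y] by simp
  qed
  have onE: "log_growth f A n x \<le> 2 * real N * ln C + real (n div N) * ln (C\<^sup>2 + 1)" if "x \<in> E" for n x
    using that
  proof (induction n arbitrary: x rule: less_induct)
    case (less n)
    have xX: "x \<in> X" using less.prems E(2) by blast
    show ?case
    proof (cases "n < r x")
      case True
      then have "log_growth f A n x \<le> 2 * real N * ln C" using r(3)[OF xX] by (intro crude2) simp
      moreover have "0 \<le> real (n div N) * ln (C\<^sup>2 + 1)" using lnC2 by simp
      ultimately show ?thesis by linarith
    next
      case False
      define n' where "n' = n - r x"
      have n: "n = n' + r x" "n' < n" using False r(1)[OF xX] by (auto simp: n'_def)
      have "log_growth f A n x \<le> log_growth f A n' ((f ^^ r x) x) + log_growth f A (r x) x"
        unfolding n(1) by (rule log_growth_add[OF A_SL2])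
      also have "\<dots> \<le> (2 * real N * ln C + real (n' div N) * ln (C\<^sup>2 + 1)) + ln (C\<^sup>2 + 1)"
        using less.IH[OF n(2) r(2)[OF xX]] column[OF less.prems] by (rule add_mono)
      also have "\<dots> = 2 * real N * ln C + real (n' div N + 1) * ln (C\<^sup>2 + 1)" by (simp add: algebra_simps)
      also have "\<dots> \<le> 2 * real N * ln C + real (n div N) * ln (C\<^sup>2 + 1)"
      proof -
        have "n' div N + 1 = (n' + N) div N" using N by simp
        also have "\<dots> \<le> n div N" using r_N[OF less.prems] n(1) by (intro div_le_mono) simp
        finally show ?thesis using lnC2 by (intro add_left_mono mult_right_mono) auto
      qed
      finally show ?thesis .
    qed
  qed
  have onX: "log_growth f A n x \<le> 4 * real N * ln C + real (n div N) * ln (C\<^sup>2 + 1)" if "x \<in> X" for n x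
  proof (cases "n < r x")
    case True
    then have "log_growth f A n x \<le> 2 * real N * ln C" using r(3)[OF that] by (intro crude2) simp
    moreover have "0 \<le> real (n div N) * ln (C\<^sup>2 + 1)" "0 \<le> real N * ln C" using lnC lnC2 by simp_all
    ultimately show ?thesis by linarith
  next
    case False
    define n' where "n' = n - r x"
    have n: "n = n' + r x" using False by (simp add: n'_def)
    have "log_growth f A n x \<le> log_growth f A n' ((f ^^ r x) x) + log_growth f A (r x) x"
      unfolding n by (rule log_growth_add[OF A_SL2])
    also have "\<dots> \<le> (2 * real N * ln C + real (n' div N) * ln (C\<^sup>2 + 1)) + 2 * real N * ln C"
      using onE[OF r(2)[OF that]] crude2[OF r(3)[OF that]] by (rule add_mono)
    also have "real (n' div N) * ln (C\<^sup>2 + 1) \<le> real (n div N) * ln (C\<^sup>2 + 1)"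
      using n lnC2 by (intro mult_right_mono) (auto intro: div_le_mono)
    finally show ?thesis by simp
  qed
  have ne_Z: "{x. A x \<noteq> B x} \<subseteq> Z" using A_B by blast
  have ne: "{x. A x \<noteq> B x} \<in> sets \<mu>"
  proof -
    note [measurable] = A_meas
    have "{x \<in> space \<mu>. A x = B x} \<in> sets \<mu>" by (rule measurable_equality_set[OF A_meas B(1)])
    then have "UNIV - {x. A x = B x} \<in> sets \<mu>" using sets.top[of \<mu>] by (intro sets.Diff) auto
    moreover have "UNIV - {x. A x = B x} = {x. A x \<noteq> B x}" by auto
    ultimately show ?thesis by simp
  qed
  have "measure \<mu> {x. A x \<noteq> B x} \<le> measure \<mu> UNIV / real N"
  proof -
    have "emeasure \<mu> Z \<le> (\<Sum>j. emeasure \<mu> (Y j))"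
      unfolding Z_def using Y by (intro emeasure_subadditive_countably) auto
    also have "\<dots> = (\<Sum>j. emeasure \<mu> (Ej j))" by (simp add: emeasure_eq_measure Y)
    also have "\<dots> = emeasure \<mu> (\<Union>j. Ej j)"
      using Ej by (intro suminf_emeasure) (auto simp: disjoint_family_on_def Ej_def)
    also have "(\<Union>j. Ej j) = E" by (auto simp: Ej_def)
    finally have "measure \<mu> Z \<le> measure \<mu> E" by (simp add: emeasure_eq_measure)
    moreover have "measure \<mu> {x. A x \<noteq> B x} \<le> measure \<mu> Z" using ne_Z Z by (intro finite_measure_mono)
    moreover have "measure \<mu> E \<le> measure \<mu> UNIV / real N" by (rule marker_measure[OF f N E(1) sep])
    ultimately show ?thesis by linarith
  qed
  moreover have "AE x in \<mu>. \<forall>n. log_growth f A n x \<le> 4 * real N * ln C + real (n div N) * ln (C\<^sup>2 + 1)"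
    using aper by eventually_elim (use onX in \<open>simp add: X_def\<close>)
  ultimately show ?thesis using that[OF A_meas A_SL2 A_norm ne] by blast
qed

text \<open>
  After truncation of the large values of \<open>A\<close>, the rotations of \<open>bounded_cocycle_slowed\<close> change the
  cocycle on a set of small measure without increasing its norm, hence little in \<open>L\<^sup>p\<close>.
\<close>

lemma slow_growth_Lp_dense:
  assumes p: "1 \<le> p" and f: "f \<in> automorphisms \<mu>" and aper: "AE x in \<mu>. \<forall>m>0. (f ^^ m) x \<noteq> x"
    and A: "A \<in> Lp_maps \<mu> p" and e: "0 < e"
  obtains A' where "A' \<in> Lp_maps \<mu> p" "(\<integral>x. matrix_norm (A x - A' x) powr p \<partial>\<mu>) < e" "slow_growth \<mu> k f A'"
proof -
  note [measurable] = Lp_maps_measurable[OF A] automorphism_measurable[OF f]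
  have A_ge1: "1 \<le> matrix_norm (A x)" for x by (rule Lp_maps_norm_ge_1[OF A])
  define w where "w = (\<lambda>x. 2 powr p * matrix_norm (A x) powr p)"
  have w: "integrable \<mu> w" unfolding w_def using Lp_maps_integrable[OF A] by simp
  obtain d where d: "0 < d" "\<And>Z. Z \<in> sets \<mu> \<Longrightarrow> measure \<mu> Z < d \<Longrightarrow> (\<integral>x. indicator Z x * w x \<partial>\<mu>) < e"
    using integral_small_on_small_sets[OF w e] by blast
  have L_sets: "{x. c < matrix_norm (A x)} \<in> sets \<mu>" for c
    by (rule Collect_in_sets) measurable
  have "(\<lambda>n. measure \<mu> {x. real (Suc n) < matrix_norm (A x)}) \<longlonglongrightarrow> measure \<mu> (\<Inter>n. {x. real (Suc n) < matrix_norm (A x)})"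
    using L_sets by (intro finite_Lim_measure_decseq decseq_SucI) auto
  also have "(\<Inter>n. {x. real (Suc n) < matrix_norm (A x)}) = {}"
  proof -
    have "\<exists>n. \<not> real (Suc n) < matrix_norm (A x)" for x
    proof -
      obtain n where "matrix_norm (A x) < real n" using reals_Archimedean2 by blast
      then have "\<not> real (Suc n) < matrix_norm (A x)" by simp
      then show ?thesis by blast
    qed
    then show ?thesis by blast
  qed
  finally have "\<forall>\<^sub>F n in sequentially. measure \<mu> {x. real (Suc n) < matrix_norm (A x)} < d / 2"
    using d by (intro order_tendstoD(2)) auto
  then obtain n0 where n0: "measure \<mu> {x. real (Suc n0) < matrix_norm (A x)} < d / 2"
    by (auto simp: eventually_sequentially)
  define C where "C = real (Suc n0)"
  have C: "1 \<le> C" by (simp add: C_def)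
  define B where "B = (\<lambda>x. if matrix_norm (A x) \<le> C then A x else mat 1)"
  have B: "B \<in> borel_measurable \<mu>" "range B \<subseteq> SL2" "matrix_norm (B x) \<le> C" "matrix_norm (B x) \<le> matrix_norm (A x)" for x
  proof -
    show "B \<in> borel_measurable \<mu>" unfolding B_def by measurable
    show "range B \<subseteq> SL2" using Lp_maps_SL2[OF A] SL2_one by (auto simp: B_def)
    show "matrix_norm (B x) \<le> C" "matrix_norm (B x) \<le> matrix_norm (A x)" using C A_ge1[of x] by (simp_all add: B_def)
  qed
  define b where "b = ln C + ln (C\<^sup>2 + 1)"
  have b: "0 \<le> b" using C by (simp add: b_def)
  obtain N where N: "2 * measure \<mu> UNIV / d + b * real (Suc k) < real N" using reals_Archimedean2 by blast
  have t: "0 \<le> 2 * measure \<mu> UNIV / d" "0 \<le> b * real (Suc k)" using d b by simp_all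
  have N1: "1 \<le> N" using N t by (cases N) auto
  have "2 * measure \<mu> UNIV / d < real N" using N t by linarith
  then have N2: "measure \<mu> UNIV / real N < d / 2" using d N1 by (simp add: field_simps)
  have N3: "b * real (Suc k) < real N" using N t by linarith
  obtain A' where A': "A' \<in> borel_measurable \<mu>" "range A' \<subseteq> SL2" "\<And>x. matrix_norm (A' x) = matrix_norm (B x)"
    "{x. A' x \<noteq> B x} \<in> sets \<mu>" "measure \<mu> {x. A' x \<noteq> B x} \<le> measure \<mu> UNIV / real N"
    and growth: "AE x in \<mu>. \<forall>n. log_growth f A' n x \<le> 4 * real N * ln C + real (n div N) * ln (C\<^sup>2 + 1)"
    using bounded_cocycle_slowed[OF f aper B(1,2,3) N1] by blast
  note [measurable] = A'(1)
  have le: "matrix_norm (A' x) \<le> matrix_norm (A x)" for x using A'(3) B(4) by simp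
  have A'_Lp: "A' \<in> Lp_maps \<mu> p"
  proof -
    have "integrable \<mu> (\<lambda>x. matrix_norm (A' x) powr p)"
    proof (rule Bochner_Integration.integrable_bound[OF Lp_maps_integrable[OF A]])
      show "(\<lambda>x. matrix_norm (A' x) powr p) \<in> borel_measurable \<mu>" by measurable
      show "AE x in \<mu>. norm (matrix_norm (A' x) powr p) \<le> norm (matrix_norm (A x) powr p)"
        using le p by (intro AE_I2) (auto intro!: powr_mono2)
    qed
    then show ?thesis using A' by (simp add: Lp_maps_def)
  qed
  define Z where "Z = {x. C < matrix_norm (A x)} \<union> {x. A' x \<noteq> B x}"
  have Z: "Z \<in> sets \<mu>" unfolding Z_def using L_sets A'(4) by (intro sets.Un)
  have "measure \<mu> Z \<le> measure \<mu> {x. C < matrix_norm (A x)} + measure \<mu> {x. A' x \<noteq> B x}"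
    unfolding Z_def using L_sets A'(4) by (intro measure_Un_le)
  also have "\<dots> < d"
  proof -
    have "measure \<mu> {x. C < matrix_norm (A x)} < d / 2" using n0 by (simp only: C_def)
    then show ?thesis using A'(5) N2 by linarith
  qed
  finally have mZ: "measure \<mu> Z < d" .
  have "(\<integral>x. matrix_norm (A x - A' x) powr p \<partial>\<mu>) \<le> (\<integral>x. indicator Z x * w x \<partial>\<mu>)"
  proof (rule integral_mono)
    show "integrable \<mu> (\<lambda>x. matrix_norm (A x - A' x) powr p)" by (rule integrable_Lp_diff[OF p A A'_Lp])
    show "integrable \<mu> (\<lambda>x. indicator Z x * w x)"
      using integrable_real_mult_indicator[OF Z w] by (simp add: mult.commute)
    fix x
    show "matrix_norm (A x - A' x) powr p \<le> indicator Z x * w x"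
    proof (cases "x \<in> Z")
      case True
      have "matrix_norm (A x - A' x) \<le> 2 * matrix_norm (A x)"
        using matrix_norm_diff_le[of "A x" "A' x"] le[of x] by simp
      then have "matrix_norm (A x - A' x) powr p \<le> (2 * matrix_norm (A x)) powr p"
        using p by (intro powr_mono2) auto
      also have "\<dots> = w x" unfolding w_def by (rule powr_mult)
      finally show ?thesis using True by simp
    next
      case False
      then have "A' x = A x" by (auto simp: Z_def B_def)
      then show ?thesis using False by (simp add: matrix_norm_0_iff[THEN iffD2])
    qed
  qed
  also have "\<dots> < e" by (rule d(2)[OF Z mZ])
  finally have close: "(\<integral>x. matrix_norm (A x - A' x) powr p \<partial>\<mu>) < e" .
  have "slow_growth \<mu> k f A'"
    unfolding slow_growth_def
  proof (intro exI[of _ "4 * N * N"] conjI)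
    define n where "n = 4 * N * N"
    show "1 \<le> 4 * N * N" using N1 by simp
    have "AE x in \<mu>. x \<notin> {x. real n / real (Suc k) \<le> log_growth f A' n x}"
      using growth
    proof eventually_elim
      case (elim x)
      have "log_growth f A' n x \<le> 4 * real N * ln C + real (n div N) * ln (C\<^sup>2 + 1)" using elim by blast
      also have "n div N = 4 * N" using N1 by (simp add: n_def)
      also have "4 * real N * ln C + real (4 * N) * ln (C\<^sup>2 + 1) = 4 * real N * b" by (simp add: b_def algebra_simps)
      also have "\<dots> < real n / real (Suc k)"
      proof -
        have "4 * real N * (b * real (Suc k)) < 4 * real N * real N"
          using N3 N1 by (intro mult_strict_left_mono) auto
        then have "4 * real N * b * real (Suc k) < real n" by (simp add: n_def mult.assoc)
        then show ?thesis by (subst pos_less_divide_eq) auto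
      qed
      finally show ?case by simp
    qed
    moreover have S: "{x. real n / real (Suc k) \<le> log_growth f A' n x} \<in> sets \<mu>"
      by (rule Collect_in_sets) measurable
    ultimately have "emeasure \<mu> {x. real n / real (Suc k) \<le> log_growth f A' n x} = 0"
      using AE_iff_measurable[OF S, of "\<lambda>x. \<not> real n / real (Suc k) \<le> log_growth f A' n x"] by simp
    then show "measure \<mu> {x. real (4 * N * N) / real (Suc k) \<le> log_growth f A' (4 * N * N) x} < 1 / real (Suc k)"
      by (simp add: measure_def n_def)
  qed
  with A'_Lp close show ?thesis by (rule that)
qed

end

section \<open>Density of slow pairs\<close>

context finite_measure_on_borel
begin

text \<open>
  Weak neighbourhoods only see finitely many sets, so they contain every perturbation of \<open>f\<close> by an
  automorphism that leaves these sets invariant.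
\<close>

lemma weak_open_contains_perturbations:
  assumes V: "openin (weak_topology \<mu>) V" and f: "f \<in> automorphisms \<mu>" and fV: "ae_class \<mu> (automorphisms \<mu>) f \<in> V"
  shows "\<exists>Ks. set Ks \<subseteq> sets \<mu> \<and> (\<forall>T\<in>automorphisms \<mu>. (\<forall>K\<in>set Ks. T ` K = K) \<longrightarrow>
    ae_class \<mu> (automorphisms \<mu>) (f \<circ> T) \<in> V)"
proof -
  define cls where "cls = ae_class \<mu> (automorphisms \<mu>)"
  have cls: "cls g \<in> Aut \<mu>" "g \<in> cls g" if "g \<in> automorphisms \<mu>" for g
    using ae_class_in_quotient[OF that] self_in_ae_class[OF that] by (auto simp: cls_def Aut_def)
  have "generate_topology_on {weak_nbhd \<mu> f K e | f K e. f \<in> automorphisms \<mu> \<and> K \<in> sets \<mu> \<and> e > 0} V"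
    using V unfolding weak_topology_def openin_topology_generated_by_iff .
  then have "cls f \<in> V \<longrightarrow> (\<exists>Ks. set Ks \<subseteq> sets \<mu> \<and> (\<forall>T\<in>automorphisms \<mu>. (\<forall>K\<in>set Ks. T ` K = K) \<longrightarrow> cls (f \<circ> T) \<in> V))"
  proof (induction rule: generate_topology_on.induct)
    case Empty
    then show ?case by simp
  next
    case (Int a b)
    show ?case
    proof
      assume "cls f \<in> a \<inter> b"
      then obtain Ka Kb where "set Ka \<subseteq> sets \<mu>" "\<forall>T\<in>automorphisms \<mu>. (\<forall>K\<in>set Ka. T ` K = K) \<longrightarrow> cls (f \<circ> T) \<in> a"
        "set Kb \<subseteq> sets \<mu>" "\<forall>T\<in>automorphisms \<mu>. (\<forall>K\<in>set Kb. T ` K = K) \<longrightarrow> cls (f \<circ> T) \<in> b"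
        using Int.IH by blast
      then show "\<exists>Ks. set Ks \<subseteq> sets \<mu> \<and> (\<forall>T\<in>automorphisms \<mu>. (\<forall>K\<in>set Ks. T ` K = K) \<longrightarrow> cls (f \<circ> T) \<in> a \<inter> b)"
        by (intro exI[of _ "Ka @ Kb"]) auto
    qed
  next
    case (UN \<K>)
    show ?case
    proof
      assume "cls f \<in> \<Union>\<K>"
      then obtain k where k: "k \<in> \<K>" "cls f \<in> k" by blast
      then obtain Ks where "set Ks \<subseteq> sets \<mu>" "\<forall>T\<in>automorphisms \<mu>. (\<forall>K\<in>set Ks. T ` K = K) \<longrightarrow> cls (f \<circ> T) \<in> k"
        using UN.IH[OF k(1)] by blast
      then show "\<exists>Ks. set Ks \<subseteq> sets \<mu> \<and> (\<forall>T\<in>automorphisms \<mu>. (\<forall>K\<in>set Ks. T ` K = K) \<longrightarrow> cls (f \<circ> T) \<in> \<Union>\<K>)"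
        using k(1) by (intro exI[of _ Ks]) auto
    qed
  next
    case (Basis U)
    then obtain f1 K e where U: "U = weak_nbhd \<mu> f1 K e" and f1: "f1 \<in> automorphisms \<mu>" and K: "K \<in> sets \<mu>"
      by blast
    show ?case
    proof
      assume "cls f \<in> U"
      then obtain g where g: "g \<in> cls f" "measure \<mu> (sym_diff (g ` K) (f1 ` K)) < e"
        unfolding U weak_nbhd_def by blast
      have g': "g \<in> automorphisms \<mu>" "AE x in \<mu>. g x = f x"
        using Aut_rep(3,4)[OF cls(1)[OF f]] g(1) cls(2)[OF f] by blast+
      have "measure \<mu> (sym_diff (g ` K) (f1 ` K)) = measure \<mu> (sym_diff (f ` K) (f1 ` K))"
        using g' f f1 K by (intro measure_sym_diff_ae) auto
      then have fK: "measure \<mu> (sym_diff (f ` K) (f1 ` K)) < e" using g(2) by simp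
      have "cls (f \<circ> T) \<in> U" if T: "T \<in> automorphisms \<mu>" "T ` K = K" for T
      proof -
        have "(f \<circ> T) ` K = f ` K" using T(2) by (simp only: image_comp[symmetric])
        then have "measure \<mu> (sym_diff ((f \<circ> T) ` K) (f1 ` K)) < e" using fK by simp
        then show ?thesis
          unfolding U weak_nbhd_def using cls[OF automorphism_comp[OF f T(1)]] by blast
      qed
      then show "\<exists>Ks. set Ks \<subseteq> sets \<mu> \<and> (\<forall>T\<in>automorphisms \<mu>. (\<forall>K\<in>set Ks. T ` K = K) \<longrightarrow> cls (f \<circ> T) \<in> U)"
        using K by (intro exI[of _ "[K]"]) auto
    qed
  qed
  then show ?thesis using fV by (simp add: cls_def)
qed

lemma trivial_spectrum_if_slow_pairs:
  assumes p: "1 \<le> p" and slow: "\<And>k. (F, \<alpha>) \<in> slow_pairs p k" and f: "f \<in> F" and A: "A \<in> \<alpha>"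
  shows "trivial_spectrum \<mu> f A"
proof -
  have F: "F \<in> Aut \<mu>" "\<alpha> \<in> Lp_SL2 \<mu> p" using slow[of 0] by (auto simp: slow_pairs_def)
  have f': "f \<in> automorphisms \<mu>" by (rule Aut_rep(3)[OF F(1) f])
  have A': "A \<in> Lp_maps \<mu> p" by (rule Lp_rep(3)[OF F(2) A])
  note [measurable] = Lp_maps_measurable[OF A']
  have "integrable \<mu> (\<lambda>x. ln (matrix_norm (A x)))"
  proof (rule Bochner_Integration.integrable_bound[OF Lp_maps_integrable[OF A']])
    show "(\<lambda>x. ln (matrix_norm (A x))) \<in> borel_measurable \<mu>" by measurable
    show "AE x in \<mu>. norm (ln (matrix_norm (A x))) \<le> norm (matrix_norm (A x) powr p)"
    proof (rule AE_I2)
      fix x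
      define t where "t = matrix_norm (A x)"
      have t: "1 \<le> t" unfolding t_def by (rule Lp_maps_norm_ge_1[OF A'])
      have "ln t \<le> t - 1" using t by (intro ln_le_minus_one) simp
      also have "\<dots> \<le> t powr 1" using t by simp
      also have "\<dots> \<le> t powr p" using t p by (intro powr_mono) auto
      finally have "ln t \<le> t powr p" .
      moreover have "0 \<le> ln t" using t by simp
      ultimately show "norm (ln (matrix_norm (A x))) \<le> norm (matrix_norm (A x) powr p)" by (simp add: t_def)
    qed
  qed
  moreover have "slow_growth \<mu> k f A" for k
    using slow[of k] slow_pairs_iff[OF F f A] by simp
  ultimately show ?thesis
    using trivial_spectrum_if_slow_growth[OF f' Lp_maps_measurable[OF A'] Lp_maps_SL2[OF A']] by blast
qed

text \<open>
  Density in the separate topology: a point of an open set is moved inside it first along the section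
  of fixed cocycle, to make the map aperiodic, and then along the section of the new map, to make the
  growth slow. The second displacement may be arbitrarily small after the first one has been fixed.
\<close>

lemma residual_slow_pairs:
  fixes U :: "nat \<Rightarrow> 'a set" and h :: "nat \<Rightarrow> 'a \<Rightarrow> real" and g :: "nat \<Rightarrow> real \<Rightarrow> 'a"
  assumes p: "1 \<le> p" and atomless: "\<And>x. measure \<mu> {x} = 0"
    and U: "\<And>i. U i \<in> sets \<mu>" "(\<Union>i. U i) = UNIV"
    and hg: "\<And>i. h i \<in> borel_measurable \<mu>" "\<And>i. g i \<in> measurable borel \<mu>" "\<And>i x. x \<in> U i \<Longrightarrow> g i (h i x) = x"
  shows "residual_in (separate_topology (weak_topology \<mu>) (Lp_topology \<mu> p)) (\<Inter>k. slow_pairs p k)"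
proof -
  have aper: "\<exists>T\<in>automorphisms \<mu>. (\<forall>x. x \<notin> D \<longrightarrow> T x = x) \<and> (\<forall>x\<in>D. T x \<in> D) \<and>
      (\<forall>x. (l (T x) :: nat) = l x) \<and> (AE x in \<mu>. x \<in> D \<longrightarrow> (\<forall>m>0. (T ^^ m) x \<noteq> x))"
    if "D \<in> sets \<mu>" "l \<in> measurable \<mu> (count_space UNIV)" for D l
    by (rule aperiodic_on_set[OF atomless U hg(1,2) _ that]) (rule hg(3))
  let ?Z = "separate_topology (weak_topology \<mu>) (Lp_topology \<mu> p)"
  have top: "topspace ?Z = Aut \<mu> \<times> Lp_SL2 \<mu> p"
    by (simp add: topspace_separate_topology topspace_weak_topology topspace_Lp_topology[OF p])
  have "?Z closure_of slow_pairs p k = topspace ?Z" for k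
    unfolding dense_intersects_open
  proof (intro allI impI)
    fix S assume S: "openin ?Z S \<and> S \<noteq> {}"
    then have so: "separately_open (weak_topology \<mu>) (Lp_topology \<mu> p) S" by (simp add: openin_separate_topology)
    obtain F \<alpha> where F\<alpha>: "(F, \<alpha>) \<in> S" using S by auto
    have sub: "S \<subseteq> Aut \<mu> \<times> Lp_SL2 \<mu> p" using openin_subset[of ?Z S] S top by simp
    have F: "F \<in> Aut \<mu>" "\<alpha> \<in> Lp_SL2 \<mu> p" using F\<alpha> sub by auto
    have sec: "openin (weak_topology \<mu>) {F' \<in> Aut \<mu>. (F', \<alpha>') \<in> S}"
        "openin (Lp_topology \<mu> p) {\<alpha>'' \<in> Lp_SL2 \<mu> p. (F', \<alpha>'') \<in> S}" if "(F', \<alpha>') \<in> S" for F' \<alpha>'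
      using so that unfolding separately_open_def topspace_weak_topology topspace_Lp_topology[OF p] by blast+
    define cls where "cls = (\<lambda>f. ae_class \<mu> (automorphisms \<mu>) f)"
    define f where "f = rep F"
    have f: "f \<in> automorphisms \<mu>" "f \<in> F" using Aut_rep(1,2)[OF F(1)] by (simp_all add: f_def)
    have "cls f = F" unfolding cls_def by (rule ae_class_of_member[OF F(1)[unfolded Aut_def] f(2)])
    then have "cls f \<in> {F' \<in> Aut \<mu>. (F', \<alpha>) \<in> S}" using F\<alpha> F by simp
    then obtain Ks where Ks: "set Ks \<subseteq> sets \<mu>"
      "\<forall>T\<in>automorphisms \<mu>. (\<forall>K\<in>set Ks. T ` K = K) \<longrightarrow> cls (f \<circ> T) \<in> {F' \<in> Aut \<mu>. (F', \<alpha>) \<in> S}"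
      using weak_open_contains_perturbations[OF sec(1)[OF F\<alpha>] f(1)] unfolding cls_def by blast
    obtain T where T: "T \<in> automorphisms \<mu>" "\<forall>K\<in>set Ks. T ` K = K" "AE x in \<mu>. \<forall>m>0. ((f \<circ> T) ^^ m) x \<noteq> x"
      using aperiodic_perturbation[OF f(1) Ks(1) aper] by blast
    define f' where "f' = f \<circ> T"
    have f': "f' \<in> automorphisms \<mu>" unfolding f'_def by (rule automorphism_comp[OF f(1) T(1)])
    have F'S: "cls f' \<in> Aut \<mu>" "(cls f', \<alpha>) \<in> S" using Ks(2) T(1,2) by (auto simp: f'_def)
    obtain r where r: "0 < r" "\<And>\<beta>. \<beta> \<in> Lp_SL2 \<mu> p \<Longrightarrow> Lp_dist \<mu> p \<alpha> \<beta> < r \<Longrightarrow> (cls f', \<beta>) \<in> S"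
      using sec(2)[OF F'S(2)] F(2) F'S(2) unfolding openin_Lp_topology[OF p] by blast
    define A where "A = rep \<alpha>"
    have A: "A \<in> Lp_maps \<mu> p" "A \<in> \<alpha>" using Lp_rep(1,2)[OF F(2)] by (simp_all add: A_def)
    have rp: "0 < r powr p" using r by simp
    obtain A' where A': "A' \<in> Lp_maps \<mu> p" "(\<integral>x. matrix_norm (A x - A' x) powr p \<partial>\<mu>) < r powr p" "slow_growth \<mu> k f' A'"
      by (rule slow_growth_Lp_dense[OF p f' T(3)[folded f'_def] A(1) rp])
    define \<beta> where "\<beta> = ae_class \<mu> (Lp_maps \<mu> p) A'"
    have \<beta>: "\<beta> \<in> Lp_SL2 \<mu> p" "A' \<in> \<beta>"
      unfolding \<beta>_def Lp_SL2_def using ae_class_in_quotient[OF A'(1)] self_in_ae_class[OF A'(1)] by auto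
    have "Lp_dist \<mu> p \<alpha> \<beta> = (\<integral>x. matrix_norm (A x - A' x) powr p \<partial>\<mu>) powr (1 / p)"
      by (rule Lp_dist_eq[OF F(2) A(2) \<beta>])
    also have "\<dots> < (r powr p) powr (1 / p)"
      using A'(2) p by (intro powr_less_mono2) auto
    also have "\<dots> = r" using r p by (simp add: powr_powr)
    finally have "(cls f', \<beta>) \<in> S" by (rule r(2)[OF \<beta>(1)])
    moreover have "(cls f', \<beta>) \<in> slow_pairs p k"
      using slow_pairs_iff[OF F'S(1) \<beta>(1) _ \<beta>(2)] self_in_ae_class[OF f'] A'(3) unfolding cls_def by blast
    ultimately show "slow_pairs p k \<inter> S \<noteq> {}" by blast
  qed
  moreover have "(\<Inter>k. slow_pairs p k) \<subseteq> topspace ?Z" unfolding top by (auto simp: slow_pairs_def)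
  ultimately show ?thesis
    unfolding residual_in_def using openin_slow_pairs[OF p]
    by (intro conjI exI[of _ "range (slow_pairs p)"]) auto
qed

end

theorem corollary4p1:
  fixes \<A> :: "('a::{t2_space, second_countable_topology}, 'n::finite) chart set"
    and g :: "('a, 'n) chart \<Rightarrow> real^'n \<Rightarrow> real^'n^'n"
    and Leb :: "'a measure"
    and p :: real
  assumes "compact (UNIV :: 'a set)"
    and "smooth_atlas \<A>"
    and "CARD('n) \<ge> 2"
    and "riemannian_metric \<A> g"
    and "riemannian_volume \<A> g Leb"
    and "1 \<le> p"
  shows "\<exists>\<R> \<subseteq> Aut Leb \<times> Lp_SL2 Leb p.
           residual_in (separate_topology (weak_topology Leb) (Lp_topology Leb p)) \<R> \<and>
           (\<forall>(F, \<alpha>) \<in> \<R>. \<forall>f\<in>F. \<forall>A\<in>\<alpha>. trivial_spectrum Leb f A)"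
proof -
  note fin = riemannian_volume_finite_atomless[OF assms(1,2,4,5)]
  interpret finite_measure_on_borel Leb by (rule fin(1))
  have open_chart: "open (fst c)" and chart: "is_chart c" if "c \<in> \<A>" for c
    using assms(2) that by (auto simp: smooth_atlas_def is_chart_def)
  obtain \<C> where \<C>: "\<C> \<subseteq> \<A>" "finite \<C>" "UNIV \<subseteq> (\<Union>c\<in>\<C>. fst c)"
    by (rule compactE_image[OF assms(1), of \<A> fst]) (use open_chart assms(2) in \<open>auto simp: smooth_atlas_def\<close>)
  obtain cs where cs: "set cs = \<C>" using finite_list[OF \<C>(2)] by blast
  define U where "U = (\<lambda>i. if i < length cs then fst (cs ! i) else {})"
  have U_open: "open (U i)" for i
  proof (cases "i < length cs")
    case True
    then have "cs ! i \<in> \<A>" using cs \<C>(1) nth_mem by blast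
    then show ?thesis using open_chart True by (simp add: U_def)
  qed (simp add: U_def)
  have U_cover: "(\<Union>i. U i) = UNIV"
  proof (intro equalityI subsetI UNIV_I)
    fix x :: 'a
    obtain c where "c \<in> set cs" "x \<in> fst c" using \<C>(3) cs by blast
    then obtain i where "i < length cs" "x \<in> fst (cs ! i)" by (metis in_set_conv_nth)
    then have "x \<in> U i" by (simp add: U_def)
    then show "x \<in> (\<Union>i. U i)" by blast
  qed
  have "\<forall>i. \<exists>hg. fst hg \<in> borel_measurable borel \<and> snd hg \<in> borel_measurable borel \<and> (\<forall>x\<in>U i. snd hg (fst hg x :: real) = x)"
  proof
    fix i
    show "\<exists>hg. fst hg \<in> borel_measurable borel \<and> snd hg \<in> borel_measurable borel \<and> (\<forall>x\<in>U i. snd hg (fst hg x :: real) = x)"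
    proof (cases "i < length cs")
      case True
      then have "cs ! i \<in> \<A>" using cs \<C>(1) nth_mem by blast
      then obtain h :: "'a \<Rightarrow> real" and g where "h \<in> borel_measurable borel" "g \<in> borel_measurable borel"
        "\<And>x. x \<in> fst (cs ! i) \<Longrightarrow> g (h x) = x"
        using chart_coding[OF chart] by blast
      then show ?thesis using True by (intro exI[of _ "(h, g)"]) (simp add: U_def)
    next
      case False
      then show ?thesis by (intro exI[of _ "(\<lambda>x. 0, \<lambda>t. undefined)"]) (simp add: U_def)
    qed
  qed
  from choice[OF this] obtain hg where hg: "\<forall>i. fst (hg i) \<in> borel_measurable borel \<and> snd (hg i) \<in> borel_measurable borel \<and>
    (\<forall>x\<in>U i. snd (hg i) (fst (hg i) x :: real) = x)" ..
  have "residual_in (separate_topology (weak_topology Leb) (Lp_topology Leb p)) (\<Inter>k. slow_pairs p k)"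
  proof (rule residual_slow_pairs[OF assms(6) fin(2) _ U_cover])
    show "U i \<in> sets Leb" for i using U_open by (simp add: sets_eq_borel)
    show "fst (hg i) \<in> borel_measurable Leb" "snd (hg i) \<in> measurable borel Leb" for i
      using hg measurable_cong_sets[OF sets_eq_borel refl] measurable_cong_sets[OF refl sets_eq_borel] by blast+
    show "snd (hg i) (fst (hg i) x) = x" if "x \<in> U i" for i x using hg that by blast
  qed
  moreover have "(\<Inter>k. slow_pairs p k) \<subseteq> Aut Leb \<times> Lp_SL2 Leb p" by (auto simp: slow_pairs_def)
  moreover have "\<forall>(F, \<alpha>) \<in> (\<Inter>k. slow_pairs p k). \<forall>f\<in>F. \<forall>A\<in>\<alpha>. trivial_spectrum Leb f A"
  proof (intro ballI, clarify)
    fix F \<alpha> f A assume *: "(F, \<alpha>) \<in> (\<Inter>k. slow_pairs p k)" and fA: "f \<in> F" "A \<in> \<alpha>"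
    have "(F, \<alpha>) \<in> slow_pairs p k" for k using * by (rule INT_D) simp
    then show "trivial_spectrum Leb f A" by (rule trivial_spectrum_if_slow_pairs[OF assms(6) _ fA])
  qed
  ultimately show ?thesis by (intro exI[of _ "\<Inter>k. slow_pairs p k"] conjI)
qed

end
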